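(* Let $\mathsf{A},\mathsf{B},\mathsf{C}$ be finite-dimensional Hilbert spaces and let $\rho_{ABC}$ be a density operator (positive semidefinite, unit trace) on $\mathsf{A}\otimes\mathsf{B}\otimes\mathsf{C}$. Let $\alpha,\beta,\gamma \in (\tfrac12,1)\cup(1,\infty)$ satisfy $\frac{\alpha}{\alpha-1} = \frac{\beta}{\beta-1} + \frac{\gamma}{\gamma-1}$. Then \[ H_{\alpha}(AB|C)_{\rho} \geqslant H_{\beta}(A|BC)_{\rho} + H_{\gamma}(B|C)_{\rho} \quad\text{if } (\alpha-1)(\beta-1)(\gamma-1) > 0, \] and \[ H_{\alpha}(AB|C)_{\rho} \leqslant H_{\beta}(A|BC)_{\rho} + H_{\gamma}(B|C)_{\rho} \quad\text{if } (\alpha-1)(\beta-1)(\gamma-1) < 0. \] Here all entropies are evaluated on the appropriate marginals of $\rho_{ABC}$ (e.g. $H_\gamma(B|C)_\rho$ uses $\rho_{BC}=\operatorname{tr}_A\rho_{ABC}$).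
   Context: For $\alpha\in[\tfrac12,1)\cup(1,\infty)$ write $\alpha' = \frac{\alpha-1}{\alpha}$. For positive semidefinite $\rho,\sigma$ on a finite-dimensional Hilbert space, the (sandwiched) quantum Rényi divergence is \[ D_{\alpha}(\rho\|\sigma) := \frac{1}{\alpha-1}\log\left(\frac{1}{\operatorname{tr}[\rho]}\operatorname{tr}\left[\left(\sigma^{-\alpha'/2}\rho\,\sigma^{-\alpha'/2}\right)^{\alpha}\right]\right), \] except that $D_\alpha(\rho\|\sigma):=\infty$ if $\alpha>1$ and the support of $\rho$ is not contained in the support of $\sigma$ (negative powers of positive semidefinite operators are taken on their support). For a positive semidefinite $\rho_{XY}$ on $\mathsf{X}\otimes\mathsf{Y}$, the conditional Rényi entropy is $H_{\alpha}(X|Y)_{\rho} := -\inf_{\omega_Y} D_{\alpha}(\rho_{XY}\,\|\,\mathrm{id}_X\otimes\omega_Y)$, the infimum over density operators $\omega_Y$ on $\mathsf{Y}$. In $H_\alpha(AB|C)$ the conditioned system is $AB$ and the conditioning system is $C$; in $H_\beta(A|BC)$ the conditioning system is $BC$. *)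

theory Defs
  imports "HOL-Analysis.Analysis"
begin

text \<open>A finite-dimensional Hilbert space is modelled as complex^'n for a finite type 'n;
  operators on it are matrices complex^'n^'n.  The tensor product of spaces indexed
  by 'a and 'b is indexed by the product type 'a \<times> 'b.\<close>

definition adj :: "complex^'n^'m \<Rightarrow> complex^'m^'n" where
  "adj M = (\<chi> i j. cnj (M $ j $ i))"

definition unitary :: "complex^'n^'n \<Rightarrow> bool" where
  "unitary U \<longleftrightarrow> adj U ** U = mat 1 \<and> U ** adj U = mat 1"

definition diagm :: "('n \<Rightarrow> complex) \<Rightarrow> complex^'n^'n" where
  "diagm d = (\<chi> i j. if i = j then d i else 0)"

definition cinner :: "complex^'n \<Rightarrow> complex^'n \<Rightarrow> complex" where
  "cinner v w = (\<Sum>i\<in>UNIV. cnj (v $ i) * w $ i)"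

definition psd :: "complex^'n^'n \<Rightarrow> bool" where
  "psd M \<longleftrightarrow> adj M = M \<and> (\<forall>v. 0 \<le> Re (cinner v (M *v v)))"

definition density :: "complex^'n^'n \<Rightarrow> bool" where
  "density M \<longleftrightarrow> psd M \<and> trace M = 1"

definition supp :: "complex^'n^'n \<Rightarrow> (complex^'n) set" where
  "supp M = range (\<lambda>v. M *v v)"

text \<open>Real power of a positive semidefinite operator via a spectral decomposition,
  with the power taken on the support (zero eigenvalues are mapped to 0).\<close>
definition mpow :: "complex^'n^'n \<Rightarrow> real \<Rightarrow> complex^'n^'n" where
  "mpow M p = (SOME N. \<exists>U (d :: 'n \<Rightarrow> real). unitary U \<and>
      M = U ** diagm (\<lambda>i. complex_of_real (d i)) ** adj U \<and>
      N = U ** diagm (\<lambda>i. if d i > 0 then complex_of_real (d i powr p) else 0) ** adj U)"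

definition kron :: "complex^'a::finite^'a \<Rightarrow> complex^'b::finite^'b \<Rightarrow> complex^('a \<times> 'b)^('a \<times> 'b)" where
  "kron A B = (\<chi> p q. A $ fst p $ fst q * B $ snd p $ snd q)"

text \<open>Sandwiched Renyi divergence (natural logarithm; log 0 = -\<infinity>).\<close>
definition renyi_div :: "real \<Rightarrow> complex^'n^'n \<Rightarrow> complex^'n^'n \<Rightarrow> ereal" where
  "renyi_div \<alpha> \<rho> \<sigma> =
     (if \<alpha> > 1 \<and> \<not> supp \<rho> \<subseteq> supp \<sigma> then \<infinity>
      else (let a' = (\<alpha> - 1) / \<alpha>;
                S = mpow \<sigma> (- a' / 2);
                Q = Re (trace (mpow (S ** \<rho> ** S) \<alpha>)) / Re (trace \<rho>)
            in if Q = 0 then (if \<alpha> < 1 then \<infinity> else -\<infinity>)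
               else ereal (ln Q / (\<alpha> - 1))))"

definition cond_renyi :: "real \<Rightarrow> complex^('x::finite \<times> 'y::finite)^('x \<times> 'y) \<Rightarrow> ereal" where
  "cond_renyi \<alpha> \<rho> = - (INF \<omega> \<in> {\<omega> :: complex^'y^'y. density \<omega>}.
                           renyi_div \<alpha> \<rho> (kron (mat 1 :: complex^'x^'x) \<omega>))"

definition ptrace1 :: "complex^('a::finite \<times> 'b::finite)^('a \<times> 'b) \<Rightarrow> complex^'b^'b" where
  "ptrace1 \<rho> = (\<chi> i j. \<Sum>a\<in>UNIV. \<rho> $ (a, i) $ (a, j))"

definition regroup :: "complex^('a::finite \<times> 'b::finite \<times> 'c::finite)^('a \<times> 'b \<times> 'c) \<Rightarrow>
                       complex^(('a \<times> 'b) \<times> 'c)^(('a \<times> 'b) \<times> 'c)" where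
  "regroup \<rho> = (\<chi> p q. \<rho> $ (fst (fst p), snd (fst p), snd p) $ (fst (fst q), snd (fst q), snd q))"

end

theory Submission
  imports Defs "HOL-Complex_Analysis.Conformal_Mappings"
begin

text \<open>Put \<open>a = (\<alpha> - 1) / \<alpha>\<close> and similarly \<open>b\<close>, \<open>c\<close>, so that \<open>1 / a = 1 / b + 1 / c\<close>, and write the state as
  \<open>R ** adj R\<close>.  Each entropy is \<open>- ln N / a\<close>, where \<open>N\<close> is an infimum or supremum of Schatten
  quasi-norms of \<open>\<rho>\<close> sandwiched by powers of a density matrix, and the claim becomes a log-convexity
  inequality between three such quantities.  It follows from Hadamard's three lines theorem in the Frobenius
  norm, applied to products of complex powers of density matrices; the Schatten norms enter only through
  their variational formulas.  For \<open>a, b, c > 0\<close> the interpolating family is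
  \<open>T powr (b z / 2) ** T\<^sub>B\<^sub>C powr ((c (1 - z) - b z) / 2) ** \<omega>\<^sub>C powr (- c (1 - z) / 2) ** R\<close>, where \<open>T\<close> is dual to the
  minimiser \<open>\<omega>\<^sub>C\<close> and has (nearly) \<open>\<omega>\<^sub>C\<close> as its marginal; such a pair is a fixed point supplied by Brouwer's
  theorem, which also yields the duality \<open>H\<^sub>\<alpha>(A|B) = - H\<^sub>\<beta>(A|C)\<close> for pure states.  Three further sign patterns
  have their own interpolating families, and duality gives the remaining two.\<close>

subsection \<open>Complex matrices\<close>

text \<open>A Frobenius norm does not see unitaries on the two outer sides of a product. On the
  boundary of the strip, however, every complex power leaves an imaginary power in its own place,
  and matrices on nested systems do not commute. This obstacle shapes the families: each inner
  imaginary power must meet a bound that is uniform in a unitary inserted there, or it must be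
  avoided. For positive exponents the factor \<open>T\<^sub>B\<^sub>C\<close> has exponent 0 at the
  interpolation point and only links the two boundary problems: at one end it is the marginal of
  \<open>T\<close>, at the other the matrix whose own marginal is controlled by
  \<open>\<omega>\<^sub>C\<close>. The range \<alpha> > 1/2 amounts to -1 < a < 1, and duality is
  the reflection of a to -a. The relation 1/a = 1/b + 1/c excludes two of the eight sign patterns.
  The factors \<kappa> > 1 are present because optima over positive definite densities need not be
  attained and because the fixed point is regularised; they cost a multiple of ln \<kappa>, which
  disappears as \<kappa> tends to 1.\<close>

lemma matrix_nth_mult: "(A ** B) $ i $ j = (\<Sum>k\<in>UNIV. A $ i $ k * B $ k $ j)"
  by (simp add: matrix_matrix_mult_def)

lemma adj_nth [simp]: "adj M $ i $ j = cnj (M $ j $ i)"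
  by (simp add: adj_def)

lemma adj_adj [simp]: "adj (adj M) = M"
  by (simp add: vec_eq_iff)

lemma adj_mat_1 [simp]: "adj (mat 1) = mat 1"
  by (simp add: vec_eq_iff mat_def)

lemma adj_mult: "adj (A ** B) = adj B ** adj A"
  by (simp add: vec_eq_iff matrix_nth_mult mult.commute)

lemma adj_add: "adj (A + B) = adj A + adj B"
  by (simp add: vec_eq_iff)

lemma adj_minus: "adj (A - B) = adj A - adj B"
  by (simp add: vec_eq_iff)

lemma adj_scaleR: "adj (c *\<^sub>R A) = c *\<^sub>R adj A"
  by (simp add: vec_eq_iff scaleR_conv_of_real[where 'a=complex])

lemma diagm_nth: "diagm d $ i $ j = (if i = j then d i else 0)"
  by (simp add: diagm_def)

lemma adj_diagm [simp]: "adj (diagm d) = diagm (\<lambda>i. cnj (d i))"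
  by (simp add: vec_eq_iff diagm_nth)

lemma diagm_mult_nth: "(diagm d ** A) $ i $ j = d i * A $ i $ j"
  by (simp add: matrix_nth_mult diagm_nth if_distrib[where f="\<lambda>x. x * _"] cong: if_cong)

lemma mult_diagm_nth: "(A ** diagm d) $ i $ j = A $ i $ j * d j"
  by (simp add: matrix_nth_mult diagm_nth if_distrib[where f="\<lambda>x. _ * x"] cong: if_cong)

lemma diagm_mult: "diagm d ** diagm e = diagm (\<lambda>i. d i * e i)"
  by (simp add: vec_eq_iff diagm_mult_nth diagm_nth)

lemma diagm_1 [simp]: "diagm (\<lambda>i. 1) = mat 1"
  by (simp add: vec_eq_iff diagm_nth mat_def)

lemma trace_diagm: "trace (diagm d) = (\<Sum>i\<in>UNIV. d i)"
  by (simp add: trace_def diagm_nth)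

lemma trace_scaleR: "trace (c *\<^sub>R (A :: complex^'n^'n)) = c *\<^sub>R trace A"
  by (simp add: trace_def scaleR_sum_right)

lemma scaleR_mult_left: "(c *\<^sub>R (A :: complex^'n^'m)) ** B = c *\<^sub>R (A ** B)"
  by (simp add: vec_eq_iff matrix_nth_mult scaleR_sum_right)

lemma scaleR_mult_right: "(A :: complex^'n^'m) ** (c *\<^sub>R B) = c *\<^sub>R (A ** B)"
  by (simp add: vec_eq_iff matrix_nth_mult scaleR_sum_right)

lemma matrix_add_mult: "((A :: complex^'n^'m) + B) ** C = A ** C + B ** C"
  by (simp add: vec_eq_iff matrix_nth_mult sum.distrib distrib_right)

lemma matrix_diff_mult: "((A :: complex^'n^'m) - B) ** C = A ** C - B ** C"
  by (simp add: vec_eq_iff matrix_nth_mult sum_subtractf left_diff_distrib)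

lemma matrix_mult_diff: "(A :: complex^'n^'m) ** (B - C) = A ** B - A ** C"
  by (simp add: vec_eq_iff matrix_nth_mult sum_subtractf right_diff_distrib)

text \<open>Normal form for the simplifier: with products nested to the right, cancellation rules
  such as \<open>unitary_cancel1\<close> and \<open>mpow_add_left\<close> apply inside longer
  products.\<close>

lemmas mult_right_assoc = matrix_mul_assoc[symmetric]

lemma norm_matrix_sq: "(norm (M :: complex^'n^'m))\<^sup>2 = (\<Sum>i\<in>UNIV. \<Sum>j\<in>UNIV. (cmod (M $ i $ j))\<^sup>2)"
  by (simp add: norm_vec_def L2_set_def sum_nonneg real_sqrt_pow2)

lemma norm_sq_trace: "(norm (M :: complex^'n^'m))\<^sup>2 = Re (trace (M ** adj M))"
  unfolding norm_matrix_sq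
  by (simp add: trace_def matrix_nth_mult cmod_power2) (simp add: power2_eq_square)

lemma norm_sq_trace': "(norm (M :: complex^'n^'m))\<^sup>2 = Re (trace (adj M ** M))"
  unfolding norm_sq_trace by (subst trace_mul_sym) (rule refl)

lemma norm_adj [simp]: "norm (adj M) = norm M"
  by (rule power2_eq_imp_eq) (simp_all only: norm_sq_trace[of "adj M"] norm_sq_trace'[of M] adj_adj norm_ge_zero)

lemma norm_matrix_mult: "norm ((A :: complex^'n^'m) ** (B :: complex^'k^'n)) \<le> norm A * norm B"
proof (rule power2_le_imp_le)
  have "(norm (A ** B))\<^sup>2 = (\<Sum>i\<in>UNIV. \<Sum>j\<in>UNIV. (cmod (\<Sum>k\<in>UNIV. A $ i $ k * B $ k $ j))\<^sup>2)"
    by (simp add: norm_matrix_sq matrix_nth_mult)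
  also have "\<dots> \<le> (\<Sum>i\<in>UNIV. \<Sum>j\<in>UNIV. (\<Sum>k\<in>UNIV. (cmod (A $ i $ k))\<^sup>2) * (\<Sum>k\<in>UNIV. (cmod (B $ k $ j))\<^sup>2))"
  proof (intro sum_mono)
    fix i j
    have "cmod (\<Sum>k\<in>UNIV. A $ i $ k * B $ k $ j) \<le> (\<Sum>k\<in>UNIV. cmod (A $ i $ k) * cmod (B $ k $ j))"
      by (rule order_trans[OF norm_sum]) (simp add: norm_mult)
    then have "(cmod (\<Sum>k\<in>UNIV. A $ i $ k * B $ k $ j))\<^sup>2 \<le> (\<Sum>k\<in>UNIV. cmod (A $ i $ k) * cmod (B $ k $ j))\<^sup>2"
      by (rule power_mono) simp
    also have "\<dots> \<le> (\<Sum>k\<in>UNIV. (cmod (A $ i $ k))\<^sup>2) * (\<Sum>k\<in>UNIV. (cmod (B $ k $ j))\<^sup>2)"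
      by (rule Cauchy_Schwarz_ineq_sum)
    finally show "(cmod (\<Sum>k\<in>UNIV. A $ i $ k * B $ k $ j))\<^sup>2
        \<le> (\<Sum>k\<in>UNIV. (cmod (A $ i $ k))\<^sup>2) * (\<Sum>k\<in>UNIV. (cmod (B $ k $ j))\<^sup>2)" .
  qed
  also have "\<dots> = (norm A)\<^sup>2 * (\<Sum>j\<in>UNIV. \<Sum>k\<in>UNIV. (cmod (B $ k $ j))\<^sup>2)"
    unfolding norm_matrix_sq by (rule sum_product[symmetric])
  also have "(\<Sum>j\<in>UNIV. \<Sum>k\<in>UNIV. (cmod (B $ k $ j))\<^sup>2) = (norm B)\<^sup>2"
    unfolding norm_matrix_sq by (rule sum.swap)
  finally show "(norm (A ** B))\<^sup>2 \<le> (norm A * norm B)\<^sup>2"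
    by (simp add: power_mult_distrib)
qed simp

subsection \<open>Unitary matrices\<close>

lemma unitary_adj_mult [simp]: "unitary U \<Longrightarrow> adj U ** U = mat 1"
  and unitary_mult_adj [simp]: "unitary U \<Longrightarrow> U ** adj U = mat 1"
  by (simp_all add: unitary_def)

lemma unitary_cancel1 [simp]: "unitary U \<Longrightarrow> adj U ** (U ** M) = M"
  and unitary_cancel2 [simp]: "unitary U \<Longrightarrow> U ** (adj U ** M) = M"
  by (simp_all add: matrix_mul_assoc)

lemma unitary_mat_1 [simp]: "unitary (mat 1)"
  unfolding unitary_def adj_mat_1 matrix_mul_lid by blast

lemma unitary_adj [simp]: "unitary (adj U) = unitary U"
  unfolding unitary_def adj_adj by blast

lemma unitary_mult: "unitary U \<Longrightarrow> unitary V \<Longrightarrow> unitary (U ** V)"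
  unfolding unitary_def[of "U ** V"] adj_mult mult_right_assoc by simp

lemma norm_unitary_mult [simp]: "unitary U \<Longrightarrow> norm (U ** M) = norm M"
  by (rule power2_eq_imp_eq) (simp_all add: norm_sq_trace' adj_mult mult_right_assoc)

lemma norm_mult_unitary [simp]: "unitary U \<Longrightarrow> norm (M ** U) = norm M"
  by (rule power2_eq_imp_eq) (simp_all add: norm_sq_trace adj_mult mult_right_assoc)

lemma norm_diagm_mult_le:
  assumes "\<And>i. cmod (d i) \<le> c" "c \<ge> 0"
  shows "norm (diagm d ** M) \<le> c * norm M"
proof (rule power2_le_imp_le)
  have "(norm (diagm d ** M))\<^sup>2 \<le> (\<Sum>i\<in>UNIV. \<Sum>j\<in>UNIV. c\<^sup>2 * (cmod (M $ i $ j))\<^sup>2)"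
    unfolding norm_matrix_sq diagm_mult_nth
    by (intro sum_mono) (simp add: norm_mult power_mult_distrib mult_right_mono power_mono assms)
  also have "\<dots> = (c * norm M)\<^sup>2"
    by (simp add: norm_matrix_sq power_mult_distrib sum_distrib_left)
  finally show "(norm (diagm d ** M))\<^sup>2 \<le> (c * norm M)\<^sup>2" .
qed (simp add: assms)

text \<open>Needed for the maximiser in \<open>hermitian_diagonalization\<close> and for limits of
  eigenbases in \<open>continuous_on_fun_calc\<close>.\<close>

lemma compact_unitary: "compact {U :: complex^'n^'n. unitary U}"
proof -
  have n: "norm U = sqrt (CARD('n))" if "unitary U" for U :: "complex^'n^'n"
    using norm_sq_trace[of U] that by (simp add: trace_I real_sqrt_unique)
  have 1: "bounded {U :: complex^'n^'n. unitary U}"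
    unfolding bounded_iff using n by fastforce
  have 2: "closed {U :: complex^'n^'n. unitary U}"
    unfolding unitary_def vec_eq_iff matrix_nth_mult adj_nth
    by (intro closed_Collect_conj closed_Collect_all closed_Collect_eq continuous_intros)
  show ?thesis using 1 2 by (simp add: compact_eq_bounded_closed)
qed

subsection \<open>Spectral theorem and functional calculus\<close>

lemma trace_diag_unitary_nth:
  "(adj G ** (A ** G)) $ i $ i = (\<Sum>k\<in>UNIV. \<Sum>l\<in>UNIV. cnj (G $ k $ i) * A $ k $ l * G $ l $ i)"
  by (simp add: matrix_nth_mult sum_distrib_left mult.assoc)

text \<open>The maximiser of \<open>\<Sum>i. c i * (adj U ** M ** U) $ i $ i\<close> over the unitaries, for distinct
  weights \<open>c\<close>, diagonalises \<open>M\<close>: otherwise a rotation in one coordinate plane increases the value.\<close>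

lemma rotation_increases:
  fixes A :: "complex^'n^'n" and c :: "'n \<Rightarrow> real"
  assumes herm: "adj A = A" and pq: "p \<noteq> q" and A: "A $ p $ q \<noteq> 0" and c: "c p \<noteq> c q"
  shows "\<exists>G. unitary G \<and> (\<Sum>i\<in>UNIV. c i * Re (A $ i $ i))
              < (\<Sum>i\<in>UNIV. c i * Re ((adj G ** (A ** G)) $ i $ i))"
proof -
  define r where "r = cmod (A $ p $ q)"
  \<comment> \<open>The phase with \<open>w * A $ p $ q = r > 0\<close>; it makes the off-diagonal
    entry real, so that a real rotation angle suffices.\<close>
  define w where "w = cnj (A $ p $ q) / r"
  define D where "D = c p - c q"
  define E where "E = Re (A $ p $ p) - Re (A $ q $ q)"
  \<comment> \<open>A rotation with tangent \<open>t\<close> changes the value by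
    \<open>D * (2 * t * r - t\<^sup>2 * E) / (1 + t\<^sup>2)\<close>. With
    \<open>t = \<eta> * D\<close> the linear term is positive, and this \<open>\<eta>\<close> gives
    \<open>\<eta> * (D * E) \<le> r\<close>, so the quadratic term cannot undo it.\<close>
  define \<eta> where "\<eta> = r / (\<bar>D * E\<bar> + 1)"
  define t where "t = \<eta> * D"
  define co where "co = 1 / sqrt (1 + t\<^sup>2)"
  define si where "si = t / sqrt (1 + t\<^sup>2)"
  have r: "r > 0" and D: "D \<noteq> 0" using A c by (auto simp: r_def D_def)
  have qp: "A $ q $ p = cnj (A $ p $ q)" using herm by (metis adj_nth)
  have diag_real: "Im (A $ i $ i) = 0" for i
    using arg_cong[where f = "\<lambda>M. M $ i $ i", OF herm] by (simp add: complex_eq_iff)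
  have t1: "1 + t\<^sup>2 > 0" by (simp add: add_pos_nonneg)
  have cs: "co * co + si * si = 1" and cs2: "co * co = 1 / (1 + t\<^sup>2)" and cs3: "si * si = t\<^sup>2 / (1 + t\<^sup>2)"
    and cs4: "si * co = t / (1 + t\<^sup>2)"
    using t1 by (auto simp: co_def si_def power2_eq_square[symmetric] real_sqrt_pow2 power_divide add_divide_distrib[symmetric])
  have "cmod w = 1" using r by (simp add: w_def r_def norm_divide)
  then have ww: "w * cnj w = 1" using complex_norm_square[of w] by simp
  have "cnj (A $ p $ q) * A $ p $ q = r * r"
    using complex_norm_square[of "A $ p $ q"] by (simp add: r_def mult.commute power2_eq_square)
  then have wA: "w * A $ p $ q = r" using r by (simp add: w_def)
  define G :: "complex^'n^'n" where "G = (\<chi> i j.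
      if j = p then (if i = p then co else if i = q then si * w else 0)
      else if j = q then (if i = p then - si * cnj w else if i = q then co else 0)
      else if i = j then 1 else 0)"
  have split: "(\<Sum>k\<in>UNIV. f k) = f p + (f q + (\<Sum>k\<in>UNIV - {p, q}. f k))" for f :: "'n \<Rightarrow> complex"
    using pq by (subst sum.remove[of UNIV p], simp, simp, subst sum.remove[of _ q]) (auto intro!: sum.cong)
  have split': "(\<Sum>k\<in>UNIV. f k) = f p + (f q + (\<Sum>k\<in>UNIV - {p, q}. f k))" for f :: "'n \<Rightarrow> real"
    using pq by (subst sum.remove[of UNIV p], simp, simp, subst sum.remove[of _ q]) (auto intro!: sum.cong)
  have cs': "complex_of_real co * complex_of_real co + complex_of_real si * complex_of_real si = 1"
    using cs by (metis of_real_1 of_real_add of_real_mult)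
  have "(adj G ** G) $ i $ j = mat 1 $ i $ j" for i j
  proof -
    have z: "(\<Sum>k\<in>UNIV - {p, q}. cnj (G $ k $ i) * G $ k $ j) = (if i = j \<and> i \<notin> {p, q} then 1 else 0)"
    proof (cases "i = j \<and> i \<notin> {p, q}")
      case True
      then have "(\<Sum>k\<in>UNIV - {p, q}. cnj (G $ k $ i) * G $ k $ j) = (\<Sum>k\<in>UNIV - {p, q}. if k = i then 1 else 0)"
        by (intro sum.cong) (auto simp: G_def)
      then show ?thesis using True by (simp add: sum.delta)
    next
      case False
      then show ?thesis by (intro trans[OF sum.neutral]) (auto simp: G_def)
    qed
    have e1: "w * (cnj w * x) = x" for x using ww by (simp add: mult.assoc[symmetric])
    show ?thesis
      unfolding matrix_nth_mult adj_nth split z using pq cs'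
      by (auto simp: G_def mat_def mult_ac add_ac e1)
  qed
  then have "adj G ** G = mat 1" by (simp add: vec_eq_iff)
  then have uG: "unitary G"
    unfolding unitary_def using matrix_left_right_inverse by blast
  define B where "B = adj G ** (A ** G)"
  have Bi: "B $ i $ i = A $ i $ i" if "i \<notin> {p, q}" for i
  proof -
    have "B $ i $ i = (\<Sum>k\<in>UNIV. if k = i then (\<Sum>l\<in>UNIV. if l = i then A $ i $ i else 0) else 0)"
      unfolding B_def trace_diag_unitary_nth using that by (intro sum.cong refl) (auto simp: G_def if_distrib[where f="\<lambda>x. _ * x"] intro!: sum.neutral cong: if_cong)
    then show ?thesis by simp
  qed
  have two: "B $ i $ i = (cnj (G $ p $ i) * A $ p $ p * G $ p $ i + cnj (G $ p $ i) * A $ p $ q * G $ q $ i)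
        + (cnj (G $ q $ i) * A $ q $ p * G $ p $ i + cnj (G $ q $ i) * A $ q $ q * G $ q $ i)"
    if "i \<in> {p, q}" for i
  proof -
    have z: "G $ k $ i = 0" if "k \<in> UNIV - {p, q}" for k
      using that \<open>i \<in> {p, q}\<close> pq by (auto simp: G_def)
    show ?thesis
      unfolding B_def trace_diag_unitary_nth split by (simp add: z algebra_simps)
  qed
  have cw: "cnj (A $ p $ q) * cnj w = r" using arg_cong[OF wA, of cnj] by (simp add: mult.commute)
  have Bp: "B $ p $ p = co * co * A $ p $ p + si * si * A $ q $ q + 2 * (si * co) * r"
  proof -
    have "B $ p $ p = co * co * A $ p $ p + (si * co) * (w * A $ p $ q)
      + ((si * co) * (cnj (A $ p $ q) * cnj w) + (si * si) * (w * cnj w) * A $ q $ q)"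
      using pq by (simp add: two qp) (simp add: G_def algebra_simps)
    then show ?thesis by (simp only: cw wA ww) (simp add: algebra_simps)
  qed
  have Bq: "B $ q $ q = si * si * A $ p $ p + co * co * A $ q $ q - 2 * (si * co) * r"
  proof -
    have "B $ q $ q = (si * si) * (w * cnj w) * A $ p $ p - (si * co) * (w * A $ p $ q)
      + (- (si * co) * (cnj (A $ p $ q) * cnj w) + co * co * A $ q $ q)"
      using pq by (simp add: two qp) (simp add: G_def algebra_simps)
    then show ?thesis by (simp only: cw wA ww) (simp add: algebra_simps)
  qed
  have rest: "(\<Sum>k\<in>UNIV - {p, q}. c k * Re (B $ k $ k)) = (\<Sum>k\<in>UNIV - {p, q}. c k * Re (A $ k $ k))"
    by (intro sum.cong refl) (simp add: Bi)
  have "(\<Sum>i\<in>UNIV. c i * Re (B $ i $ i)) - (\<Sum>i\<in>UNIV. c i * Re (A $ i $ i))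
      = D * (2 * (si * co) * r) + c p * (co * co * Re (A $ p $ p) + si * si * Re (A $ q $ q) - Re (A $ p $ p))
        + c q * (si * si * Re (A $ p $ p) + co * co * Re (A $ q $ q) - Re (A $ q $ q))"
    unfolding split' rest by (simp add: Bp Bq diag_real D_def algebra_simps)
  also have "co * co = 1 - si * si" using cs by simp
  also have "D * (2 * (si * co) * r) + c p * ((1 - si * si) * Re (A $ p $ p) + si * si * Re (A $ q $ q) - Re (A $ p $ p))
        + c q * (si * si * Re (A $ p $ p) + (1 - si * si) * Re (A $ q $ q) - Re (A $ q $ q))
      = D * (2 * (si * co) * r - si * si * E)"
    by (simp add: D_def E_def algebra_simps)
  also have "\<dots> = D * (2 * t * r - t\<^sup>2 * E) / (1 + t\<^sup>2)"
    unfolding mult.assoc[of 2 "si * co"] mult.assoc[of 2 t] cs3 cs4 by (simp add: diff_divide_distrib[symmetric])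
  also have "D * (2 * t * r - t\<^sup>2 * E) = \<eta> * D\<^sup>2 * (2 * r - \<eta> * (D * E))"
    by (simp add: t_def power2_eq_square algebra_simps)
  finally have diff: "(\<Sum>i\<in>UNIV. c i * Re (B $ i $ i)) - (\<Sum>i\<in>UNIV. c i * Re (A $ i $ i))
      = \<eta> * D\<^sup>2 * (2 * r - \<eta> * (D * E)) / (1 + t\<^sup>2)" .
  have \<eta>: "\<eta> > 0" using r by (simp add: \<eta>_def add_nonneg_pos)
  have "\<eta> * (D * E) \<le> \<eta> * (\<bar>D * E\<bar> + 1)" using \<eta> by (intro mult_left_mono) auto
  also have "\<dots> = r" by (simp add: \<eta>_def add_nonneg_eq_0_iff)
  finally have "2 * r - \<eta> * (D * E) > 0" using r by simp
  then have "\<eta> * D\<^sup>2 * (2 * r - \<eta> * (D * E)) / (1 + t\<^sup>2) > 0"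
    using \<eta> D t1 by simp
  with diff uG show ?thesis unfolding B_def by (intro exI[of _ G]) auto
qed

theorem hermitian_diagonalization:
  fixes M :: "complex^'n^'n"
  assumes "adj M = M"
  obtains U d where "unitary U" "M = U ** diagm (\<lambda>i. complex_of_real (d i)) ** adj U"
proof -
  obtain c0 :: "'n \<Rightarrow> nat" where c0: "inj c0"
    using finite_imp_inj_to_nat_seg[of "UNIV :: 'n set"] by auto
  define c where "c i = real (c0 i)" for i
  define f where "f U = (\<Sum>i\<in>UNIV. c i * Re ((adj U ** (M ** U)) $ i $ i))" for U
  have "continuous_on {U. unitary U} f"
    unfolding f_def matrix_nth_mult adj_nth by (intro continuous_intros)
  then obtain U where U: "unitary U" and max: "\<And>V. unitary V \<Longrightarrow> f V \<le> f U"
    using continuous_attains_sup[OF compact_unitary, of f] unitary_mat_1 by (metis empty_iff mem_Collect_eq)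
  define A where "A = adj U ** (M ** U)"
  have herm: "adj A = A" by (simp add: A_def adj_mult mult_right_assoc assms)
  have off: "A $ p $ q = 0" if pq: "p \<noteq> q" for p q
  proof (rule ccontr)
    assume "A $ p $ q \<noteq> 0"
    moreover have "c p \<noteq> c q" using c0 pq by (simp add: c_def inj_eq)
    ultimately obtain G where G: "unitary G" "(\<Sum>i\<in>UNIV. c i * Re (A $ i $ i))
              < (\<Sum>i\<in>UNIV. c i * Re ((adj G ** (A ** G)) $ i $ i))"
      using rotation_increases[OF herm pq] by blast
    have "f (U ** G) \<le> f U" using max U G(1) unitary_mult by blast
    then show False using G(2) by (simp add: f_def A_def adj_mult mult_right_assoc)
  qed
  have "A = diagm (\<lambda>i. complex_of_real (Re (A $ i $ i)))"
  proof -
    have "Im (A $ i $ i) = 0" for i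
      using arg_cong[where f = "\<lambda>M. M $ i $ i", OF herm] by (simp add: complex_eq_iff)
    then show ?thesis by (auto simp: vec_eq_iff diagm_nth off complex_eq_iff)
  qed
  moreover have "M = U ** A ** adj U" using U by (simp add: A_def mult_right_assoc)
  ultimately show ?thesis using that U by metis
qed

definition herm :: "complex^'n^'n \<Rightarrow> bool" where "herm M \<longleftrightarrow> adj M = M"

text \<open>The same choice as in \<open>mpow\<close>, for a general scalar function, so that
  \<open>mpow\<close> is an instance by unfolding. Complex values of \<open>f\<close> serve complex
  powers; independence of the chosen decomposition is \<open>fun_calc_diag\<close>.\<close>

definition fun_calc :: "(real \<Rightarrow> complex) \<Rightarrow> complex^'n^'n \<Rightarrow> complex^'n^'n" where
  "fun_calc f M = (SOME N. \<exists>U (d :: 'n \<Rightarrow> real). unitary U \<and>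
      M = U ** diagm (\<lambda>i. complex_of_real (d i)) ** adj U \<and>
      N = U ** diagm (\<lambda>i. f (d i)) ** adj U)"

text \<open>In the two eigenbases the hypothesis reads
  \<open>d i * R $ i $ j = R $ i $ j * e j\<close>, so an entry of \<open>R\<close> vanishes unless
  \<open>d i = e j\<close>, and the relation persists when \<open>f\<close> is applied to the
  eigenvalues. For \<open>K = mat 1\<close> this says that \<open>f\<close> of a matrix does not
  depend on its diagonalisation.\<close>

lemma intertwine_spectral:
  assumes "unitary U" "unitary V"
    and "U ** diagm (\<lambda>i. complex_of_real (d i)) ** adj U ** K = K ** (V ** diagm (\<lambda>i. complex_of_real (e i)) ** adj V)"
  shows "U ** diagm (\<lambda>i. f (d i)) ** adj U ** K = K ** (V ** diagm (\<lambda>i. f (e i)) ** adj V)"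
proof -
  define R where "R = adj U ** K ** V"
  have "diagm (\<lambda>i. complex_of_real (d i)) ** R = R ** diagm (\<lambda>i. complex_of_real (e i))"
    using arg_cong[OF assms(3), of "\<lambda>X. adj U ** X ** V"] assms(1,2) by (simp add: R_def mult_right_assoc)
  then have "complex_of_real (d i) * R $ i $ j = R $ i $ j * complex_of_real (e j)" for i j
    by (metis diagm_mult_nth mult_diagm_nth)
  then have "R $ i $ j = 0 \<or> d i = e j" for i j
    by (metis mult.commute mult_left_cancel of_real_eq_iff)
  then have "diagm (\<lambda>i. f (d i)) ** R = R ** diagm (\<lambda>i. f (e i))"
    unfolding vec_eq_iff diagm_mult_nth mult_diagm_nth by (metis mult.commute mult_zero_right)
  from arg_cong[OF this, of "\<lambda>X. U ** X ** adj V"] show ?thesis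
    using assms(1,2) by (simp add: R_def mult_right_assoc)
qed

lemma fun_calc_diag:
  assumes "unitary U"
  shows "fun_calc f (U ** diagm (\<lambda>i. complex_of_real (d i)) ** adj U) = U ** diagm (\<lambda>i. f (d i)) ** adj U"
proof -
  define M where "M = U ** diagm (\<lambda>i. complex_of_real (d i)) ** adj U"
  have "\<exists>V e. unitary V \<and> M = V ** diagm (\<lambda>i. complex_of_real (e i)) ** adj V \<and> fun_calc f M = V ** diagm (\<lambda>i. f (e i)) ** adj V"
    unfolding fun_calc_def by (rule someI_ex) (use assms M_def in blast)
  then obtain V e where V: "unitary V" "M = V ** diagm (\<lambda>i. complex_of_real (e i)) ** adj V"
    "fun_calc f M = V ** diagm (\<lambda>i. f (e i)) ** adj V" by blast
  show ?thesis
    using intertwine_spectral[OF assms V(1), of d "mat 1" e f] V(2,3) by (simp add: M_def)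
qed

lemma hermE:
  assumes "herm M"
  obtains U d where "unitary U" "M = U ** diagm (\<lambda>i. complex_of_real (d i)) ** adj U"
    "\<And>f. fun_calc f M = U ** diagm (\<lambda>i. f (d i)) ** adj U"
proof -
  obtain U d where "unitary U" and M: "M = U ** diagm (\<lambda>i. complex_of_real (d i)) ** adj U"
    using assms hermitian_diagonalization[of M] unfolding herm_def by blast
  then show ?thesis using that fun_calc_diag[of U _ d] by blast
qed

text \<open>\<open>K\<close> may be rectangular, which allows a comparison of
  \<open>Q ** adj Q\<close> with \<open>adj Q ** Q\<close> in \<open>fun_calc_gram\<close> and a
  change of index type in \<open>mpow_regroup_perm\<close>.\<close>

lemma fun_calc_intertwine:
  assumes "herm A" "herm B" "A ** K = K ** B"
  shows "fun_calc f A ** K = K ** fun_calc f B"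
proof -
  obtain U d where U: "unitary U" "A = U ** diagm (\<lambda>i. complex_of_real (d i)) ** adj U"
    "fun_calc f A = U ** diagm (\<lambda>i. f (d i)) ** adj U" using hermE[OF assms(1)] by metis
  obtain V e where V: "unitary V" "B = V ** diagm (\<lambda>i. complex_of_real (e i)) ** adj V"
    "fun_calc f B = V ** diagm (\<lambda>i. f (e i)) ** adj V" using hermE[OF assms(2)] by metis
  show ?thesis unfolding U(3) V(3) using assms(3) intertwine_spectral[OF U(1) V(1)] unfolding U(2) V(2) by blast
qed

lemma fun_calc_mult: "herm A \<Longrightarrow> fun_calc f A ** fun_calc g A = fun_calc (\<lambda>x. f x * g x) A"
  by (erule hermE) (simp add: mult_right_assoc, simp add: matrix_mul_assoc diagm_mult)

lemma fun_calc_id [simp]: "herm A \<Longrightarrow> fun_calc complex_of_real A = A"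
  by (erule hermE) metis

lemma fun_calc_one: "herm A \<Longrightarrow> fun_calc (\<lambda>x. 1) A = mat 1"
  by (erule hermE) simp

lemma adj_fun_calc: "herm A \<Longrightarrow> adj (fun_calc f A) = fun_calc (\<lambda>x. cnj (f x)) A"
  by (erule hermE) (simp add: adj_mult mult_right_assoc)

lemma herm_fun_calc [simp]: "herm A \<Longrightarrow> herm (fun_calc (\<lambda>x. complex_of_real (g x)) A)"
  by (simp add: herm_def adj_fun_calc)

lemma fun_calc_comp: "herm A \<Longrightarrow> fun_calc f (fun_calc (\<lambda>x. complex_of_real (g x)) A) = fun_calc (\<lambda>x. f (g x)) A"
  by (erule hermE) (simp add: fun_calc_diag)

lemma trace_unitary_conj: "unitary U \<Longrightarrow> trace (U ** A ** adj U) = trace A"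
  by (subst trace_mul_sym) (simp add: mult_right_assoc)

lemma norm_fun_calc_mult_le:
  assumes "herm A" "\<And>x. cmod (f x) \<le> c" "c \<ge> 0"
  shows "norm (fun_calc f A ** M) \<le> c * norm M"
proof -
  obtain U d where U: "unitary U" "fun_calc f A = U ** diagm (\<lambda>i. f (d i)) ** adj U" using hermE[OF assms(1)] by metis
  have "norm (fun_calc f A ** M) = norm (diagm (\<lambda>i. f (d i)) ** (adj U ** M))"
    using U by (simp add: mult_right_assoc)
  also have "\<dots> \<le> c * norm (adj U ** M)" by (rule norm_diagm_mult_le) (use assms in auto)
  finally show ?thesis using U by simp
qed

lemma norm_mult_fun_calc_le:
  assumes "herm A" "\<And>x. cmod (f x) \<le> c" "c \<ge> 0"
  shows "norm (M ** fun_calc f A) \<le> c * norm M"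
proof -
  have "norm (M ** fun_calc f A) = norm (adj (M ** fun_calc f A))" by simp
  also have "\<dots> = norm (fun_calc (\<lambda>x. cnj (f x)) A ** adj M)" by (simp add: adj_mult adj_fun_calc assms)
  also have "\<dots> \<le> c * norm (adj M)" by (rule norm_fun_calc_mult_le) (use assms in auto)
  finally show ?thesis by simp
qed

subsection \<open>Positive matrices\<close>

lemma cinner_adj: "cinner v (A *v w) = cinner (adj A *v v) w"
proof -
  have "cinner v (A *v w) = (\<Sum>i\<in>UNIV. \<Sum>j\<in>UNIV. cnj (v $ i) * A $ i $ j * w $ j)"
    by (simp add: cinner_def matrix_vector_mult_def sum_distrib_left mult.assoc)
  also have "\<dots> = (\<Sum>j\<in>UNIV. \<Sum>i\<in>UNIV. cnj (v $ i) * A $ i $ j * w $ j)" by (rule sum.swap)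
  also have "\<dots> = cinner (adj A *v v) w"
    by (simp add: cinner_def matrix_vector_mult_def sum_distrib_left sum_distrib_right mult_ac)
  finally show ?thesis .
qed

lemma psd_herm [simp]: "psd M \<Longrightarrow> herm M"
  by (simp add: psd_def herm_def)

lemma psd_conj: assumes "psd A" shows "psd (K ** A ** adj K)"
  unfolding psd_def
proof (intro conjI allI)
  show "adj (K ** A ** adj K) = K ** A ** adj K"
    using assms by (simp add: adj_mult mult_right_assoc psd_def)
  fix v
  have "cinner v (K ** A ** adj K *v v) = cinner (adj K *v v) (A *v (adj K *v v))"
    by (subst cinner_adj[symmetric]) (simp add: matrix_vector_mul_assoc matrix_mul_assoc)
  then show "0 \<le> Re (cinner v (K ** A ** adj K *v v))" using assms by (simp add: psd_def)
qed

lemma psd_diagm: "(\<And>i. d i \<ge> 0) \<Longrightarrow> psd (diagm (\<lambda>i. complex_of_real (d i)))"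
proof -
  assume d: "\<And>i. d i \<ge> 0"
  have "Re (cnj z * (of_real x * z)) = x * (cmod z)\<^sup>2" for x z
    by (simp add: cmod_power2) (simp add: algebra_simps power2_eq_square)
  then have "Re (cinner v (diagm (\<lambda>i. complex_of_real (d i)) *v v)) = (\<Sum>i\<in>UNIV. d i * (cmod (v $ i))\<^sup>2)" for v
    by (simp add: cinner_def matrix_vector_mult_def diagm_nth if_distrib[where f = "\<lambda>x. x * _"] cong: if_cong)
  then show ?thesis using d by (simp add: psd_def sum_nonneg)
qed

lemma psd_unitary_diag: "(\<And>i. d i \<ge> 0) \<Longrightarrow> psd (U ** diagm (\<lambda>i. complex_of_real (d i)) ** adj U)"
  by (intro psd_conj psd_diagm)

lemma psd_mat_1 [simp]: "psd (mat 1)"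
  using psd_diagm[of "\<lambda>_. 1"] by simp

lemma psd_mult_adj [simp]: "psd (K ** adj K)"
  using psd_conj[of "mat 1" K] by simp

lemma psd_adj_mult [simp]: "psd (adj K ** K)"
  using psd_mult_adj[of "adj K"] by simp

lemma psd_add: "psd A \<Longrightarrow> psd B \<Longrightarrow> psd (A + B)"
proof -
  have "cinner v ((A + B) *v v) = cinner v (A *v v) + cinner v (B *v v)" for v
    by (simp add: matrix_vector_mult_add_rdistrib cinner_def distrib_left sum.distrib)
  then show "psd A \<Longrightarrow> psd B \<Longrightarrow> psd (A + B)" by (simp add: psd_def adj_add)
qed

lemma psd_scaleR: "psd A \<Longrightarrow> c \<ge> 0 \<Longrightarrow> psd (c *\<^sub>R A)"
proof -
  assume A: "psd A" "c \<ge> 0"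
  have "cinner v (c *\<^sub>R A *v v) = c * cinner v (A *v v)" for v
    by (simp add: cinner_def matrix_vector_mult_def scaleR_conv_of_real[where 'a=complex] sum_distrib_left sum_distrib_right mult_ac)
  then show ?thesis using A by (simp add: psd_def adj_scaleR)
qed

lemma psd_zero [simp]: "psd 0"
  using psd_scaleR[OF psd_mat_1, of 0] by simp

lemma psd_sum: "(\<And>x. x \<in> S \<Longrightarrow> psd (f x)) \<Longrightarrow> psd (sum f S)"
  by (induction S rule: infinite_finite_induct) (auto intro: psd_add)

lemma psdE:
  assumes "psd M"
  obtains U d where "unitary U" "M = U ** diagm (\<lambda>i. complex_of_real (d i)) ** adj U"
    "\<And>f. fun_calc f M = U ** diagm (\<lambda>i. f (d i)) ** adj U" "\<And>i. d i \<ge> 0"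
proof -
  obtain U d where U: "unitary U" "M = U ** diagm (\<lambda>i. complex_of_real (d i)) ** adj U"
    "\<And>f. fun_calc f M = U ** diagm (\<lambda>i. f (d i)) ** adj U"
    using hermE[OF psd_herm[OF assms]] by blast
  have D: "diagm (\<lambda>i. complex_of_real (d i)) = adj U ** M ** adj (adj U)"
    using U(1) by (simp add: U(2) mult_right_assoc)
  then have p: "psd (diagm (\<lambda>i. complex_of_real (d i)))" using assms psd_conj by metis
  have "d i \<ge> 0" for i
  proof -
    have "cinner (axis i 1) (diagm (\<lambda>i. complex_of_real (d i)) *v axis i 1) = d i"
      by (simp add: cinner_def matrix_vector_mult_def axis_def diagm_nth if_distrib[where f = "\<lambda>x. x * _"]
          if_distrib[where f = "\<lambda>x. _ * x"] if_distrib[where f = cnj] cong: if_cong)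
    then show ?thesis using p unfolding psd_def by (metis Re_complex_of_real)
  qed
  with U show ?thesis using that by blast
qed

lemma fun_calc_cong: "psd M \<Longrightarrow> (\<And>x. x \<ge> 0 \<Longrightarrow> f x = g x) \<Longrightarrow> fun_calc f M = fun_calc g M"
  by (erule psdE) simp

lemma psd_fun_calc: "psd M \<Longrightarrow> (\<And>x. x \<ge> 0 \<Longrightarrow> g x \<ge> 0) \<Longrightarrow> psd (fun_calc (\<lambda>x. complex_of_real (g x)) M)"
  by (erule psdE) (simp add: psd_unitary_diag)

text \<open>A lower bound by a multiple of the identity, rather than strict positivity on vectors:
  it passes easily through sums, \<open>emb\<close>, \<open>ptrace1\<close> and sandwiches, and for
  a fixed bound it describes a closed set.\<close>

definition pd :: "complex^'n^'n \<Rightarrow> bool" where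
  "pd M \<longleftrightarrow> (\<exists>e>0. psd (M - e *\<^sub>R mat 1))"

lemma pd_psd [simp]: assumes "pd M" shows "psd M"
proof -
  obtain e where "e > 0" "psd (M - e *\<^sub>R mat 1)" using assms by (auto simp: pd_def)
  then have "psd (M - e *\<^sub>R mat 1 + e *\<^sub>R mat 1)" by (intro psd_add psd_scaleR) auto
  then show ?thesis by simp
qed

lemma unitary_diag_minus: "unitary U \<Longrightarrow>
  U ** diagm (\<lambda>i. complex_of_real (d i)) ** adj U - e *\<^sub>R mat 1 = U ** diagm (\<lambda>i. complex_of_real (d i - e)) ** adj U"
proof -
  assume U: "unitary U"
  have "diagm (\<lambda>i. complex_of_real (d i - e)) = diagm (\<lambda>i. complex_of_real (d i)) - e *\<^sub>R mat 1"
    by (simp add: vec_eq_iff diagm_nth mat_def scaleR_conv_of_real[where 'a=complex])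
  then show ?thesis using U by (simp add: matrix_diff_mult matrix_mult_diff scaleR_mult_left scaleR_mult_right)
qed

lemma pd_unitary_diag: 
  assumes "unitary U" "\<And>i. d i > 0" shows "pd (U ** diagm (\<lambda>i. complex_of_real (d i)) ** adj U)"
proof -
  define e where "e = Min (range d)"
  have "e \<in> range d" unfolding e_def by (intro Min_in) auto
  then have "e > 0" using assms(2) by auto
  moreover have "d i - e \<ge> 0" for i by (simp add: e_def)
  ultimately show ?thesis unfolding pd_def
    by (intro exI[of _ e]) (simp add: unitary_diag_minus assms(1) psd_unitary_diag del: of_real_diff)
qed

lemma pdE:
  assumes "pd M"
  obtains U d where "unitary U" "M = U ** diagm (\<lambda>i. complex_of_real (d i)) ** adj U"
    "\<And>f. fun_calc f M = U ** diagm (\<lambda>i. f (d i)) ** adj U" "\<And>i. d i > 0"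
proof -
  obtain e where e: "e > 0" "psd (M - e *\<^sub>R mat 1)" using assms by (auto simp: pd_def)
  obtain U d where U: "unitary U" "M - e *\<^sub>R mat 1 = U ** diagm (\<lambda>i. complex_of_real (d i)) ** adj U"
    "\<And>i. d i \<ge> 0" using psdE[OF e(2)] by metis
  have "M = U ** diagm (\<lambda>i. complex_of_real (d i + e)) ** adj U"
    using unitary_diag_minus[OF U(1), of "\<lambda>i. d i + e" e] U(2) by (simp del: of_real_add add: diff_eq_eq)
  moreover have "d i + e > 0" for i using U(3)[of i] e(1) by simp
  ultimately show ?thesis using that[of U "\<lambda>i. d i + e"] U(1) fun_calc_diag[of U _ "\<lambda>i. d i + e"] by metis
qed

lemma pd_herm [simp]: "pd M \<Longrightarrow> herm M" by simp

lemma fun_calc_cong_pd: "pd M \<Longrightarrow> (\<And>x. x > 0 \<Longrightarrow> f x = g x) \<Longrightarrow> fun_calc f M = fun_calc g M"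
  by (erule pdE) simp

lemma pd_fun_calc: "pd M \<Longrightarrow> (\<And>x. x > 0 \<Longrightarrow> g x > 0) \<Longrightarrow> pd (fun_calc (\<lambda>x. complex_of_real (g x)) M)"
  by (erule pdE) (simp add: pd_unitary_diag)

lemma pd_mat_1 [simp]: "pd (mat 1)"
  using pd_unitary_diag[of "mat 1" "\<lambda>_. 1"] by simp

lemma pd_add: "pd A \<Longrightarrow> psd B \<Longrightarrow> pd (A + B)"
proof -
  assume "pd A" "psd B"
  then obtain e where "e > 0" "psd (A - e *\<^sub>R mat 1)" by (auto simp: pd_def)
  then have "psd (A - e *\<^sub>R mat 1 + B)" using \<open>psd B\<close> by (intro psd_add)
  then show ?thesis unfolding pd_def using \<open>e > 0\<close> by (intro exI[of _ e]) (simp add: algebra_simps)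
qed

lemma pd_scaleR: "pd A \<Longrightarrow> c > 0 \<Longrightarrow> pd (c *\<^sub>R A)"
proof -
  assume "pd A" "c > 0"
  then obtain e where e: "e > 0" "psd (A - e *\<^sub>R mat 1)" by (auto simp: pd_def)
  then have "psd (c *\<^sub>R (A - e *\<^sub>R mat 1))" using \<open>c > 0\<close> by (intro psd_scaleR) auto
  then show ?thesis unfolding pd_def using e \<open>c > 0\<close> by (intro exI[of _ "c * e"]) (simp add: scaleR_diff_right)
qed

lemma trace_psd_nonneg: "psd A \<Longrightarrow> Re (trace A) \<ge> 0"
  by (erule psdE) (simp add: trace_unitary_conj trace_diagm sum_nonneg)

lemma trace_psd_zero: "psd A \<Longrightarrow> Re (trace A) = 0 \<Longrightarrow> A = 0"
proof (erule psdE)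
  fix U d assume U: "unitary U" "A = U ** diagm (\<lambda>i. complex_of_real (d i)) ** adj U" "\<And>i. d i \<ge> 0" "Re (trace A) = 0"
  then have "(\<Sum>i\<in>UNIV. d i) = 0" by (simp add: trace_unitary_conj trace_diagm)
  then have "d = (\<lambda>i. 0)" using U(3) by (auto simp: sum_nonneg_eq_0_iff)
  then show "A = 0" using U(2) by (simp add: vec_eq_iff matrix_nth_mult diagm_nth)
qed

lemma trace_psd_Im: "psd A \<Longrightarrow> Im (trace A) = 0"
  by (erule psdE) (simp add: trace_unitary_conj trace_diagm)

lemma psd_square_root: assumes "psd A" obtains K where "A = adj K ** K" "herm K"
proof
  have "A = fun_calc complex_of_real A" using assms by simp
  also have "\<dots> = fun_calc (\<lambda>x. of_real (sqrt x) * of_real (sqrt x)) A"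
    using assms by (intro fun_calc_cong) (auto simp flip: of_real_mult)
  finally show "A = adj (fun_calc (\<lambda>x. of_real (sqrt x)) A) ** fun_calc (\<lambda>x. of_real (sqrt x)) A"
    using assms by (simp add: adj_fun_calc fun_calc_mult)
  show "herm (fun_calc (\<lambda>x. of_real (sqrt x)) A)" using assms by simp
qed

lemma trace_mult_psd_nonneg: assumes "psd A" "psd B" shows "Re (trace (A ** B)) \<ge> 0"
proof -
  obtain K where K: "A = adj K ** K" and "herm K" by (rule psd_square_root[OF assms(1)])
  have "trace (A ** B) = trace (K ** B ** adj K)"
    unfolding K mult_right_assoc by (subst trace_mul_sym) (simp add: mult_right_assoc)
  then show ?thesis using trace_psd_nonneg[OF psd_conj[OF assms(2)]] by simp
qed

lemma trace_mult_mono: assumes "psd (A' - A)" "psd B" shows "Re (trace (A ** B)) \<le> Re (trace (A' ** B))"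
  using trace_mult_psd_nonneg[OF assms] by (simp add: matrix_diff_mult trace_sub)

lemma psd_conj_mono: "psd (A - B) \<Longrightarrow> psd (K ** A ** adj K - K ** B ** adj K)"
  using psd_conj[of "A - B" K] by (simp add: matrix_diff_mult matrix_mult_diff)

lemma cmod_sq: "(complex_of_real (cmod z))\<^sup>2 = z * cnj z"
  by (metis complex_norm_square of_real_power)

text \<open>With \<open>R\<close> the unitary overlap of the two eigenbases, \<open>w i j\<close> is
  the squared modulus of \<open>R $ i $ j\<close>, hence doubly stochastic. Trace inequalities
  between functions of two noncommuting matrices thereby reduce to inequalities between pairs of
  eigenvalues.\<close>

lemma spectral_pair:
  fixes A B :: "complex^'n^'n"
  assumes "herm A" "herm B"
  obtains a b :: "'n \<Rightarrow> real" and w :: "'n \<Rightarrow> 'n \<Rightarrow> real" where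
    "\<And>f g. Re (trace (fun_calc (\<lambda>x. complex_of_real (f x)) A ** fun_calc (\<lambda>x. complex_of_real (g x)) B)) = (\<Sum>i\<in>UNIV. \<Sum>j\<in>UNIV. w i j * (f (a i) * g (b j)))"
    "\<And>f. trace (fun_calc f A) = (\<Sum>i\<in>UNIV. f (a i))"
    "\<And>f. trace (fun_calc f B) = (\<Sum>i\<in>UNIV. f (b i))"
    "\<And>i j. w i j \<ge> 0" "\<And>i. (\<Sum>j\<in>UNIV. w i j) = 1" "\<And>j. (\<Sum>i\<in>UNIV. w i j) = 1"
    "\<And>i. psd A \<Longrightarrow> a i \<ge> 0" "\<And>i. psd B \<Longrightarrow> b i \<ge> 0"
    "\<And>i. pd A \<Longrightarrow> a i > 0" "\<And>i. pd B \<Longrightarrow> b i > 0"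
proof -
  have E: "\<exists>U d. unitary U \<and> M = U ** diagm (\<lambda>i. complex_of_real (d i)) ** adj U \<and>
      (\<forall>f. fun_calc f M = U ** diagm (\<lambda>i. f (d i)) ** adj U) \<and> (psd M \<longrightarrow> (\<forall>i. d i \<ge> 0)) \<and> (pd M \<longrightarrow> (\<forall>i. d i > 0))"
    if "herm M" for M :: "complex^'n^'n"
  proof -
    consider "pd M" | "\<not> pd M" "psd M" | "\<not> psd M" by blast
    then show ?thesis
    proof cases
      case 1 then show ?thesis by (elim pdE) (metis less_imp_le)
    next
      case 2 then show ?thesis by (elim psdE) metis
    next
      case 3 then show ?thesis using hermE[OF that] pd_psd by metis
    qed
  qed
  obtain U a where U: "unitary U" "\<And>f. fun_calc f A = U ** diagm (\<lambda>i. f (a i)) ** adj U"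
    "\<And>i. psd A \<Longrightarrow> a i \<ge> 0" "\<And>i. pd A \<Longrightarrow> a i > 0" using E[OF assms(1)] by blast
  obtain V b where V: "unitary V" "\<And>f. fun_calc f B = V ** diagm (\<lambda>i. f (b i)) ** adj V"
    "\<And>i. psd B \<Longrightarrow> b i \<ge> 0" "\<And>i. pd B \<Longrightarrow> b i > 0" using E[OF assms(2)] by blast
  define R where "R = adj U ** V"
  have uR: "unitary R" using U(1) V(1) by (simp add: R_def unitary_mult)
  define w where "w i j = (cmod (R $ i $ j))\<^sup>2" for i j
  have tr: "Re (trace (fun_calc (\<lambda>x. complex_of_real (f x)) A ** fun_calc (\<lambda>x. complex_of_real (g x)) B))
      = (\<Sum>i\<in>UNIV. \<Sum>j\<in>UNIV. w i j * (f (a i) * g (b j)))" for f g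
  proof -
    have "trace (fun_calc (\<lambda>x. complex_of_real (f x)) A ** fun_calc (\<lambda>x. complex_of_real (g x)) B)
      = trace (U ** (diagm (\<lambda>i. complex_of_real (f (a i))) ** R ** diagm (\<lambda>i. complex_of_real (g (b i))) ** adj R) ** adj U)"
      using U(1) V(1) by (simp add: U(2) V(2) R_def mult_right_assoc adj_mult)
    also have "\<dots> = trace ((diagm (\<lambda>i. complex_of_real (f (a i))) ** R ** diagm (\<lambda>i. complex_of_real (g (b i)))) ** adj R)"
      by (rule trace_unitary_conj[OF U(1)])
    also have "\<dots> = (\<Sum>i\<in>UNIV. \<Sum>j\<in>UNIV. f (a i) * R $ i $ j * g (b j) * cnj (R $ i $ j))"
      unfolding trace_def matrix_nth_mult[of _ "adj R"] mult_diagm_nth diagm_mult_nth adj_nth ..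
    also have "\<dots> = (\<Sum>i\<in>UNIV. \<Sum>j\<in>UNIV. complex_of_real (w i j * (f (a i) * g (b j))))"
      by (intro sum.cong refl) (simp add: w_def cmod_sq mult_ac)
    finally show ?thesis by simp
  qed
  have w1: "(\<Sum>j\<in>UNIV. w i j) = 1" for i
  proof -
    have "(R ** adj R) $ i $ i = 1" using uR by (simp add: mat_def)
    then have "(\<Sum>j\<in>UNIV. complex_of_real (w i j)) = 1"
      by (simp add: matrix_nth_mult w_def cmod_sq)
    then show ?thesis by (metis of_real_eq_1_iff of_real_sum)
  qed
  have w2: "(\<Sum>i\<in>UNIV. w i j) = 1" for j
  proof -
    have "(adj R ** R) $ j $ j = 1" using uR by (simp add: mat_def)
    then have "(\<Sum>i\<in>UNIV. complex_of_real (w i j)) = 1"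
      by (simp add: matrix_nth_mult w_def cmod_sq mult.commute)
    then show ?thesis by (metis of_real_eq_1_iff of_real_sum)
  qed
  show ?thesis
    by (rule that[of w a b]) (use tr w1 w2 U V in \<open>simp_all add: trace_unitary_conj trace_diagm w_def\<close>)
qed

text \<open>The scalar inequality is averaged over the weights of \<open>spectral_pair\<close>; row
  and column sums 1 separate the terms in \<open>x\<close> and \<open>y\<close>. The guarded
  premises restrict \<open>x\<close> and \<open>y\<close> to where the spectra can lie, so one
  statement serves psd and pd matrices.\<close>

lemma trace_fun_calc_mult_le:
  assumes "herm A" "herm B"
    and "\<And>x y. (psd A \<Longrightarrow> x \<ge> 0) \<Longrightarrow> (psd B \<Longrightarrow> y \<ge> 0) \<Longrightarrow> (pd A \<Longrightarrow> x > 0) \<Longrightarrow> (pd B \<Longrightarrow> y > 0) \<Longrightarrow> f x * g y \<le> u x + v y"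
  shows "Re (trace (fun_calc (\<lambda>x. complex_of_real (f x)) A ** fun_calc (\<lambda>x. complex_of_real (g x)) B))
    \<le> Re (trace (fun_calc (\<lambda>x. complex_of_real (u x)) A)) + Re (trace (fun_calc (\<lambda>x. complex_of_real (v x)) B))"
proof (rule spectral_pair[OF assms(1,2)])
  fix a b w assume *:
    "\<And>f g. Re (trace (fun_calc (\<lambda>x. complex_of_real (f x)) A ** fun_calc (\<lambda>x. complex_of_real (g x)) B)) = (\<Sum>i\<in>UNIV. \<Sum>j\<in>UNIV. w i j * (f (a i) * g (b j)))"
    "\<And>f. trace (fun_calc f A) = (\<Sum>i\<in>UNIV. f (a i))"
    "\<And>f. trace (fun_calc f B) = (\<Sum>i\<in>UNIV. f (b i))"
    "\<And>i j. w i j \<ge> 0" "\<And>i. (\<Sum>j\<in>UNIV. w i j) = 1" "\<And>j. (\<Sum>i\<in>UNIV. w i j) = 1"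
    "\<And>i. psd A \<Longrightarrow> a i \<ge> 0" "\<And>i. psd B \<Longrightarrow> b i \<ge> 0"
    "\<And>i. pd A \<Longrightarrow> a i > 0" "\<And>i. pd B \<Longrightarrow> b i > 0"
  have "(\<Sum>i\<in>UNIV. \<Sum>j\<in>UNIV. w i j * (f (a i) * g (b j))) \<le> (\<Sum>i\<in>UNIV. \<Sum>j\<in>UNIV. w i j * (u (a i) + v (b j)))"
  proof (intro sum_mono mult_left_mono)
    show "f (a i) * g (b j) \<le> u (a i) + v (b j)" for i j
      by (rule assms(3)) (fact *(7-10))+
  qed (rule *(4))
  also have "\<dots> = (\<Sum>i\<in>UNIV. \<Sum>j\<in>UNIV. w i j * u (a i)) + (\<Sum>j\<in>UNIV. \<Sum>i\<in>UNIV. w i j * v (b j))"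
    by (subst sum.swap[of _ UNIV UNIV, where g = "\<lambda>j i. w i j * v (b j)"]) (simp add: distrib_left sum.distrib)
  also have "\<dots> = (\<Sum>i\<in>UNIV. u (a i)) + (\<Sum>j\<in>UNIV. v (b j))"
    by (simp add: sum_distrib_right[symmetric] *(5,6))
  finally show ?thesis unfolding *(1-3) by simp
qed

subsection \<open>Real and complex powers\<close>

definition rpow :: "real \<Rightarrow> real \<Rightarrow> real" where
  "rpow p x = (if x > 0 then x powr p else 0)"

text \<open>Entire in \<open>z\<close> for each fixed \<open>x\<close>, including
  \<open>x \<le> 0\<close>, so that \<open>cpow\<close> is entire for singular matrices too. In
  exchange, for psd \<open>M\<close> the power \<open>cpow M 0\<close> is only the projection onto
  the support.\<close>

definition cpow_scalar :: "complex \<Rightarrow> real \<Rightarrow> complex" where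
  "cpow_scalar z x = (if x > 0 then exp (z * complex_of_real (ln x)) else 0)"

definition cpow :: "complex^'n^'n \<Rightarrow> complex \<Rightarrow> complex^'n^'n" where
  "cpow M z = fun_calc (cpow_scalar z) M"

lemma rpow_nonneg [simp]: "rpow p x \<ge> 0" by (simp add: rpow_def)

lemma rpow_pos [simp]: "x > 0 \<Longrightarrow> rpow p x > 0" by (simp add: rpow_def)

lemma rpow_eq: "x > 0 \<Longrightarrow> rpow p x = x powr p" by (simp add: rpow_def)

lemma rpow_eq': "x \<ge> 0 \<Longrightarrow> rpow p x = x powr p" by (auto simp: rpow_def)

lemma mpow_fun_calc: "mpow M p = fun_calc (\<lambda>x. complex_of_real (rpow p x)) M"
  unfolding mpow_def fun_calc_def rpow_def by (simp only: if_distrib[of complex_of_real] of_real_0)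

lemma cpow_scalar_of_real: "cpow_scalar (complex_of_real p) x = complex_of_real (rpow p x)"
  by (simp add: cpow_scalar_def rpow_def powr_def exp_of_real[symmetric])

lemma mpow_cpow: "mpow M p = cpow M (complex_of_real p)"
  unfolding mpow_fun_calc cpow_def by (rule arg_cong[where f = "\<lambda>f. fun_calc f M"]) (simp add: cpow_scalar_of_real fun_eq_iff)

lemma cpow_add: "herm M \<Longrightarrow> cpow M z ** cpow M w = cpow M (z + w)"
proof -
  have "cpow_scalar z x * cpow_scalar w x = cpow_scalar (z + w) x" for x by (simp add: cpow_scalar_def exp_add[symmetric] ring_distribs)
  then show "herm M \<Longrightarrow> ?thesis" by (simp add: cpow_def fun_calc_mult)
qed

lemma adj_cpow: "herm M \<Longrightarrow> adj (cpow M z) = cpow M (cnj z)"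
proof -
  have "cnj (cpow_scalar z x) = cpow_scalar (cnj z) x" for x by (simp add: cpow_scalar_def exp_cnj)
  then show "herm M \<Longrightarrow> ?thesis" by (simp add: cpow_def adj_fun_calc)
qed

lemma cpow_0: "pd M \<Longrightarrow> cpow M 0 = mat 1"
proof -
  assume M: "pd M"
  have "cpow M 0 = fun_calc (\<lambda>x. 1) M" unfolding cpow_def by (rule fun_calc_cong_pd[OF M]) (simp add: cpow_scalar_def)
  then show ?thesis using M by (simp add: fun_calc_one)
qed

lemma cmod_cpow_scalar_imag: "cmod (cpow_scalar (\<i> * complex_of_real t) x) \<le> 1"
  by (simp add: cpow_scalar_def)

lemma norm_cpow_imag_mult: "herm M \<Longrightarrow> norm (cpow M (\<i> * complex_of_real t) ** X) \<le> norm X"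
  using norm_fun_calc_mult_le[of M "cpow_scalar (\<i> * complex_of_real t)" 1 X] cmod_cpow_scalar_imag by (simp add: cpow_def)

lemma norm_mult_cpow_imag: "herm M \<Longrightarrow> norm (X ** cpow M (\<i> * complex_of_real t)) \<le> norm X"
  using norm_mult_fun_calc_le[of M "cpow_scalar (\<i> * complex_of_real t)" 1 X] cmod_cpow_scalar_imag by (simp add: cpow_def)

lemma unitary_cpow_imag: "pd M \<Longrightarrow> unitary (cpow M (\<i> * complex_of_real t))"
  by (simp only: unitary_def adj_cpow cpow_add pd_herm) (simp add: cpow_0)

lemma herm_mpow [simp]: "herm M \<Longrightarrow> herm (mpow M p)"
  by (simp add: mpow_fun_calc)

lemma adj_mpow [simp]: "herm M \<Longrightarrow> adj (mpow M p) = mpow M p"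
  using herm_mpow by (auto simp: herm_def)

lemma psd_mpow [simp]: "psd M \<Longrightarrow> psd (mpow M p)"
  by (simp add: mpow_fun_calc psd_fun_calc)

lemma pd_mpow [simp]: "pd M \<Longrightarrow> pd (mpow M p)"
  by (simp add: mpow_fun_calc pd_fun_calc)

lemma mpow_add: "herm M \<Longrightarrow> mpow M p ** mpow M q = mpow M (p + q)"
  by (simp add: mpow_cpow cpow_add)

lemma mpow_add_left: "herm M \<Longrightarrow> mpow M p ** (mpow M q ** X) = mpow M (p + q) ** X"
  by (simp add: matrix_mul_assoc mpow_add)

lemma mpow_0: "pd M \<Longrightarrow> mpow M 0 = mat 1"
  by (simp add: mpow_cpow cpow_0)

lemma mpow_1: "psd M \<Longrightarrow> mpow M 1 = M"
  unfolding mpow_fun_calc by (subst fun_calc_cong[of M _ complex_of_real]) (auto simp: rpow_def)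

lemma mpow_mpow: "herm M \<Longrightarrow> mpow (mpow M p) q = mpow M (p * q)"
  unfolding mpow_fun_calc by (subst fun_calc_comp) (auto simp: rpow_def powr_powr intro!: arg_cong[where f = "\<lambda>f. fun_calc f M"])

lemma mpow_scaleR:
  assumes "psd M" "c > 0" shows "mpow (c *\<^sub>R M) p = (c powr p) *\<^sub>R mpow M p"
proof (rule psdE[OF assms(1)])
  fix U d assume U: "unitary U" "M = U ** diagm (\<lambda>i. complex_of_real (d i)) ** adj U"
    "\<And>f. fun_calc f M = U ** diagm (\<lambda>i. f (d i)) ** adj U" "\<And>i. d i \<ge> 0"
  have s: "U ** diagm (\<lambda>i. complex_of_real (a * e i)) ** adj U = a *\<^sub>R (U ** diagm (\<lambda>i. complex_of_real (e i)) ** adj U)" for a e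
  proof -
    have "diagm (\<lambda>i. complex_of_real (a * e i)) = a *\<^sub>R diagm (\<lambda>i. complex_of_real (e i))"
      by (simp add: vec_eq_iff diagm_nth scaleR_conv_of_real[where 'a=complex])
    then show ?thesis by (simp only: scaleR_mult_left scaleR_mult_right)
  qed
  have "mpow (c *\<^sub>R M) p = U ** diagm (\<lambda>i. complex_of_real (rpow p (c * d i))) ** adj U"
    unfolding mpow_fun_calc U(2) s[symmetric] by (rule fun_calc_diag[OF U(1)])
  also have "(\<lambda>i. complex_of_real (rpow p (c * d i))) = (\<lambda>i. complex_of_real (c powr p * rpow p (d i)))"
    using assms(2) U(4) by (auto simp: rpow_eq' powr_mult)
  finally show "mpow (c *\<^sub>R M) p = (c powr p) *\<^sub>R mpow M p" unfolding s mpow_fun_calc U(3) .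
qed

section \<open>Functional calculus under conjugation and for Gram matrices\<close>

lemma fun_calc_unitary_conj:
  assumes "herm A" "unitary V" shows "fun_calc f (V ** A ** adj V) = V ** fun_calc f A ** adj V"
proof (rule hermE[OF assms(1)])
  fix U d assume U: "unitary U" "A = U ** diagm (\<lambda>i. complex_of_real (d i)) ** adj U"
    "\<And>f. fun_calc f A = U ** diagm (\<lambda>i. f (d i)) ** adj U"
  show ?thesis
    using fun_calc_diag[OF unitary_mult[OF assms(2) U(1)], of f d] unfolding U(3) by (simp add: U(2) adj_mult mult_right_assoc)
qed

text \<open>\<open>Q\<close> intertwines \<open>adj Q ** Q\<close> with \<open>Q ** adj Q\<close>,
  hence also their functions; the extra factor \<open>x\<close> comes from the
  \<open>Q ** adj Q\<close> that is left over.\<close>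

lemma fun_calc_gram:
  fixes Q :: "complex^'n^'m"
  shows "Q ** fun_calc f (adj Q ** Q) ** adj Q = fun_calc (\<lambda>x. f x * of_real x) (Q ** adj Q)"
proof -
  have h: "herm (adj Q ** Q)" "herm (Q ** adj Q)" by simp_all
  have "fun_calc f (Q ** adj Q) ** Q = Q ** fun_calc f (adj Q ** Q)"
    by (rule fun_calc_intertwine[OF h(2,1)]) (simp add: mult_right_assoc)
  then have "Q ** fun_calc f (adj Q ** Q) ** adj Q = fun_calc f (Q ** adj Q) ** (Q ** adj Q)" by (simp add: matrix_mul_assoc)
  also have "\<dots> = fun_calc f (Q ** adj Q) ** fun_calc complex_of_real (Q ** adj Q)" by (simp only: fun_calc_id[OF h(2)])
  finally show ?thesis by (simp only: fun_calc_mult[OF h(2)])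
qed

text \<open>The two Gram matrices share their nonzero spectrum. \<open>fun_calc_gram\<close> is used
  with exponent \<open>p - 1\<close>, which is fine for every real \<open>p\<close> because powers
  live on the support.\<close>

lemma trace_mpow_gram:
  "trace (mpow (adj Q ** Q) p) = trace (mpow (Q ** adj Q) p)"
proof -
  have h: "herm (adj Q ** Q)" by simp
  have e: "(\<lambda>x. complex_of_real (rpow (p - 1) x) * complex_of_real x) = (\<lambda>x. complex_of_real (rpow p x))"
    by (auto simp: rpow_def powr_diff)
  have "mpow (Q ** adj Q) p = Q ** mpow (adj Q ** Q) (p - 1) ** adj Q"
    unfolding mpow_fun_calc fun_calc_gram e ..
  also have "trace \<dots> = trace (mpow (adj Q ** Q) (p - 1) ** (adj Q ** Q))"
    using trace_mul_sym[of Q "mpow (adj Q ** Q) (p - 1) ** adj Q"] by (simp add: mult_right_assoc)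
  also have "mpow (adj Q ** Q) (p - 1) ** (adj Q ** Q) = mpow (adj Q ** Q) (p - 1) ** fun_calc complex_of_real (adj Q ** Q)"
    by (simp only: fun_calc_id[OF h])
  also have "\<dots> = mpow (adj Q ** Q) p" by (simp only: mpow_fun_calc fun_calc_mult[OF h] e)
  finally show ?thesis ..
qed

subsection \<open>Hadamard's three lines theorem\<close>

lemma three_lines_le_1:
  fixes g :: "complex \<Rightarrow> complex"
  assumes hol: "g holomorphic_on UNIV" and bd: "\<And>z. 0 \<le> Re z \<Longrightarrow> Re z \<le> 1 \<Longrightarrow> cmod (g z) \<le> B"
    and l: "\<And>t. cmod (g (\<i> * of_real t)) \<le> 1" and r: "\<And>t. cmod (g (1 + \<i> * of_real t)) \<le> 1"
    and \<theta>: "0 < \<theta>" "\<theta> < 1"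
  shows "cmod (g (of_real \<theta>)) \<le> 1"
proof -
  have "cmod (g (of_real \<theta>)) \<le> exp e" if e: "e > 0" for e
  proof -
    \<comment> \<open>The Gaussian factor forces decay in the imaginary direction, so the maximum
      principle on a box suffices. The \<open>- 1\<close> compensates
      \<open>(Re z)\<^sup>2 \<le> 1\<close> on the strip and leaves modulus at most
      \<open>exp (- e * (Im z)\<^sup>2)\<close>.\<close>
    define h where "h z = g z * exp (of_real e * (z * z - 1))" for z
    \<comment> \<open>High enough that
      \<open>\<bar>B\<bar> \<le> e * T\<^sup>2 \<le> exp (e * T\<^sup>2)\<close>, so the decay beats
      the crude bound \<open>B\<close> on the horizontal sides.\<close>
    define T where "T = sqrt (\<bar>B\<bar> / e) + 1"
    have T: "T > 0" using e by (simp add: T_def add_nonneg_pos)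
    have eb: "cmod (exp (of_real e * (z * z - 1))) \<le> exp (- e * (Im z)\<^sup>2)" if "0 \<le> Re z" "Re z \<le> 1" for z
    proof -
      have "Re z * Re z \<le> 1" using that by (simp add: mult_le_one)
      then have "e * (Re z * Re z - Im z * Im z - 1) \<le> e * (- (Im z)\<^sup>2)" using e
        by (intro mult_left_mono) (auto simp: power2_eq_square)
      then show ?thesis by (simp add: norm_exp_eq_Re)
    qed
    have "cmod (h (of_real \<theta>)) \<le> 1"
    proof (rule maximum_modulus_frontier[of h "cbox (Complex 0 (- T)) (Complex 1 T)"])
      show "h holomorphic_on interior (cbox (Complex 0 (- T)) (Complex 1 T))"
        unfolding h_def using hol holomorphic_on_subset by (intro holomorphic_intros) blast+
      have "continuous_on UNIV g" using hol holomorphic_on_imp_continuous_on by blast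
      then show "continuous_on (closure (cbox (Complex 0 (- T)) (Complex 1 T))) h"
        unfolding h_def by (intro continuous_intros) (auto intro: continuous_on_subset)
      show "of_real \<theta> \<in> cbox (Complex 0 (- T)) (Complex 1 T)"
        using T \<theta> by (simp add: in_cbox_complex_iff)
      fix z assume "z \<in> frontier (cbox (Complex 0 (- T)) (Complex 1 T))"
      then have z: "0 \<le> Re z" "Re z \<le> 1" and "Re z = 0 \<or> Re z = 1 \<or> \<bar>Im z\<bar> = T"
        using T by (auto simp: frontier_cbox in_cbox_complex_iff in_box_complex_iff)
      then consider "Re z = 0" | "Re z = 1" | "\<bar>Im z\<bar> = T" by blast
      then show "cmod (h z) \<le> 1"
      proof cases
        case 1
        have "cmod (g z) * cmod (exp (of_real e * (z * z - 1))) \<le> 1 * 1"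
          using l[of "Im z"] 1 complex_eq[of z] eb[OF z] e
          by (intro mult_mono) (auto intro: order_trans)
        then show ?thesis by (simp add: h_def norm_mult)
      next
        case 2
        have "cmod (g z) * cmod (exp (of_real e * (z * z - 1))) \<le> 1 * 1"
          using r[of "Im z"] 2 complex_eq[of z] eb[OF z] e
          by (intro mult_mono) (auto intro: order_trans)
        then show ?thesis by (simp add: h_def norm_mult)
      next
        case 3
        have "\<bar>B\<bar> \<le> e * T\<^sup>2"
        proof -
          have "\<bar>B\<bar> / e = (sqrt (\<bar>B\<bar> / e))\<^sup>2" using e by simp
          also have "\<dots> \<le> T\<^sup>2" unfolding T_def using e by (intro power_mono) auto
          finally show ?thesis using e by (simp add: field_simps)
        qed
        also have "\<dots> \<le> exp (e * T\<^sup>2)" using exp_ge_add_one_self[of "e * T\<^sup>2"] by linarith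
        finally have B: "\<bar>B\<bar> * exp (- e * T\<^sup>2) \<le> 1" by (simp add: exp_minus field_simps)
        have "(Im z)\<^sup>2 = T\<^sup>2" using 3 by (metis power2_abs)
        then have "cmod (g z) * cmod (exp (of_real e * (z * z - 1))) \<le> \<bar>B\<bar> * exp (- e * T\<^sup>2)"
          using bd[OF z] eb[OF z] by (intro mult_mono) auto
        then show ?thesis using B by (simp add: h_def norm_mult)
      qed
    qed simp_all
    then have "cmod (g (of_real \<theta>)) * exp (e * (\<theta> * \<theta> - 1)) \<le> 1"
      by (simp add: h_def norm_mult norm_exp_eq_Re)
    then have "cmod (g (of_real \<theta>)) \<le> exp (e * (1 - \<theta> * \<theta>))"
      by (simp add: exp_minus[symmetric] field_simps exp_diff)
    also have "\<dots> \<le> exp e" using e \<theta> by (simp add: mult_left_le)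
    finally show ?thesis .
  qed
  then have "eventually (\<lambda>e. cmod (g (of_real \<theta>)) \<le> exp e) (at_right 0)"
    by (simp add: eventually_at_right_less eventually_mono[OF eventually_at_right_less])
  moreover have "((\<lambda>e. exp e) \<longlongrightarrow> exp (0::real)) (at_right 0)" by (intro tendsto_intros)
  ultimately show ?thesis
    using tendsto_lowerbound[of exp "exp 0" "at_right (0::real)" "cmod (g (of_real \<theta>))"] by simp
qed

lemma three_lines_scalar:
  fixes f :: "complex \<Rightarrow> complex"
  assumes hol: "f holomorphic_on UNIV" and bd: "\<And>z. 0 \<le> Re z \<Longrightarrow> Re z \<le> 1 \<Longrightarrow> cmod (f z) \<le> B"
    and l: "\<And>t. cmod (f (\<i> * of_real t)) \<le> M0" and r: "\<And>t. cmod (f (1 + \<i> * of_real t)) \<le> M1"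
    and M: "M0 > 0" "M1 > 0" and \<theta>: "0 < \<theta>" "\<theta> < 1"
  shows "cmod (f (of_real \<theta>)) \<le> M0 powr (1 - \<theta>) * M1 powr \<theta>"
proof -
  \<comment> \<open>Inverse of the interpolated bound, \<open>M0\<close> to the power
    \<open>1 - z\<close> times \<open>M1\<close> to the power \<open>z\<close>; multiplication by it
    brings both boundary bounds to 1.\<close>
  define E where "E z = exp ((z - 1) * of_real (ln M0) - z * of_real (ln M1))" for z :: complex
  have E: "cmod (E z) = M0 powr (Re z - 1) * M1 powr (- Re z)" for z
    using M by (simp add: E_def norm_exp_eq_Re powr_def exp_add[symmetric])
  have "cmod (f (of_real \<theta>) * E (of_real \<theta>)) \<le> 1"
  proof (rule three_lines_le_1[where g = "\<lambda>z. f z * E z", OF _ _ _ _ \<theta>])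
    show "(\<lambda>z. f z * E z) holomorphic_on UNIV" unfolding E_def by (intro holomorphic_intros hol)
    fix z :: complex assume z: "0 \<le> Re z" "Re z \<le> 1"
    have "cmod (E z) \<le> exp (\<bar>ln M0\<bar> + \<bar>ln M1\<bar>)"
    proof -
      have "(Re z - 1) * ln M0 \<le> \<bar>(Re z - 1) * ln M0\<bar>" by simp
      also have "\<dots> \<le> \<bar>ln M0\<bar>" using z by (simp add: abs_mult mult_left_le_one_le)
      finally have 1: "(Re z - 1) * ln M0 \<le> \<bar>ln M0\<bar>" .
      have "- (Re z * ln M1) \<le> \<bar>Re z * ln M1\<bar>" by simp
      also have "\<dots> \<le> \<bar>ln M1\<bar>" using z by (simp add: abs_mult mult_left_le_one_le)
      finally show ?thesis using 1 by (simp add: E_def norm_exp_eq_Re)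
    qed
    then show "cmod (f z * E z) \<le> \<bar>B\<bar> * exp (\<bar>ln M0\<bar> + \<bar>ln M1\<bar>)"
      unfolding norm_mult using bd[OF z] by (intro mult_mono) auto
  next
    fix t :: real
    show "cmod (f (\<i> * of_real t) * E (\<i> * of_real t)) \<le> 1"
      using l[of t] M by (simp add: norm_mult E powr_minus field_simps)
    show "cmod (f (1 + \<i> * of_real t) * E (1 + \<i> * of_real t)) \<le> 1"
      using r[of t] M by (simp add: norm_mult E powr_minus field_simps)
  qed
  then show ?thesis using M by (simp add: norm_mult E powr_minus powr_diff field_simps)
qed

lemma cmod_trace_adj_mult_le: "cmod (trace (adj A ** B)) \<le> norm A * norm (B :: complex^'n^'m)"
proof -
  have L: "L2_set (\<lambda>(i,k). cmod (C $ k $ i)) UNIV = norm C" for C :: "complex^'n^'m"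
  proof -
    have "(\<Sum>(i,k)\<in>UNIV. (cmod (C $ k $ i))\<^sup>2) = (\<Sum>i\<in>UNIV. \<Sum>k\<in>UNIV. (cmod (C $ k $ i))\<^sup>2)"
      by (simp add: sum.cartesian_product UNIV_Times_UNIV)
    also have "\<dots> = (norm C)\<^sup>2" unfolding norm_matrix_sq by (rule sum.swap)
    finally show ?thesis by (simp add: L2_set_def case_prod_beta)
  qed
  have "trace (adj A ** B) = (\<Sum>i\<in>UNIV. \<Sum>k\<in>UNIV. cnj (A $ k $ i) * B $ k $ i)"
    by (simp add: trace_def matrix_nth_mult)
  also have "\<dots> = (\<Sum>(i,k)\<in>UNIV. cnj (A $ k $ i) * B $ k $ i)"
    by (simp add: sum.cartesian_product UNIV_Times_UNIV)
  finally have "cmod (trace (adj A ** B)) \<le> (\<Sum>(i,k)\<in>UNIV. cmod (A $ k $ i) * cmod (B $ k $ i))"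
    by (simp add: order_trans[OF norm_sum] norm_mult case_prod_beta)
  also have "\<dots> \<le> L2_set (\<lambda>(i,k). cmod (A $ k $ i)) UNIV * L2_set (\<lambda>(i,k). cmod (B $ k $ i)) UNIV"
    using L2_set_mult_ineq[of "\<lambda>(i,k). cmod (A $ k $ i)" "\<lambda>(i,k). cmod (B $ k $ i)" UNIV]
    by (simp add: case_prod_beta)
  finally show ?thesis unfolding L .
qed

text \<open>The regularity hypotheses of the three lines theorem, bundled so that they can be
  checked factor by factor.\<close>

definition strip_ok :: "(complex \<Rightarrow> complex^'n^'m) \<Rightarrow> bool" where
  "strip_ok F \<longleftrightarrow> (\<forall>i j. (\<lambda>z. F z $ i $ j) holomorphic_on UNIV) \<and> (\<exists>B. \<forall>z. 0 \<le> Re z \<longrightarrow> Re z \<le> 1 \<longrightarrow> norm (F z) \<le> B)"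

lemma strip_ok_const [simp]: "strip_ok (\<lambda>z. A)"
  by (auto simp: strip_ok_def)

lemma strip_ok_mult: 
  assumes "strip_ok F" "strip_ok G" shows "strip_ok (\<lambda>z. F z ** G z)"
proof -
  obtain B where B: "\<And>z. 0 \<le> Re z \<Longrightarrow> Re z \<le> 1 \<Longrightarrow> norm (F z) \<le> B" using assms(1) by (auto simp: strip_ok_def)
  obtain C where C: "\<And>z. 0 \<le> Re z \<Longrightarrow> Re z \<le> 1 \<Longrightarrow> norm (G z) \<le> C" using assms(2) by (auto simp: strip_ok_def)
  have "norm (F z ** G z) \<le> B * C" if "0 \<le> Re z" "Re z \<le> 1" for z
    by (rule order_trans[OF norm_matrix_mult])
       (use B[OF that] C[OF that] in \<open>intro mult_mono, auto intro: order_trans[OF norm_ge_zero]\<close>)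
  then show ?thesis using assms unfolding strip_ok_def matrix_nth_mult
    by (auto intro!: holomorphic_intros)
qed

lemma strip_ok_cpow: fixes M :: "complex^'n^'n" assumes "herm M" shows "strip_ok (\<lambda>z. cpow M (of_real u + of_real v * z))"
proof (rule hermE[OF assms])
  fix U d assume U: "unitary U" "\<And>f. fun_calc f M = U ** diagm (\<lambda>i. f (d i)) ** adj U"
  define k where "k = (\<Sum>i\<in>UNIV. exp ((\<bar>u\<bar> + \<bar>v\<bar>) * \<bar>ln (d i)\<bar>))"
  have b: "cmod (cpow_scalar (of_real u + of_real v * z) (d i)) \<le> k" if "0 \<le> Re z" "Re z \<le> 1" for z i
  proof -
    have "(u + v * Re z) * ln (d i) \<le> \<bar>(u + v * Re z) * ln (d i)\<bar>" by simp
    also have "\<dots> = \<bar>u + v * Re z\<bar> * \<bar>ln (d i)\<bar>" by (rule abs_mult)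
    also have "\<dots> \<le> (\<bar>u\<bar> + \<bar>v\<bar>) * \<bar>ln (d i)\<bar>"
    proof (rule mult_right_mono)
      have "\<bar>u + v * Re z\<bar> \<le> \<bar>u\<bar> + \<bar>v * Re z\<bar>" by simp
      also have "\<bar>v * Re z\<bar> \<le> \<bar>v\<bar>" using that by (simp add: abs_mult mult_left_le)
      finally show "\<bar>u + v * Re z\<bar> \<le> \<bar>u\<bar> + \<bar>v\<bar>" by simp
    qed simp
    finally have "cmod (cpow_scalar (of_real u + of_real v * z) (d i)) \<le> exp ((\<bar>u\<bar> + \<bar>v\<bar>) * \<bar>ln (d i)\<bar>)"
      by (simp add: cpow_scalar_def norm_exp_eq_Re)
    also have "\<dots> \<le> k" unfolding k_def
      by (rule member_le_sum[where f = "\<lambda>i. exp ((\<bar>u\<bar> + \<bar>v\<bar>) * \<bar>ln (d i)\<bar>)"]) auto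
    finally show ?thesis .
  qed
  have k0: "k \<ge> 0" by (simp add: k_def sum_nonneg)
  have "(\<lambda>z. cpow_scalar (of_real u + of_real v * z) (d i)) holomorphic_on UNIV" for i
    by (cases "d i > 0") (auto simp: cpow_scalar_def intro!: holomorphic_intros)
  moreover have "norm (U ** diagm (\<lambda>i. cpow_scalar (of_real u + of_real v * z) (d i)) ** adj U) \<le> k * norm (mat 1 :: complex^'n^'n)"
    if "0 \<le> Re z" "Re z \<le> 1" for z
    using norm_diagm_mult_le[of "\<lambda>i. cpow_scalar (of_real u + of_real v * z) (d i)" k "mat 1 :: complex^'n^'n"] b[OF that] k0 U(1)
      norm_mult_unitary[of "adj U"] by (simp add: mult_right_assoc)
  ultimately show ?thesis
    unfolding strip_ok_def cpow_def U(2) matrix_nth_mult[of _ "adj U"] mult_diagm_nth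
    by (intro conjI allI exI[of _ "k * norm (mat 1 :: complex^'n^'n)"]) (auto intro!: holomorphic_intros)
qed

text \<open>Pairing \<open>F\<close> with the fixed matrix \<open>F (of_real \<theta>)\<close> gives
  a scalar entire function whose value at \<open>\<theta>\<close> is the squared norm.
  Cauchy-Schwarz bounds it on the two lines, and one factor of the norm cancels. Squares are used
  because they are traces.\<close>

theorem three_lines:
  fixes F :: "complex \<Rightarrow> complex^'n^'m"
  assumes F: "strip_ok F"
    and l: "\<And>t. (norm (F (\<i> * of_real t)))\<^sup>2 \<le> M0" and r: "\<And>t. (norm (F (1 + \<i> * of_real t)))\<^sup>2 \<le> M1"
    and M: "M0 > 0" "M1 > 0" and \<theta>: "0 < \<theta>" "\<theta> < 1"
  shows "(norm (F (of_real \<theta>)))\<^sup>2 \<le> M0 powr (1 - \<theta>) * M1 powr \<theta>"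
proof (cases "F (of_real \<theta>) = 0")
  case True
  then show ?thesis by simp
next
  case False
  define N where "N = norm (F (of_real \<theta>))"
  have N: "N > 0" using False by (simp add: N_def)
  define f where "f z = trace (adj (F (of_real \<theta>)) ** F z)" for z
  obtain B where B: "\<And>z. 0 \<le> Re z \<Longrightarrow> Re z \<le> 1 \<Longrightarrow> norm (F z) \<le> B" using F by (auto simp: strip_ok_def)
  have fN: "cmod (f z) \<le> N * norm (F z)" for z
    unfolding f_def N_def by (rule cmod_trace_adj_mult_le)
  have sq: "norm (F z) \<le> sqrt m" if "(norm (F z))\<^sup>2 \<le> m" for z m using that by (rule real_le_rsqrt)
  have "cmod (f (of_real \<theta>)) \<le> (N * sqrt M0) powr (1 - \<theta>) * (N * sqrt M1) powr \<theta>"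
  proof (rule three_lines_scalar[where f = f and B = "N * B", OF _ _ _ _ _ _ \<theta>])
    show "f holomorphic_on UNIV" using F unfolding f_def strip_ok_def trace_def matrix_nth_mult
      by (auto intro!: holomorphic_intros)
    show "cmod (f z) \<le> N * B" if "0 \<le> Re z" "Re z \<le> 1" for z
      using fN[of z] B[OF that] N by (meson mult_left_mono order_trans less_imp_le)
    show "cmod (f (\<i> * of_real t)) \<le> N * sqrt M0" for t
      using fN sq[OF l[of t]] N by (meson mult_left_mono order_trans less_imp_le)
    show "cmod (f (1 + \<i> * of_real t)) \<le> N * sqrt M1" for t
      using fN sq[OF r[of t]] N by (meson mult_left_mono order_trans less_imp_le)
  qed (use N M in auto)
  also have "\<dots> = N * sqrt (M0 powr (1 - \<theta>) * M1 powr \<theta>)"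
    using N M by (simp add: powr_mult powr_half_sqrt[symmetric] powr_powr mult.commute)
      (simp add: mult_ac powr_add[symmetric])
  finally have a: "cmod (f (of_real \<theta>)) \<le> N * sqrt (M0 powr (1 - \<theta>) * M1 powr \<theta>)" .
  have "Re (f (of_real \<theta>)) = N\<^sup>2" by (simp add: f_def N_def norm_sq_trace')
  then have "N * N \<le> N * sqrt (M0 powr (1 - \<theta>) * M1 powr \<theta>)"
    using a complex_Re_le_cmod[of "f (of_real \<theta>)"] by (simp add: power2_eq_square)
  then have "N \<le> sqrt (M0 powr (1 - \<theta>) * M1 powr \<theta>)" using N by simp
  then have "N\<^sup>2 \<le> (sqrt (M0 powr (1 - \<theta>) * M1 powr \<theta>))\<^sup>2" using N by (intro power_mono) auto
  then show ?thesis using M by (simp add: N_def)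
qed

subsection \<open>Schatten quasi-norms of positive matrices\<close>

definition schatten :: "real \<Rightarrow> complex^'n^'n \<Rightarrow> real" where
  "schatten p P = Re (trace (mpow P p)) powr (1 / p)"

lemma schatten_nonneg [simp]: "schatten p P \<ge> 0" by (simp add: schatten_def)

lemma trace_mpow_zero_iff: assumes "psd P" shows "Re (trace (mpow P p)) = 0 \<longleftrightarrow> P = 0"
proof
  assume "Re (trace (mpow P p)) = 0"
  then have 0: "mpow P p = 0" using trace_psd_zero psd_mpow assms by blast
  have "P = mpow P (p + (1 - p))" using mpow_1[OF assms] by simp
  also have "\<dots> = mpow P p ** mpow P (1 - p)" using assms by (simp add: mpow_add)
  also have "\<dots> = 0" unfolding 0 by (simp add: vec_eq_iff matrix_nth_mult)
  finally show "P = 0" .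
next
  assume P: "P = 0"
  have e: "(0 :: complex^'a^'a) = mat 1 ** diagm (\<lambda>i. complex_of_real 0) ** adj (mat 1)"
    by (simp add: vec_eq_iff diagm_nth)
  have "mpow (0 :: complex^'a^'a) p = mat 1 ** diagm (\<lambda>i. complex_of_real (rpow p 0)) ** adj (mat 1)"
    unfolding mpow_fun_calc by (subst e) (rule fun_calc_diag[OF unitary_mat_1])
  then show "Re (trace (mpow P p)) = 0" by (simp add: P trace_diagm rpow_def)
qed

lemma trace_mpow_pos: "psd P \<Longrightarrow> P \<noteq> 0 \<Longrightarrow> Re (trace (mpow P p)) > 0"
  using trace_mpow_zero_iff[of P p] trace_psd_nonneg[OF psd_mpow, of P p] by simp

lemma schatten_pos: "psd P \<Longrightarrow> P \<noteq> 0 \<Longrightarrow> schatten p P > 0"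
  using trace_mpow_pos[of P p] by (simp add: schatten_def)

lemma schatten_powr: "psd P \<Longrightarrow> p > 0 \<Longrightarrow> schatten p P powr p = Re (trace (mpow P p))"
  using trace_psd_nonneg[OF psd_mpow, of P p] by (simp add: schatten_def powr_powr)

lemma schatten_gram: "schatten p (adj Q ** Q) = schatten p (Q ** adj Q)"
  by (simp add: schatten_def trace_mpow_gram)

text \<open>Young's inequality for pairs of eigenvalues, with weights \<open>1 - x\<close> and
  \<open>x\<close>. Scaling by \<open>s\<close>, the norm of \<open>P\<close>, makes the two
  resulting traces contribute \<open>(1 - x) * s\<close> and at most \<open>x * s\<close>.\<close>

lemma holder_trace:
  assumes P: "psd P" and \<tau>: "psd \<tau>" "Re (trace \<tau>) \<le> 1" and x: "0 < x" "x < 1"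
  shows "Re (trace (P ** mpow \<tau> x)) \<le> schatten (1 / (1 - x)) P"
proof (cases "P = 0")
  case True
  then show ?thesis by (simp add: trace_def matrix_nth_mult)
next
  case False
  define p where "p = 1 / (1 - x)"
  define s where "s = schatten p P"
  have p: "p > 0" "p * (1 - x) = 1" using x by (auto simp: p_def)
  have s: "s > 0" using schatten_pos[OF P False] by (simp add: s_def)
  have Y: "u * rpow x t \<le> (1 - x) * s powr (1 - p) * rpow p u + x * s * t" if "u \<ge> 0" "t \<ge> 0" for u t
  proof (cases "u = 0 \<or> t = 0")
    case True
    then show ?thesis using that x s by (auto simp: rpow_def)
  next
    case False
    then have ut: "u > 0" "t > 0" using that by auto
    have "((u / s) powr p) powr (1 - x) * t powr x \<le> (1 - x) * (u / s) powr p + x * t"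
      using Youngs_inequality_0[of "1 - x" x "(u / s) powr p" t] x ut s by simp
    moreover have "((u / s) powr p) powr (1 - x) = u / s" using p ut s by (simp add: powr_powr)
    ultimately have "s * (u / s * t powr x) \<le> s * ((1 - x) * (u / s) powr p + x * t)"
      using s by (intro mult_left_mono) auto
    moreover have "s powr (1 - p) = s / s powr p" using s by (simp add: powr_diff)
    ultimately show ?thesis using ut s by (simp add: rpow_def powr_divide algebra_simps)
  qed
  have "P ** mpow \<tau> x = fun_calc (\<lambda>y. complex_of_real y) P ** fun_calc (\<lambda>y. complex_of_real (rpow x y)) \<tau>"
    using P by (simp add: mpow_fun_calc)
  then have "Re (trace (P ** mpow \<tau> x)) \<le> Re (trace (fun_calc (\<lambda>y. complex_of_real ((1 - x) * s powr (1 - p) * rpow p y)) P))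
      + Re (trace (fun_calc (\<lambda>y. complex_of_real (x * s * y)) \<tau>))"
    using trace_fun_calc_mult_le[of P \<tau> "\<lambda>y. y" "rpow x" "\<lambda>y. (1 - x) * s powr (1 - p) * rpow p y" "\<lambda>y. x * s * y"] Y P \<tau> by auto
  also have "Re (trace (fun_calc (\<lambda>y. complex_of_real ((1 - x) * s powr (1 - p) * rpow p y)) P))
    = (1 - x) * s powr (1 - p) * Re (trace (mpow P p))"
    using P by (rule psdE) (simp add: mpow_fun_calc trace_unitary_conj trace_diagm sum_distrib_left mult.assoc)
  also have "Re (trace (mpow P p)) = s powr p" using P p by (simp add: s_def schatten_powr)
  also have "Re (trace (fun_calc (\<lambda>y. complex_of_real (x * s * y)) \<tau>)) = x * s * Re (trace \<tau>)"
    using \<tau>(1) by (rule psdE) (simp add: trace_unitary_conj trace_diagm sum_distrib_left)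
  also have "(1 - x) * s powr (1 - p) * s powr p = (1 - x) * s"
    using s by (simp add: mult.assoc powr_add[symmetric])
  also have "x * s * Re (trace \<tau>) \<le> x * s * 1" using x s \<tau>(2) by (intro mult_left_mono) auto
  finally show ?thesis by (simp add: s_def p_def algebra_simps)
qed

text \<open>Equality case of \<open>holder_trace\<close>. The explicit formula for
  \<open>\<tau>\<close> is exported because \<open>dual_witness\<close> has to identify this
  \<open>\<tau>\<close> with the one in the fixed point equation.\<close>

lemma schatten_attained:
  assumes P: "psd P" "P \<noteq> 0" and x: "0 < x" "x < 1"
  obtains \<tau> where "psd \<tau>" "trace \<tau> = 1" "P = schatten (1 / (1 - x)) P *\<^sub>R mpow \<tau> (1 - x)"
    "Re (trace (P ** mpow \<tau> x)) = schatten (1 / (1 - x)) P"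
    "\<tau> = (1 / Re (trace (mpow P (1 / (1 - x))))) *\<^sub>R mpow P (1 / (1 - x))"
proof -
  define p where "p = 1 / (1 - x)"
  define t where "t = Re (trace (mpow P p))"
  have p: "p > 0" "p * (1 - x) = 1" using x by (auto simp: p_def)
  have t: "t > 0" using trace_mpow_pos P by (simp add: t_def)
  have t': "trace (mpow P p) = t" using trace_psd_Im[OF psd_mpow[OF P(1)]] by (simp add: t_def complex_eq_iff)
  define \<tau> where "\<tau> = (1 / t) *\<^sub>R mpow P p"
  have 1: "psd \<tau>" using P t by (simp add: \<tau>_def psd_scaleR)
  have 2: "trace \<tau> = 1" using t by (simp add: \<tau>_def trace_scaleR t' scaleR_conv_of_real[where 'a=complex])
  have m: "mpow \<tau> y = (1 / t) powr y *\<^sub>R mpow P (p * y)" for y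
    unfolding \<tau>_def using t P by (simp add: mpow_scaleR mpow_mpow)
  have snt: "schatten p P = t powr (1 - x)" using p x by (simp add: schatten_def t_def p_def)
  have "schatten p P *\<^sub>R mpow \<tau> (1 - x) = P"
    unfolding m p(2) mpow_1[OF P(1)] snt using t by (simp add: powr_divide)
  then have 3: "P = schatten p P *\<^sub>R mpow \<tau> (1 - x)" ..
  have "P ** mpow \<tau> x = schatten p P *\<^sub>R (mpow \<tau> (1 - x) ** mpow \<tau> x)"
    by (subst 3) (simp add: scaleR_mult_left)
  also have "\<dots> = schatten p P *\<^sub>R \<tau>" using 1 by (simp add: mpow_add mpow_1)
  finally have 4: "Re (trace (P ** mpow \<tau> x)) = schatten p P" using 2 by (simp add: trace_scaleR)
  show ?thesis using that 1 2 3 4 unfolding p_def t_def \<tau>_def by blast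
qed

text \<open>Hoelder's inequality below exponent 1, where its direction reverses. Full rank of
  \<open>\<tau>\<close> is essential: \<open>mpow \<tau> (- x)\<close> vanishes off the support and
  would lose part of \<open>P\<close>.\<close>

lemma reverse_holder_trace:
  assumes P: "psd P" and \<tau>: "pd \<tau>" "Re (trace \<tau>) \<le> 1" and x: "0 < x"
  shows "schatten (1 / (1 + x)) P \<le> Re (trace (P ** mpow \<tau> (- x)))"
proof (cases "P = 0")
  case True
  then have "Re (trace (mpow P (1 / (1 + x)))) = 0" using trace_mpow_zero_iff P by blast
  then show ?thesis using True by (simp add: trace_def matrix_nth_mult schatten_def)
next
  case False
  define p where "p = 1 / (1 + x)"
  define s where "s = schatten p P"
  have p: "p > 0" "p * (1 + x) = 1" using x by (auto simp: p_def)
  have px: "p + p * x = 1" using p by (simp add: algebra_simps)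
  have s: "s > 0" using schatten_pos[OF P False] by (simp add: s_def)
  \<comment> \<open>Young's inequality with weights \<open>p\<close> and \<open>p * x\<close>, which
    add up to 1; the minus signs turn a lower bound on the product into the upper bound that
    \<open>trace_fun_calc_mult_le\<close> handles.\<close>
  have Y: "(- u) * rpow (- x) t \<le> - ((1 + x) * s powr (1 - p) * rpow p u) + x * s * t" if "u \<ge> 0" "t > 0" for u t
  proof (cases "u = 0")
    case True
    then show ?thesis using that x s by (auto simp: rpow_def)
  next
    case False
    then have u: "u > 0" using that by auto
    have "(u / s * t powr (- x)) powr p * t powr (p * x) \<le> p * (u / s * t powr (- x)) + p * x * t"
      using Youngs_inequality_0[of p "p * x" "u / s * t powr (- x)" t] x p px u that s by simp
    moreover have "(u / s * t powr (- x)) powr p * t powr (p * x) = (u / s) powr p"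
      using u s that by (simp add: powr_mult powr_powr powr_minus powr_divide field_simps)
    ultimately have "(1 + x) * s * (u / s) powr p \<le> (1 + x) * s * (p * (u / s * t powr (- x)) + p * x * t)"
      using s x by (intro mult_left_mono) auto
    also have "\<dots> = (p * (1 + x)) * (s * (u / s) * t powr (- x) + x * s * t)"
      by (simp only: distrib_left distrib_right mult_ac times_divide_eq_left times_divide_eq_right)
    also have "\<dots> = u * t powr (- x) + x * s * t" unfolding p(2) using s by simp
    finally have "(1 + x) * s * (u / s) powr p \<le> u * t powr (- x) + x * s * t" .
    moreover have "s powr (1 - p) = s / s powr p" using s by (simp add: powr_diff)
    ultimately show ?thesis using u s that by (simp add: rpow_def powr_divide algebra_simps)
  qed
  have "Re (trace (fun_calc (\<lambda>y. complex_of_real (- y)) P ** fun_calc (\<lambda>y. complex_of_real (rpow (- x) y)) \<tau>))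
     \<le> Re (trace (fun_calc (\<lambda>y. complex_of_real (- ((1 + x) * s powr (1 - p) * rpow p y))) P))
      + Re (trace (fun_calc (\<lambda>y. complex_of_real (x * s * y)) \<tau>))"
    by (rule trace_fun_calc_mult_le) (use Y P \<tau> in auto)
  also have "Re (trace (fun_calc (\<lambda>y. complex_of_real (- ((1 + x) * s powr (1 - p) * rpow p y))) P))
    = - ((1 + x) * s powr (1 - p) * Re (trace (mpow P p)))"
    using P by (rule psdE) (simp add: mpow_fun_calc trace_unitary_conj trace_diagm sum_distrib_left mult.assoc sum_negf)
  also have "Re (trace (mpow P p)) = s powr p" using P p by (simp add: s_def schatten_powr)
  also have "Re (trace (fun_calc (\<lambda>y. complex_of_real (x * s * y)) \<tau>)) = x * s * Re (trace \<tau>)"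
    using pd_psd[OF \<tau>(1)] by (rule psdE) (simp add: trace_unitary_conj trace_diagm sum_distrib_left)
  also have "(1 + x) * s powr (1 - p) * s powr p = (1 + x) * s"
    using s by (simp add: mult.assoc powr_add[symmetric])
  also have "x * s * Re (trace \<tau>) \<le> x * s * 1" using x s \<tau>(2) by (intro mult_left_mono) auto
  also have "fun_calc (\<lambda>y. complex_of_real (- y)) P = - P"
  proof (rule psdE[OF P])
    fix U d assume U: "unitary U" "P = U ** diagm (\<lambda>i. complex_of_real (d i)) ** adj U" 
      "\<And>f. fun_calc f P = U ** diagm (\<lambda>i. f (d i)) ** adj U"
    have e: "diagm (\<lambda>i. complex_of_real (- d i)) = (- 1) *\<^sub>R diagm (\<lambda>i. complex_of_real (d i))"
      by (simp add: vec_eq_iff diagm_nth)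
    show ?thesis unfolding U(3) e scaleR_mult_left scaleR_mult_right by (simp add: U(2))
  qed
  also have "(- P) ** fun_calc (\<lambda>y. complex_of_real (rpow (- x) y)) \<tau> = - (P ** mpow \<tau> (- x))"
    using scaleR_mult_left[of "-1" P] by (simp add: mpow_fun_calc)
  also have "Re (trace (- (P ** mpow \<tau> (- x)))) = - Re (trace (P ** mpow \<tau> (- x)))"
    using trace_scaleR[of "-1" "P ** mpow \<tau> (- x)"] by simp
  finally show ?thesis by (simp add: s_def p_def algebra_simps)
qed

text \<open>The optimal \<open>\<tau>\<close>, proportional to \<open>mpow P p\<close> with
  \<open>p = 1 / (1 + x)\<close>, is singular whenever \<open>P\<close> is. Shifting the eigenvalues
  of \<open>P\<close> by a small \<open>\<delta>\<close> restores full rank, and the value tends to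
  the quasi-norm as \<open>\<delta>\<close> tends to 0.\<close>

lemma reverse_holder_approx:
  fixes P :: "complex^'n^'n"
  assumes P: "psd P" and x: "0 < x" and e: "e > 0"
  obtains \<tau> where "pd \<tau>" "trace \<tau> = 1" "Re (trace (P ** mpow \<tau> (- x))) \<le> schatten (1 / (1 + x)) P + e"
proof (rule psdE[OF P])
  fix U d assume U: "unitary U" "P = U ** diagm (\<lambda>i. complex_of_real (d i)) ** adj U" 
      "\<And>f. fun_calc f P = U ** diagm (\<lambda>i. f (d i)) ** adj U" "\<And>i. d i \<ge> 0"
  define p where "p = 1 / (1 + x)"
  have p: "p > 0" "p * (1 + x) = 1" using x by (auto simp: p_def)
  have p': "1 - p * x = p" "1 / p = 1 + x" using p(2) by (simp add: algebra_simps) (simp add: p_def)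
  define T where "T \<delta> = (\<Sum>i\<in>UNIV. (d i + \<delta>) powr p)" for \<delta>
  have "((\<lambda>\<delta>. T \<delta> powr (1 + x)) \<longlongrightarrow> (\<Sum>i\<in>UNIV. (d i + 0) powr p) powr (1 + x)) (at_right 0)"
    unfolding T_def using U(4) p x
    by (intro tendsto_powr' tendsto_sum tendsto_intros)
       (auto intro!: sum_nonneg eventually_mono[OF eventually_at_right_less[of 0]] add_nonneg_nonneg)
  moreover have "(\<Sum>i\<in>UNIV. (d i + 0) powr p) powr (1 + x) = schatten p P"
    using U(1,4) p' by (simp add: schatten_def mpow_fun_calc U(3) trace_unitary_conj trace_diagm rpow_eq')
  ultimately have "eventually (\<lambda>\<delta>. T \<delta> powr (1 + x) < schatten p P + e) (at_right 0)"
    using e by (intro order_tendstoD(2)) auto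
  then obtain \<delta> where \<delta>: "\<delta> > 0" "T \<delta> powr (1 + x) < schatten p P + e"
    using eventually_happens[OF eventually_conj[OF _ eventually_at_right_less[of "0::real"]]] by force
  define t where "t = T \<delta>"
  have dp: "d i + \<delta> > 0" for i using U(4)[of i] \<delta>(1) by simp
  then have pp: "(d i + \<delta>) powr p > 0" for i using powr_gt_zero[of "d i + \<delta>" p] by (metis less_irrefl)
  then have t: "t > 0" unfolding t_def T_def by (intro sum_pos) auto
  define \<tau> where "\<tau> = U ** diagm (\<lambda>i. complex_of_real ((d i + \<delta>) powr p / t)) ** adj U"
  have 1: "pd \<tau>" unfolding \<tau>_def by (rule pd_unitary_diag[OF U(1) divide_pos_pos[OF pp t]])
  have 2: "trace \<tau> = 1"
    using U(1) t unfolding \<tau>_def trace_unitary_conj[OF U(1)] trace_diagm of_real_sum[symmetric] sum_divide_distrib[symmetric]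
    by (simp add: t_def T_def)
  have "Re (trace (P ** mpow \<tau> (- x))) = (\<Sum>i\<in>UNIV. d i * ((d i + \<delta>) powr p / t) powr (- x))"
  proof -
    have "mpow \<tau> (- x) = U ** diagm (\<lambda>i. complex_of_real (rpow (- x) ((d i + \<delta>) powr p / t))) ** adj U"
      unfolding mpow_fun_calc \<tau>_def by (rule fun_calc_diag[OF U(1)])
    then have "P ** mpow \<tau> (- x) = U ** (diagm (\<lambda>i. complex_of_real (d i)) ** diagm (\<lambda>i. complex_of_real (rpow (- x) ((d i + \<delta>) powr p / t)))) ** adj U"
      using U(1) by (simp add: U(2) mult_right_assoc)
    then show ?thesis using U(1) pp t by (simp add: trace_unitary_conj diagm_mult trace_diagm rpow_eq)
  qed
  also have "\<dots> \<le> (\<Sum>i\<in>UNIV. t powr x * (d i + \<delta>) powr p)"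
  proof (rule sum_mono)
    fix i
    have "((d i + \<delta>) powr p / t) powr (- x) = t powr x * (d i + \<delta>) powr (- (p * x))"
      using pp[of i] t dp[of i] by (simp add: powr_divide powr_powr powr_minus field_simps)
    moreover have "d i * (d i + \<delta>) powr (- (p * x)) \<le> (d i + \<delta>) powr 1 * (d i + \<delta>) powr (- (p * x))"
      using dp[of i] \<delta>(1) by (intro mult_right_mono) auto
    moreover have "(d i + \<delta>) powr 1 * (d i + \<delta>) powr (- (p * x)) = (d i + \<delta>) powr p"
      by (subst powr_add[symmetric]) (simp add: p')
    ultimately show "d i * ((d i + \<delta>) powr p / t) powr (- x) \<le> t powr x * (d i + \<delta>) powr p"
      using t by (simp add: mult.left_commute mult_left_mono)
  qed
  also have "\<dots> = t powr x * t" by (simp add: sum_distrib_left t_def T_def)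
  also have "\<dots> = t powr (1 + x)" using t by (simp add: powr_add)
  finally have 3: "Re (trace (P ** mpow \<tau> (- x))) \<le> schatten p P + e" using \<delta>(2) by (simp add: t_def)
  show ?thesis using that 1 2 3 unfolding p_def by blast
qed

text \<open>Monotonicity follows from the variational formula, whose trace expression is linear in
  \<open>P\<close>.\<close>

lemma schatten_mono: assumes "psd P" "psd (P' - P)" "0 < x"
  shows "schatten (1 / (1 + x)) P \<le> schatten (1 / (1 + x)) P'"
proof (rule field_le_epsilon)
  fix e :: real assume e: "e > 0"
  have "psd P'" using psd_add[OF assms(2,1)] by simp
  obtain \<tau> where t: "pd \<tau>" "trace \<tau> = 1" "Re (trace (P' ** mpow \<tau> (- x))) \<le> schatten (1 / (1 + x)) P' + e"
    by (rule reverse_holder_approx[OF \<open>psd P'\<close> assms(3) e])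
  have "schatten (1 / (1 + x)) P \<le> Re (trace (P ** mpow \<tau> (- x)))"
    using t assms by (intro reverse_holder_trace) auto
  also have "\<dots> \<le> Re (trace (P' ** mpow \<tau> (- x)))" using t by (intro trace_mult_mono assms) auto
  finally show "schatten (1 / (1 + x)) P \<le> schatten (1 / (1 + x)) P' + e" using t(3) by simp
qed

subsection \<open>Tensor products with the identity\<close>

abbreviation emb :: "complex^'y^'y \<Rightarrow> complex^('x::finite \<times> 'y::finite)^('x \<times> 'y)" where
  "emb M \<equiv> kron (mat 1) M"

lemma sum_prod_UNIV: "(\<Sum>k\<in>(UNIV :: ('x::finite \<times> 'y::finite) set). f k) = (\<Sum>i\<in>UNIV. \<Sum>j\<in>UNIV. f (i, j))"
  by (simp add: sum.cartesian_product UNIV_Times_UNIV)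

lemma kron_mult: "kron A B ** kron C D = kron (A ** C) (B ** D)"
  by (simp add: vec_eq_iff matrix_nth_mult kron_def sum_prod_UNIV sum_product mult_ac)

lemma kron_mat_1 [simp]: "kron (mat 1) (mat 1) = mat 1"
  by (auto simp: vec_eq_iff kron_def mat_def prod_eq_iff)

lemma emb_mult: "emb A ** emb B = emb (A ** B)" by (simp add: kron_mult)

lemma emb_mult_left: "emb A ** (emb B ** X) = emb (A ** B) ** X" by (simp add: matrix_mul_assoc emb_mult)

lemma adj_emb: "adj (emb A) = emb (adj A)"
  by (auto simp: vec_eq_iff kron_def mat_def)

lemma emb_diff: "emb A - emb B = emb (A - B)"
  by (simp add: vec_eq_iff kron_def algebra_simps)

lemma emb_scaleR: "emb (c *\<^sub>R A) = c *\<^sub>R emb A"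
  by (simp add: vec_eq_iff kron_def)

lemma unitary_emb: "unitary U \<Longrightarrow> unitary (emb U)"
  by (subst unitary_def) (simp add: adj_emb emb_mult)

lemma emb_diagm: "emb (diagm d) = diagm (\<lambda>p. d (snd p))"
  by (auto simp: vec_eq_iff kron_def mat_def diagm_nth prod_eq_iff)

lemma fun_calc_emb: assumes "herm A" shows "fun_calc f (emb A) = emb (fun_calc f A)"
proof (rule hermE[OF assms])
  fix U d assume U: "unitary U" "A = U ** diagm (\<lambda>i. complex_of_real (d i)) ** adj U"
    "\<And>f. fun_calc f A = U ** diagm (\<lambda>i. f (d i)) ** adj U"
  have e: "emb (U ** diagm (\<lambda>i. g (d i)) ** adj U) = emb U ** diagm (\<lambda>p. g (d (snd p))) ** adj (emb U)" for g
    unfolding emb_mult[symmetric] adj_emb by (simp add: emb_diagm)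
  have "fun_calc f (emb A) = emb U ** diagm (\<lambda>p. f (d (snd p))) ** adj (emb U)"
    unfolding U(2) e[of complex_of_real] by (rule fun_calc_diag[OF unitary_emb[OF U(1)]])
  then show ?thesis unfolding U(3) e .
qed

lemma herm_emb [simp]: "herm A \<Longrightarrow> herm (emb A)"
  by (simp add: herm_def adj_emb)

lemma mpow_emb: "herm A \<Longrightarrow> mpow (emb A) p = emb (mpow A p)"
  by (simp add: mpow_fun_calc fun_calc_emb)

lemma cpow_emb: "herm A \<Longrightarrow> cpow (emb A) z = emb (cpow A z)"
  by (simp add: cpow_def fun_calc_emb)

lemma psd_emb [simp]: assumes "psd A" shows "psd (emb A :: complex^('x::finite \<times> 'y::finite)^('x \<times> 'y))"
proof -
  obtain K where "A = adj K ** K" "herm K" by (rule psd_square_root[OF assms])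
  then have "emb A = adj (emb K :: complex^('x::finite \<times> 'y::finite)^('x \<times> 'y)) ** emb K"
    by (simp add: adj_emb emb_mult)
  then show ?thesis by simp
qed

lemma pd_emb [simp]: assumes "pd A" shows "pd (emb A :: complex^('x::finite \<times> 'y::finite)^('x \<times> 'y))"
proof -
  obtain e where e: "e > 0" "psd (A - e *\<^sub>R mat 1)" using assms by (auto simp: pd_def)
  have "(emb A :: complex^('x::finite \<times> 'y::finite)^('x \<times> 'y)) - e *\<^sub>R mat 1 = emb (A - e *\<^sub>R mat 1)"
    by (simp only: emb_diff[symmetric] emb_scaleR kron_mat_1)
  then show ?thesis unfolding pd_def using e psd_emb by metis
qed

lemma trace_mult_emb: "trace (R ** emb W) = trace (ptrace1 R ** W)"
proof -
  have d: "(\<Sum>a'\<in>UNIV. \<Sum>j\<in>UNIV. f a' j * (mat 1 $ a' $ a * g j)) = (\<Sum>j\<in>UNIV. f a j * g j)"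
    for f :: "'a::finite \<Rightarrow> 'b::finite \<Rightarrow> complex" and g a
  proof -
    have "(\<Sum>j\<in>UNIV. f a' j * (mat 1 $ a' $ a * g j)) = (if a' = a then (\<Sum>j\<in>UNIV. f a j * g j) else 0)" for a'
      by (simp add: mat_def)
    then show ?thesis by simp
  qed
  have "trace (R ** emb W) = (\<Sum>a\<in>UNIV. \<Sum>i\<in>UNIV. \<Sum>j\<in>UNIV. R $ (a, i) $ (a, j) * W $ j $ i)"
    by (simp add: trace_def matrix_nth_mult sum_prod_UNIV kron_def d)
  also have "\<dots> = (\<Sum>i\<in>UNIV. \<Sum>a\<in>UNIV. \<Sum>j\<in>UNIV. R $ (a, i) $ (a, j) * W $ j $ i)" by (rule sum.swap)
  also have "\<dots> = trace (ptrace1 R ** W)"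
    unfolding trace_def matrix_nth_mult ptrace1_def
    by (intro sum.cong refl, subst sum.swap) (simp add: sum_distrib_right)
  finally show ?thesis .
qed

lemma trace_ptrace1: "trace (ptrace1 R) = trace R"
  using trace_mult_emb[of R "mat 1"] by simp

lemma psd_ptrace1: fixes R :: "complex^('x::finite \<times> 'y::finite)^('x \<times> 'y)" assumes "psd R" shows "psd (ptrace1 R)"
proof -
  \<comment> \<open>\<open>K a\<close> cuts out the block with first index \<open>a\<close>, so that
    the partial trace becomes a sum of congruences.\<close>
  define K :: "'x \<Rightarrow> complex^('x \<times> 'y)^'y" where "K a = (\<chi> i q. if q = (a, i) then 1 else 0)" for a
  have n: "(K a ** R ** adj (K a)) $ i $ j = R $ (a, i) $ (a, j)" for a i j
    by (simp add: matrix_nth_mult K_def if_distrib[where f = "\<lambda>x. x * _"] if_distrib[where f = "\<lambda>x. _ * x"]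
        if_distrib[where f = cnj] cong: if_cong)
  then have "ptrace1 R = (\<Sum>a\<in>UNIV. K a ** R ** adj (K a))"
    by (simp add: vec_eq_iff ptrace1_def n)
  then show ?thesis using assms by (simp add: psd_sum psd_conj)
qed

lemma ptrace1_diff: "ptrace1 (A - B) = ptrace1 A - ptrace1 B"
  by (simp add: vec_eq_iff ptrace1_def sum_subtractf)

lemma ptrace1_scaleR: "ptrace1 (c *\<^sub>R A) = c *\<^sub>R ptrace1 A"
  by (simp add: vec_eq_iff ptrace1_def scaleR_sum_right)

lemma ptrace1_add: "ptrace1 (A + B) = ptrace1 A + ptrace1 B"
  by (simp add: vec_eq_iff ptrace1_def sum.distrib)

lemma ptrace1_mat_1: "ptrace1 (mat 1 :: complex^('x::finite \<times> 'y::finite)^('x \<times> 'y)) = real CARD('x) *\<^sub>R mat 1"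
  by (simp add: vec_eq_iff ptrace1_def mat_def scaleR_conv_of_real[where 'a=complex])

lemma pd_ptrace1: fixes R :: "complex^('x::finite \<times> 'y::finite)^('x \<times> 'y)" assumes "pd R" shows "pd (ptrace1 R)"
proof -
  obtain e where e: "e > 0" "psd (R - e *\<^sub>R mat 1)" using assms by (auto simp: pd_def)
  have "ptrace1 R - (e * real CARD('x)) *\<^sub>R mat 1 = ptrace1 (R - e *\<^sub>R mat 1)"
    by (simp add: ptrace1_diff ptrace1_scaleR ptrace1_mat_1)
  then have "psd (ptrace1 R - (e * real CARD('x)) *\<^sub>R mat 1)" using psd_ptrace1[OF e(2)] by simp
  then show ?thesis unfolding pd_def using e(1) by (intro exI[of _ "e * real CARD('x)"]) simp
qed

subsection \<open>Interpolation estimates\<close>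

text \<open>An affine exponent with real coefficients: \<open>u\<close> at 0 and
  \<open>u + v\<close> at 1. All interpolating families are products of such factors and
  constants.\<close>

definition cpow_line :: "complex^'n^'n \<Rightarrow> real \<Rightarrow> real \<Rightarrow> complex \<Rightarrow> complex^'n^'n" where
  "cpow_line M u v z = cpow M (of_real u + of_real v * z)"

lemma strip_ok_cpow_line [simp]: "herm M \<Longrightarrow> strip_ok (\<lambda>z. cpow_line M u v z)"
  using strip_ok_cpow[of M u v] by (simp add: cpow_line_def[abs_def])

lemma cpow_line_emb: "herm M \<Longrightarrow> cpow_line (emb M) u v z = emb (cpow_line M u v z)"
  by (simp add: cpow_line_def cpow_emb)

definition imag_pow :: "complex^'n^'n \<Rightarrow> real \<Rightarrow> complex^'n^'n" where
  "imag_pow M t = cpow M (\<i> * of_real t)"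

lemma norm_imag_pow_mult: "herm M \<Longrightarrow> norm (imag_pow M t ** X) \<le> norm X"
  unfolding imag_pow_def by (rule norm_cpow_imag_mult)

lemma norm_mult_imag_pow: "herm M \<Longrightarrow> norm (X ** imag_pow M t) \<le> norm X"
  unfolding imag_pow_def by (rule norm_mult_cpow_imag)

lemma unitary_imag_pow: "pd M \<Longrightarrow> unitary (imag_pow M t)"
  unfolding imag_pow_def by (rule unitary_cpow_imag)

lemma imag_pow_emb: "herm M \<Longrightarrow> imag_pow (emb M) t = emb (imag_pow M t)"
  by (simp add: imag_pow_def cpow_emb)

lemma cpow_line_0_left: "herm M \<Longrightarrow> cpow_line M u v (\<i> * of_real t) = imag_pow M (v * t) ** mpow M u"
  unfolding mpow_cpow cpow_line_def imag_pow_def by (subst cpow_add) (auto simp: algebra_simps intro!: arg_cong[where f = "cpow M"])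

lemma cpow_line_0_right: "herm M \<Longrightarrow> cpow_line M u v (\<i> * of_real t) = mpow M u ** imag_pow M (v * t)"
  unfolding mpow_cpow cpow_line_def imag_pow_def by (subst cpow_add) (auto simp: algebra_simps intro!: arg_cong[where f = "cpow M"])

lemma cpow_line_0_imag: "cpow_line M 0 v (\<i> * of_real t) = imag_pow M (v * t)"
  unfolding cpow_line_def imag_pow_def by (auto simp: algebra_simps intro!: arg_cong[where f = "cpow M"])

lemma cpow_line_1_left: "herm M \<Longrightarrow> u + v = w \<Longrightarrow> cpow_line M u v (1 + \<i> * of_real t) = imag_pow M (v * t) ** mpow M w"
  unfolding mpow_cpow cpow_line_def imag_pow_def by (subst cpow_add) (auto simp: algebra_simps intro!: arg_cong[where f = "cpow M"])

lemma cpow_line_1_right: "herm M \<Longrightarrow> u + v = w \<Longrightarrow> cpow_line M u v (1 + \<i> * of_real t) = mpow M w ** imag_pow M (v * t)"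
  unfolding mpow_cpow cpow_line_def imag_pow_def by (subst cpow_add) (auto simp: algebra_simps intro!: arg_cong[where f = "cpow M"])

lemma cpow_line_1_imag: "u + v = 0 \<Longrightarrow> cpow_line M u v (1 + \<i> * of_real t) = imag_pow M (v * t)"
proof -
  assume "u + v = 0"
  then have "complex_of_real u + complex_of_real v = 0" by (metis of_real_0 of_real_add)
  then show ?thesis unfolding cpow_line_def imag_pow_def by (auto simp: algebra_simps intro!: arg_cong[where f = "cpow M"])
qed

lemma cpow_line_real: "u + v * \<theta> = w \<Longrightarrow> cpow_line M u v (of_real \<theta>) = mpow M w"
  unfolding mpow_cpow cpow_line_def by (metis of_real_add of_real_mult)

lemma norm_mpow_mult_sq: "herm A \<Longrightarrow> (norm (mpow A (p / 2) ** X))\<^sup>2 = Re (trace (mpow A p ** (X ** adj X)))"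
proof -
  assume A: "herm A"
  have "(norm (mpow A (p / 2) ** X))\<^sup>2 = Re (trace ((adj X ** mpow A p) ** X))"
    using A by (simp add: norm_sq_trace' adj_mult mult_right_assoc mpow_add_left)
  then show ?thesis using trace_mul_sym[of "adj X ** mpow A p" X] trace_mul_sym[of "X ** adj X" "mpow A p"] by (simp add: mult_right_assoc)
qed

lemma norm_mult_mpow_sq: "herm A \<Longrightarrow> (norm (X ** mpow A (p / 2)))\<^sup>2 = Re (trace ((adj X ** X) ** mpow A p))"
proof -
  assume A: "herm A"
  have "norm (X ** mpow A (p / 2)) = norm (mpow A (p / 2) ** adj X)"
    using norm_adj[of "X ** mpow A (p / 2)"] A by (simp add: adj_mult)
  then show ?thesis using norm_mpow_mult_sq[OF A, of p "adj X"] trace_mul_sym[of "adj X ** X" "mpow A p"] by simp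
qed

lemma norm_mpow_half_sq: "psd A \<Longrightarrow> (norm (mpow A (1 / 2)))\<^sup>2 = Re (trace A)"
  using norm_mpow_mult_sq[of A 1 "mat 1"] by (simp add: mpow_1)

text \<open>This is where the marginal of \<open>T\<close> enters: \<open>T\<close> is tested only
  against a matrix acting on the second system, hence only through \<open>ptrace1 T\<close>, which
  \<open>\<kappa> *\<^sub>R \<omega>\<close> dominates.\<close>

lemma norm_half_emb_le:
  assumes "psd T" "psd \<omega>" "psd (\<kappa> *\<^sub>R \<omega> - ptrace1 T)"
  shows "(norm (mpow T (1 / 2) ** emb W))\<^sup>2 \<le> \<kappa> * (norm (mpow \<omega> (1 / 2) ** W))\<^sup>2"
proof -
  have "(norm (mpow T (1 / 2) ** emb W))\<^sup>2 = Re (trace (T ** emb (W ** adj W)))"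
    using norm_mpow_mult_sq[of T 1 "emb W"] assms(1) by (simp add: mpow_1 adj_emb emb_mult)
  also have "\<dots> = Re (trace (ptrace1 T ** (W ** adj W)))" by (simp add: trace_mult_emb)
  also have "\<dots> \<le> Re (trace ((\<kappa> *\<^sub>R \<omega>) ** (W ** adj W)))" by (intro trace_mult_mono assms(3)) simp
  also have "\<dots> = \<kappa> * (norm (mpow \<omega> (1 / 2) ** W))\<^sup>2"
    using norm_mpow_mult_sq[of \<omega> 1 W] assms(2) by (simp add: mpow_1 scaleR_mult_left trace_scaleR)
  finally show ?thesis .
qed

text \<open>An operator acting trivially on the first system sees \<open>R\<close> only through the
  marginal, so \<open>R\<close> may be replaced by any square root \<open>R'\<close> of that
  marginal, even with another auxiliary dimension.\<close>

lemma norm_emb_reduce: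
  assumes "R' ** adj R' = ptrace1 (R ** adj R)"
  shows "norm (emb W ** R) = norm (W ** R')"
proof (rule power2_eq_imp_eq)
  have "(norm (emb W ** R))\<^sup>2 = Re (trace (emb W ** R ** adj R ** emb (adj W)))"
    by (simp add: norm_sq_trace adj_mult adj_emb mult_right_assoc)
  also have "\<dots> = Re (trace (R ** adj R ** emb (adj W ** W)))"
    using trace_mul_sym[of "emb W" "R ** adj R ** emb (adj W)"] by (simp add: mult_right_assoc emb_mult)
  also have "\<dots> = Re (trace (R' ** adj R' ** (adj W ** W)))" by (simp add: trace_mult_emb assms)
  also have "\<dots> = (norm (W ** R'))\<^sup>2"
    using trace_mul_sym[of "R' ** adj R' ** adj W" W] by (simp add: norm_sq_trace adj_mult mult_right_assoc)
  finally show "(norm (emb W ** R))\<^sup>2 = (norm (W ** R'))\<^sup>2" .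
qed simp_all

text \<open>Writing \<open>Q ** adj Q\<close> as its Schatten value \<open>s\<close> times
  \<open>mpow \<tau> (1 - x)\<close> leaves a Frobenius norm to be bounded by
  \<open>\<kappa> powr x\<close>. The family \<open>F\<close> moves from
  \<open>mpow \<tau> (1 / 2)\<close> at 0 to a product at 1 in which \<open>T\<close> meets
  \<open>\<omega>\<close> through its marginal and only \<open>mpow \<sigma> (1 / 2)\<close>
  remains. The bound does not depend on \<open>U\<close>.\<close>

lemma interpolation_upper:
  fixes T :: "complex^('x::finite \<times> 'y::finite)^('x \<times> 'y)" and R :: "complex^'d^('x \<times> 'y)"
  assumes T: "pd T" and \<omega>: "pd \<omega>" and \<kappa>: "\<kappa> > 0" "psd (\<kappa> *\<^sub>R \<omega> - ptrace1 T)" and U: "unitary U"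
    and \<sigma>: "pd \<sigma>" "Re (trace \<sigma>) \<le> 1" and x: "0 < x" "x < 1"
  shows "(norm (mpow T (x / 2) ** (emb (mpow \<omega> (- x / 2) ** U) ** R)))\<^sup>2
    \<le> \<kappa> powr x * schatten (1 / (1 - x)) (adj R ** emb (mpow \<sigma> (- x)) ** R)"
proof -
  define Q where "Q = emb (mpow \<sigma> (- x / 2)) ** R"
  define P where "P = Q ** adj Q"
  define s where "s = schatten (1 / (1 - x)) P"
  define Z where "Z = mpow T (x / 2) ** emb (mpow \<omega> (- x / 2) ** U ** mpow \<sigma> (x / 2))"
  have "adj Q ** Q = adj R ** emb (mpow \<sigma> (- x)) ** R"
    using \<sigma>(1) by (simp add: Q_def adj_mult adj_emb mult_right_assoc emb_mult_left mpow_add)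
  then have s: "schatten (1 / (1 - x)) (adj R ** emb (mpow \<sigma> (- x)) ** R) = s"
    unfolding s_def P_def by (metis schatten_gram)
  have ZQ: "Z ** Q = mpow T (x / 2) ** (emb (mpow \<omega> (- x / 2) ** U) ** R)"
    using \<sigma>(1) by (simp add: Z_def Q_def mult_right_assoc emb_mult_left mpow_add mpow_0)
  show ?thesis
  proof (cases "P = 0")
    case True
    then have "(norm Q)\<^sup>2 = 0" by (simp add: norm_sq_trace P_def trace_def)
    then have Q0: "Q = 0" by simp
    have "Z ** Q = 0" unfolding Q0 by (simp add: vec_eq_iff matrix_nth_mult)
    then show ?thesis unfolding ZQ[symmetric] s by (simp add: s_def)
  next
    case False
    have "psd P" by (simp add: P_def)
    obtain \<tau> where \<tau>: "psd \<tau>" "trace \<tau> = 1" "P = s *\<^sub>R mpow \<tau> (1 - x)"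
      unfolding s_def by (rule schatten_attained[OF \<open>psd P\<close> False x])
    have "(norm (Z ** Q))\<^sup>2 = Re (trace (Z ** (P ** adj Z)))"
      by (simp add: norm_sq_trace P_def adj_mult mult_right_assoc)
    also have "\<dots> = s * Re (trace (Z ** mpow \<tau> (1 - x) ** adj Z))"
      unfolding \<tau>(3) by (simp add: scaleR_mult_left scaleR_mult_right trace_scaleR mult_right_assoc)
    also have "Re (trace (Z ** mpow \<tau> (1 - x) ** adj Z)) = (norm (Z ** mpow \<tau> ((1 - x) / 2)))\<^sup>2"
      using \<tau>(1) by (simp add: norm_sq_trace adj_mult mult_right_assoc mpow_add_left)
    finally have n: "(norm (Z ** Q))\<^sup>2 = s * (norm (Z ** mpow \<tau> ((1 - x) / 2)))\<^sup>2" .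
    define F where "F z = cpow_line T 0 (1 / 2) z ** (cpow_line (emb \<omega>) 0 (- 1 / 2) z ** (emb U ** (cpow_line (emb \<sigma>) 0 (1 / 2) z ** cpow_line \<tau> (1 / 2) (- 1 / 2) z)))" for z
    have "(norm (F (of_real x)))\<^sup>2 \<le> 1 powr (1 - x) * \<kappa> powr x"
    proof (rule three_lines[OF _ _ _ _ \<kappa>(1) x])
      show "strip_ok F" unfolding F_def using T \<omega> \<sigma> \<tau> by (intro strip_ok_mult strip_ok_const strip_ok_cpow_line) auto
      show "(norm (F (\<i> * of_real t)))\<^sup>2 \<le> 1" for t
      proof -
        have "norm (F (\<i> * of_real t)) \<le> norm (mpow \<tau> (1 / 2))"
          unfolding F_def cpow_line_0_imag cpow_line_0_left[OF psd_herm[OF \<tau>(1)]]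
          using T \<omega> \<sigma> \<tau> U by (intro order_trans[OF norm_imag_pow_mult] order_trans[OF eq_refl[OF norm_unitary_mult[OF unitary_emb]]]) auto
        then have "(norm (F (\<i> * of_real t)))\<^sup>2 \<le> (norm (mpow \<tau> (1 / 2)))\<^sup>2" by (intro power_mono) auto
        also have "\<dots> = 1" using \<tau> by (simp add: norm_mpow_half_sq)
        finally show ?thesis .
      qed
      show "(norm (F (1 + \<i> * of_real t)))\<^sup>2 \<le> \<kappa>" for t
      proof -
        \<comment> \<open>Everything to the right of \<open>mpow T (1 / 2)\<close>, except an
          imaginary power of \<open>\<tau>\<close>, acts on the second system alone. So
          \<open>norm_half_emb_le\<close> applies, and once \<open>\<omega>\<close> has cancelled
          the unitaries inside \<open>W\<close> are on outer sides.\<close>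
        define W where "W = mpow \<omega> (- 1 / 2) ** (imag_pow \<omega> (- 1 / 2 * t) ** (U ** (mpow \<sigma> (1 / 2) ** imag_pow \<sigma> (1 / 2 * t))))"
        have "F (1 + \<i> * of_real t) = imag_pow T (1 / 2 * t) ** ((mpow T (1 / 2) ** emb W) ** imag_pow \<tau> (- 1 / 2 * t))"
          unfolding F_def using T \<omega> \<sigma>
          by (simp add: cpow_line_1_imag cpow_line_1_left[where M = T and w = "1/2"] cpow_line_emb imag_pow_emb mpow_emb cpow_line_1_right[where w = "- 1/2"] cpow_line_1_right[where w = "1/2" and M = \<sigma>]
              emb_mult_left emb_mult W_def mult_right_assoc)
        then have "norm (F (1 + \<i> * of_real t)) \<le> norm (mpow T (1 / 2) ** emb W)"
          using T \<tau> by (auto intro!: order_trans[OF norm_imag_pow_mult] norm_mult_imag_pow)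
        then have "(norm (F (1 + \<i> * of_real t)))\<^sup>2 \<le> (norm (mpow T (1 / 2) ** emb W))\<^sup>2" by (intro power_mono) auto
        also have "\<dots> \<le> \<kappa> * (norm (mpow \<omega> (1 / 2) ** W))\<^sup>2"
          using T \<omega> \<kappa> by (intro norm_half_emb_le) auto
        also have "mpow \<omega> (1 / 2) ** W = imag_pow \<omega> (- 1 / 2 * t) ** (U ** (mpow \<sigma> (1 / 2) ** imag_pow \<sigma> (1 / 2 * t)))"
          using \<omega> by (simp add: W_def mpow_add_left mpow_0)
        also have "norm \<dots> = norm (mpow \<sigma> (1 / 2))"
          using \<omega> U \<sigma> by (simp only: norm_unitary_mult norm_mult_unitary unitary_imag_pow)
        also have "(norm (mpow \<sigma> (1 / 2)))\<^sup>2 \<le> 1" using \<sigma> by (simp add: norm_mpow_half_sq)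
        finally show ?thesis using \<kappa> by simp
      qed
    qed simp
    also have "F (of_real x) = Z ** mpow \<tau> ((1 - x) / 2)"
      unfolding F_def Z_def using \<omega> \<sigma>
      by (simp add: cpow_line_real[where w = "x/2"] cpow_line_real[where w = "- x/2"] cpow_line_real[where w = "(1-x)/2"] field_simps cpow_line_emb mpow_emb emb_mult_left mult_right_assoc)
    finally have "(norm (Z ** mpow \<tau> ((1 - x) / 2)))\<^sup>2 \<le> \<kappa> powr x" by simp
    then have "s * (norm (Z ** mpow \<tau> ((1 - x) / 2)))\<^sup>2 \<le> s * \<kappa> powr x"
      by (rule mult_left_mono) (simp add: s_def)
    then show ?thesis unfolding ZQ[symmetric] s n by (simp add: mult.commute)
  qed
qed

section \<open>Sandwiches of positive definite matrices and the geometric mean\<close>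

lemma pd_mono: "pd B \<Longrightarrow> psd (A - B) \<Longrightarrow> pd A"
  using pd_add[of B "A - B"] by simp

lemma pd_conj_mpow: assumes "pd A" "pd G" shows "pd (mpow G r ** A ** mpow G r)"
proof -
  obtain e where e: "e > 0" "psd (A - e *\<^sub>R mat 1)" using assms by (auto simp: pd_def)
  have "psd (mpow G r ** A ** adj (mpow G r) - mpow G r ** (e *\<^sub>R mat 1) ** adj (mpow G r))"
    by (rule psd_conj_mono[OF e(2)])
  then have "psd (mpow G r ** A ** mpow G r - e *\<^sub>R mpow G (r + r))"
    using assms(2) by (simp add: scaleR_mult_left scaleR_mult_right mpow_add)
  moreover have "pd (e *\<^sub>R mpow G (r + r))" using assms e by (intro pd_scaleR) auto
  ultimately show ?thesis by (rule pd_mono[rotated])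
qed

lemma mpow_inverse: assumes "pd Y" "Y ** Z = mat 1" shows "mpow Y (- 1) = Z"
proof -
  have "mpow Y (- 1) = mpow Y (- 1) ** (mpow Y 1 ** Z)" using assms by (simp add: mpow_1)
  also have "\<dots> = Z" using assms(1) by (simp add: mpow_add_left mpow_0)
  finally show ?thesis .
qed

text \<open>\<open>\<sigma>\<close> is a power of the weighted geometric mean of \<open>G\<close> and \<open>S\<close> (up to inverses).  The point is that
  \<open>cpow L z\<close> has imaginary powers on the outer side only, whereas a product of powers of \<open>G\<close> and of \<open>S\<close>
  would have them between the two factors.\<close>

lemma geometric_mean_density:
  fixes G S :: "complex^'n^'n"
  assumes G: "pd G" and S: "pd S" "Re (trace S) \<le> 1" and s: "0 < s" "s < 1" and \<theta>: "0 < \<theta>" "\<theta> < 1"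
  obtains \<sigma> L where "pd \<sigma>" "Re (trace \<sigma>) \<le> 1" "pd L" "mpow L (- 1) = mpow G (1 / 2) ** mpow S (- s) ** mpow G (1 / 2)"
    "mpow \<sigma> (- (s * \<theta>)) = mpow G (- \<theta> / 2) ** mpow L (- \<theta>) ** mpow G (- \<theta> / 2)"
proof -
  define L where "L = mpow G (- 1 / 2) ** mpow S s ** mpow G (- 1 / 2)"
  \<comment> \<open>If \<open>G\<close> and \<open>S\<close> commute, this is
    \<open>mpow S (s * \<theta>)\<close> and \<open>\<sigma>\<close> below is \<open>S\<close>
    itself; in general the trace bound is what survives.\<close>
  define Y where "Y = mpow G (\<theta> / 2) ** mpow L \<theta> ** mpow G (\<theta> / 2)"
  have L: "pd L" unfolding L_def using G S by (intro pd_conj_mpow) auto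
  have Y: "pd Y" unfolding Y_def using G L by (intro pd_conj_mpow) auto
  have Li: "mpow L (- 1) = mpow G (1 / 2) ** mpow S (- s) ** mpow G (1 / 2)"
    by (rule mpow_inverse[OF L]) (use G S in \<open>simp add: L_def mult_right_assoc mpow_add_left mpow_0 mpow_add\<close>)
  have Yi: "mpow Y (- 1) = mpow G (- \<theta> / 2) ** mpow L (- \<theta>) ** mpow G (- \<theta> / 2)"
    by (rule mpow_inverse[OF Y]) (use G L in \<open>simp add: Y_def mult_right_assoc mpow_add_left mpow_0 mpow_add\<close>)
  have s\<theta>: "0 < s * \<theta>" "s * \<theta> < 1"
    using s \<theta> mult_strict_mono[of s 1 \<theta> 1] by auto
  define \<sigma> where "\<sigma> = mpow Y (1 / (s * \<theta>))"
  have \<sigma>: "pd \<sigma>" using Y by (simp add: \<sigma>_def)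
  have \<sigma>i: "mpow \<sigma> (- (s * \<theta>)) = mpow Y (- 1)" using Y s\<theta> s \<theta> by (simp add: \<sigma>_def mpow_mpow)
  have "Re (trace \<sigma>) \<le> 1"
  proof (cases "Y = 0")
    case True
    then show ?thesis using trace_mpow_zero_iff[OF pd_psd[OF Y], of "1 / (s * \<theta>)"] by (simp add: \<sigma>_def)
  next
    case False
    define x where "x = 1 - s * \<theta>"
    have x: "0 < x" "x < 1" using s\<theta> by (auto simp: x_def)
    obtain \<tau> where \<tau>: "psd \<tau>" "trace \<tau> = 1" "Re (trace (Y ** mpow \<tau> x)) = schatten (1 / (1 - x)) Y"
      by (rule schatten_attained[OF pd_psd[OF Y] False x])
    \<comment> \<open>At \<open>\<theta>\<close> the squared norm is the trace of \<open>Y\<close>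
      against its optimal test matrix \<open>mpow \<tau> x\<close>. At 0 only \<open>\<tau>\<close>
      remains, and at 1 the factors \<open>L\<close> and \<open>G\<close> combine to
      \<open>mpow S s\<close>.\<close>
    define F where "F z = cpow_line L 0 (1 / 2) z ** (cpow_line G 0 (1 / 2) z ** cpow_line \<tau> (1 / 2) (- s / 2) z)" for z
    have "(norm (F (of_real \<theta>)))\<^sup>2 \<le> 1 powr (1 - \<theta>) * 1 powr \<theta>"
    proof (rule three_lines[OF _ _ _ _ _ \<theta>])
      show "strip_ok F" unfolding F_def using L G \<tau> by (intro strip_ok_mult strip_ok_const strip_ok_cpow_line) auto
      show "(norm (F (\<i> * of_real t)))\<^sup>2 \<le> 1" for t
      proof -
        have "norm (F (\<i> * of_real t)) \<le> norm (mpow \<tau> (1 / 2))"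
          unfolding F_def cpow_line_0_imag cpow_line_0_left[OF psd_herm[OF \<tau>(1)]]
          using L G \<tau> by (intro order_trans[OF norm_imag_pow_mult]) auto
        then have "(norm (F (\<i> * of_real t)))\<^sup>2 \<le> (norm (mpow \<tau> (1 / 2)))\<^sup>2" by (intro power_mono) auto
        also have "\<dots> = 1" using \<tau> by (simp add: norm_mpow_half_sq)
        finally show ?thesis .
      qed
      show "(norm (F (1 + \<i> * of_real t)))\<^sup>2 \<le> 1" for t
      proof -
        define V where "V = imag_pow G (1 / 2 * t)"
        have V: "unitary V" unfolding V_def by (rule unitary_imag_pow[OF G])
        define X where "X = mpow L (1 / 2) ** (mpow G (1 / 2) ** V)"
        have "F (1 + \<i> * of_real t) = imag_pow L (1 / 2 * t) ** ((X ** mpow \<tau> ((1 - s) / 2)) ** imag_pow \<tau> (- s / 2 * t))"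
          unfolding F_def using L G \<tau>
          by (simp add: cpow_line_1_left[where M = L and w = "1/2"] cpow_line_1_right[where M = G and w = "1/2"]
              cpow_line_1_right[where w = "(1-s)/2"] field_simps X_def V_def mult_right_assoc)
        then have "norm (F (1 + \<i> * of_real t)) \<le> norm (X ** mpow \<tau> ((1 - s) / 2))"
          using L \<tau> by (auto intro!: order_trans[OF norm_imag_pow_mult] norm_mult_imag_pow)
        then have "(norm (F (1 + \<i> * of_real t)))\<^sup>2 \<le> (norm (X ** mpow \<tau> ((1 - s) / 2)))\<^sup>2" by (intro power_mono) auto
        also have "\<dots> = Re (trace ((adj X ** X) ** mpow \<tau> (1 - s)))" using \<tau> by (intro norm_mult_mpow_sq) auto
        also have "adj X ** X = adj V ** mpow S s ** V"
          using L G S by (simp add: X_def adj_mult mult_right_assoc mpow_add_left mpow_add)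
             (simp add: mpow_1 L_def mult_right_assoc mpow_add_left mpow_0 mpow_add)
        \<comment> \<open>The inner unitary \<open>V\<close> is moved onto \<open>\<tau>\<close>,
          which gives another density matrix, and Hoelder's inequality holds for it just as
          well.\<close>
        also have "trace (adj V ** mpow S s ** V ** mpow \<tau> (1 - s)) = trace (mpow S s ** (V ** mpow \<tau> (1 - s) ** adj V))"
          using trace_mul_sym[of "adj V" "mpow S s ** V ** mpow \<tau> (1 - s)"] by (simp add: mult_right_assoc)
        also have "V ** mpow \<tau> (1 - s) ** adj V = mpow (V ** \<tau> ** adj V) (1 - s)"
          unfolding mpow_fun_calc using \<tau> V by (subst fun_calc_unitary_conj) auto
        also have "Re (trace (mpow S s ** mpow (V ** \<tau> ** adj V) (1 - s))) \<le> schatten (1 / (1 - (1 - s))) (mpow S s)"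
          using S s \<tau> V by (intro holder_trace) (auto simp: psd_conj trace_unitary_conj)
        also have "\<dots> = Re (trace S) powr s" using S s by (simp add: schatten_def mpow_mpow mpow_1)
        also have "\<dots> \<le> 1" using S s trace_psd_nonneg[OF pd_psd[OF S(1)]] by (intro powr_le1) auto
        finally show ?thesis .
      qed
    qed simp_all
    then have "(norm (F (of_real \<theta>)))\<^sup>2 \<le> 1" by simp
    also have "F (of_real \<theta>) = (mpow L (\<theta> / 2) ** mpow G (\<theta> / 2)) ** mpow \<tau> (x / 2)"
      unfolding F_def by (simp add: cpow_line_real[where w = "\<theta>/2"] cpow_line_real[where w = "x/2"] x_def field_simps mult_right_assoc)
    also have "(norm \<dots>)\<^sup>2 = Re (trace ((adj (mpow L (\<theta> / 2) ** mpow G (\<theta> / 2)) ** (mpow L (\<theta> / 2) ** mpow G (\<theta> / 2))) ** mpow \<tau> x))"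
      using \<tau> by (intro norm_mult_mpow_sq) auto
    also have "adj (mpow L (\<theta> / 2) ** mpow G (\<theta> / 2)) ** (mpow L (\<theta> / 2) ** mpow G (\<theta> / 2)) = Y"
      using L G by (simp add: adj_mult Y_def mult_right_assoc mpow_add_left)
    finally have "schatten (1 / (s * \<theta>)) Y \<le> 1" using \<tau>(3) by (simp add: x_def)
    then have "schatten (1 / (s * \<theta>)) Y powr (1 / (s * \<theta>)) \<le> 1" using s\<theta> by (intro powr_le1) auto
    then show ?thesis using schatten_powr[OF pd_psd[OF Y], of "1 / (s * \<theta>)"] s\<theta> by (simp add: \<sigma>_def)
  qed
  with \<sigma> L Li \<sigma>i Yi show ?thesis using that by metis
qed

subsection \<open>The four interpolation inequalities\<close>

lemma emb_emb_mult_left: "emb (emb A) ** (emb (emb B) ** X) = emb (emb (A ** B)) ** X"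
  by (simp add: emb_mult_left emb_mult)

text \<open>The suffix gives the signs of the exponents \<open>a\<close>, \<open>b\<close>, \<open>c\<close> in \<open>1 / a = 1 / b + 1 / c\<close>; here a
  negative exponent is represented by its absolute value.  In \<open>chain_ppp\<close> and \<open>chain_mmp\<close> the imaginary
  powers inside \<open>F\<close> are absorbed by the unitary \<open>U\<close> of \<open>interpolation_upper\<close>; in \<open>chain_ppm\<close> and
  \<open>chain_mpm\<close> this is not possible, and a geometric mean is used instead.\<close>

lemma chain_ppp:
  fixes T :: "complex^('a::finite \<times> 'b::finite \<times> 'c::finite)^('a \<times> 'b \<times> 'c)" and R :: "complex^'d^('a \<times> 'b \<times> 'c)"
    and R' :: "complex^'e^('b \<times> 'c)"
  assumes T: "pd T" and \<omega>: "pd \<omega>" and \<kappa>: "\<kappa> > 0" "psd (\<kappa> *\<^sub>R \<omega> - ptrace1 (ptrace1 T))"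
    and \<beta>: "pd \<beta>" "Re (trace \<beta>) \<le> 1" and \<gamma>: "pd \<gamma>" "Re (trace \<gamma>) \<le> 1"
    and R': "R' ** adj R' = ptrace1 (R ** adj R)"
    and abc: "0 < b" "b < 1" "0 < c" "c < 1" "a = b * c / (b + c)"
    and K0: "\<kappa> powr c * schatten (1 / (1 - c)) (adj R' ** emb (mpow \<gamma> (- c)) ** R') \<le> K0" "K0 > 0"
    and K1: "schatten (1 / (1 - b)) (adj R ** emb (mpow \<beta> (- b)) ** R) \<le> K1" "K1 > 0"
  shows "(norm (mpow T (a / 2) ** (emb (emb (mpow \<omega> (- a / 2))) ** R)))\<^sup>2 \<le> K0 powr (a / c) * K1 powr (a / b)"
proof -
  define TB where "TB = ptrace1 T"
  have TB: "pd TB" using T by (simp add: TB_def pd_ptrace1)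
  \<comment> \<open>The point at which the exponent of \<open>TB\<close> vanishes; the exponents of
    \<open>T\<close> and \<open>\<omega>\<close> are then \<open>a / 2\<close> and
    \<open>- a / 2\<close>.\<close>
  define \<theta> where "\<theta> = c / (b + c)"
  have \<theta>: "0 < \<theta>" "\<theta> < 1" "a / b = \<theta>" "a / c = 1 - \<theta>"
    and e: "b / 2 * \<theta> = a / 2" "c / 2 + (- (c + b) / 2) * \<theta> = 0" "- c / 2 + c / 2 * \<theta> = - a / 2"
    using abc by (auto simp: \<theta>_def field_simps)
  define F where "F z = cpow_line T 0 (b / 2) z ** (emb (cpow_line TB (c / 2) (- (c + b) / 2) z ** emb (cpow_line \<omega> (- c / 2) (c / 2) z)) ** R)" for z
  have "(norm (F (of_real \<theta>)))\<^sup>2 \<le> K0 powr (1 - \<theta>) * K1 powr \<theta>"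
  proof (rule three_lines[OF _ _ _ K0(2) K1(2) \<theta>(1,2)])
    have "F = (\<lambda>z. cpow_line T 0 (b / 2) z ** ((cpow_line (emb TB) (c / 2) (- (c + b) / 2) z ** cpow_line (emb (emb \<omega>)) (- c / 2) (c / 2) z) ** R))"
      using TB \<omega> by (simp add: F_def cpow_line_emb emb_mult fun_eq_iff)
    then show "strip_ok F" using T TB \<omega> by (auto intro!: strip_ok_mult)
    show "(norm (F (\<i> * of_real t)))\<^sup>2 \<le> K0" for t
    proof -
      define U where "U = imag_pow \<omega> (c / 2 * t)"
      define W where "W = mpow TB (c / 2) ** emb (mpow \<omega> (- c / 2) ** U)"
      have "F (\<i> * of_real t) = imag_pow T (b / 2 * t) ** (emb (imag_pow TB (- (c + b) / 2 * t)) ** (emb W ** R))"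
        unfolding F_def cpow_line_0_imag cpow_line_0_left[OF pd_herm[OF TB]] cpow_line_0_right[OF pd_herm[OF \<omega>]] W_def U_def
        by (simp add: emb_mult_left mult_right_assoc)
      then have "norm (F (\<i> * of_real t)) \<le> norm (emb W ** R)"
        using T norm_unitary_mult[OF unitary_emb[OF unitary_imag_pow[OF TB]]] norm_imag_pow_mult[of T] by (metis pd_herm)
      also have "\<dots> = norm (W ** R')" by (rule norm_emb_reduce[OF R'])
      finally have "(norm (F (\<i> * of_real t)))\<^sup>2 \<le> (norm (W ** R'))\<^sup>2" by (intro power_mono) auto
      also have "\<dots> \<le> \<kappa> powr c * schatten (1 / (1 - c)) (adj R' ** emb (mpow \<gamma> (- c)) ** R')"
      proof -
        have "W ** R' = mpow TB (c / 2) ** (emb (mpow \<omega> (- c / 2) ** U) ** R')" by (simp add: W_def mult_right_assoc)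
        then show ?thesis using interpolation_upper[OF TB \<omega> \<kappa>(1) _ _ \<gamma> abc(3,4), of U R'] \<kappa>(2) \<omega>
          by (simp add: U_def unitary_imag_pow TB_def)
      qed
      finally show ?thesis using K0 by simp
    qed
    show "(norm (F (1 + \<i> * of_real t)))\<^sup>2 \<le> K1" for t
    proof -
      define U where "U = imag_pow TB (- (c + b) / 2 * t) ** emb (imag_pow \<omega> (c / 2 * t))"
      have U: "unitary U" using TB \<omega> by (simp add: U_def unitary_mult unitary_emb unitary_imag_pow)
      have "F (1 + \<i> * of_real t) = imag_pow T (b / 2 * t) ** (mpow T (b / 2) ** (emb (mpow TB (- b / 2) ** U) ** R))"
        unfolding F_def U_def using T TB \<omega>
        by (simp add: cpow_line_1_left[where w = "b / 2"] cpow_line_1_right[where w = "- b / 2"] cpow_line_1_imag field_simps mult_right_assoc)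
      then have "norm (F (1 + \<i> * of_real t)) \<le> norm (mpow T (b / 2) ** (emb (mpow TB (- b / 2) ** U) ** R))"
        using T norm_imag_pow_mult[of T] by simp
      then have "(norm (F (1 + \<i> * of_real t)))\<^sup>2 \<le> (norm (mpow T (b / 2) ** (emb (mpow TB (- b / 2) ** U) ** R)))\<^sup>2"
        by (intro power_mono) auto
      \<comment> \<open>The constant is 1 here because \<open>TB\<close> is the exact marginal of
        \<open>T\<close>; at the other end \<open>TB\<close> plays the part of \<open>T\<close> and
        \<kappa> enters.\<close>
      also have "\<dots> \<le> 1 powr b * schatten (1 / (1 - b)) (adj R ** emb (mpow \<beta> (- b)) ** R)"
        using T TB U \<beta> abc by (intro interpolation_upper) (auto simp: TB_def)
      finally show ?thesis using K1 by simp
    qed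
  qed
  also have "F (of_real \<theta>) = mpow T (a / 2) ** (emb (emb (mpow \<omega> (- a / 2))) ** R)"
    unfolding F_def cpow_line_real[OF e(2)] cpow_line_real[OF e(3)] using TB cpow_line_real[of 0 "b / 2" \<theta> "a / 2" T] e(1) by (simp add: mpow_0)
  finally show ?thesis by (simp add: \<theta>)
qed

text \<open>\<open>\<sigma>\<close> acts on the auxiliary index of \<open>R\<close> and linearises
  the quasi-norms of the two negative exponents. The family shows the \<open>a\<close>-expression
  for the marginal of \<open>T\<close> at 0 and \<open>T\<close> against its own marginal, as in
  \<open>interpolation_upper\<close>, at 1; at \<open>\<theta>\<close> the marginal drops
  out.\<close>

lemma chain_mmp:
  fixes T :: "complex^('b::finite \<times> 'c::finite)^('b \<times> 'c)" and R :: "complex^'d^('a::finite \<times> 'b \<times> 'c)"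
    and R' :: "complex^'e^('b \<times> 'c)"
  assumes T: "pd T" and \<sigma>: "pd \<sigma>" and \<gamma>: "pd \<gamma>" "Re (trace \<gamma>) \<le> 1"
    and R': "R' ** adj R' = ptrace1 (R ** adj R)"
    and abc: "0 < a" "0 < c" "c < 1" "b = a * c / (a + c)"
    and K0: "(norm (emb (emb (mpow (ptrace1 T) (a / 2))) ** (R ** mpow \<sigma> (- a / 2))))\<^sup>2 \<le> K0" "K0 > 0"
    and K1: "schatten (1 / (1 - c)) (adj R' ** emb (mpow \<gamma> (- c)) ** R') \<le> K1" "K1 > 0"
  shows "(norm (emb (mpow T (b / 2)) ** (R ** mpow \<sigma> (- b / 2))))\<^sup>2 \<le> K0 powr (b / a) * K1 powr (b / c)"
proof -
  define TC where "TC = ptrace1 T"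
  have TC: "pd TC" using T by (simp add: TC_def pd_ptrace1)
  define \<theta> where "\<theta> = a / (a + c)"
  have \<theta>: "0 < \<theta>" "\<theta> < 1" "b / c = \<theta>" "b / a = 1 - \<theta>"
    and e: "c / 2 * \<theta> = b / 2" "a / 2 + (- (a + c) / 2) * \<theta> = 0" "- a / 2 + a / 2 * \<theta> = - b / 2"
    using abc by (auto simp: \<theta>_def field_simps)
  define F where "F z = emb (cpow_line T 0 (c / 2) z ** emb (cpow_line TC (a / 2) (- (a + c) / 2) z)) ** (R ** cpow_line \<sigma> (- a / 2) (a / 2) z)" for z
  have "(norm (F (of_real \<theta>)))\<^sup>2 \<le> K0 powr (1 - \<theta>) * K1 powr \<theta>"
  proof (rule three_lines[OF _ _ _ K0(2) K1(2) \<theta>(1,2)])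
    have "F = (\<lambda>z. (cpow_line (emb T) 0 (c / 2) z ** cpow_line (emb (emb TC)) (a / 2) (- (a + c) / 2) z) ** (R ** cpow_line \<sigma> (- a / 2) (a / 2) z))"
      using T TC by (simp add: F_def cpow_line_emb emb_mult fun_eq_iff)
    then show "strip_ok F" using T TC \<sigma> by (auto intro!: strip_ok_mult)
    show "(norm (F (\<i> * of_real t)))\<^sup>2 \<le> K0" for t
    proof -
      define U :: "complex^('a \<times> 'b \<times> 'c)^('a \<times> 'b \<times> 'c)" where "U = emb (imag_pow T (c / 2 * t) ** emb (imag_pow TC (- (a + c) / 2 * t)))"
      have U: "unitary U" using T TC by (simp add: U_def unitary_mult unitary_emb unitary_imag_pow)
      have "F (\<i> * of_real t) = U ** ((emb (emb (mpow TC (a / 2))) ** (R ** mpow \<sigma> (- a / 2))) ** imag_pow \<sigma> (a / 2 * t))"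
        unfolding F_def cpow_line_0_imag cpow_line_0_left[OF pd_herm[OF TC]] cpow_line_0_right[OF pd_herm[OF \<sigma>]] U_def
        by (simp add: emb_mult_left emb_mult mult_right_assoc)
      then have "norm (F (\<i> * of_real t)) = norm (emb (emb (mpow TC (a / 2))) ** (R ** mpow \<sigma> (- a / 2)))"
        using U \<sigma> by (simp add: unitary_imag_pow)
      then show ?thesis using K0(1) by (simp add: TC_def)
    qed
    show "(norm (F (1 + \<i> * of_real t)))\<^sup>2 \<le> K1" for t
    proof -
      define U where "U = imag_pow TC (- (a + c) / 2 * t)"
      have U: "unitary U" using TC by (simp add: U_def unitary_imag_pow)
      define W where "W = mpow T (c / 2) ** emb (mpow TC (- c / 2) ** U)"
      have "F (1 + \<i> * of_real t) = emb (imag_pow T (c / 2 * t)) ** (emb W ** R ** imag_pow \<sigma> (a / 2 * t))"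
        unfolding F_def U_def W_def using T TC \<sigma>
        by (simp add: cpow_line_1_left[where w = "c / 2"] cpow_line_1_right[where w = "- c / 2"] cpow_line_1_imag field_simps mult_right_assoc emb_mult_left)
      then have "norm (F (1 + \<i> * of_real t)) = norm (emb W ** R)"
        using T \<sigma> by (simp add: unitary_imag_pow unitary_emb)
      also have "\<dots> = norm (W ** R')" by (rule norm_emb_reduce[OF R'])
      also have "(norm (W ** R'))\<^sup>2 \<le> 1 powr c * schatten (1 / (1 - c)) (adj R' ** emb (mpow \<gamma> (- c)) ** R')"
      proof -
        have "W ** R' = mpow T (c / 2) ** (emb (mpow TC (- c / 2) ** U) ** R')" by (simp add: W_def mult_right_assoc)
        then show ?thesis using interpolation_upper[OF T TC _ _ U \<gamma> abc(2,3), of 1 R']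
          by (simp add: TC_def)
      qed
      finally show ?thesis using K1 by simp
    qed
  qed
  also have "F (of_real \<theta>) = emb (mpow T (b / 2)) ** (R ** mpow \<sigma> (- b / 2))"
    unfolding F_def cpow_line_real[OF e(2)] cpow_line_real[OF e(3)] using TC cpow_line_real[of 0 "c / 2" \<theta> "b / 2" T] e(1) by (simp add: mpow_0)
  finally show ?thesis by (simp add: \<theta>)
qed

text \<open>A candidate for the exponent \<open>b\<close> is built from \<open>\<omega>\<close> and
  \<open>\<sigma>\<close>. Its Schatten value is the trace against an optimal
  \<open>mpow \<tau> b\<close>, and the family joins a trace against \<open>mpow \<tau> a\<close> at
  0 to the \<open>c\<close>-expression at 1.\<close>

lemma chain_ppm:
  fixes \<sigma> :: "complex^('b::finite \<times> 'c::finite)^('b \<times> 'c)" and R :: "complex^'d^('a::finite \<times> 'b \<times> 'c)"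
  assumes \<omega>: "pd \<omega>" and \<sigma>: "pd \<sigma>" "Re (trace \<sigma>) \<le> 1"
    and abc: "0 < a" "a < 1" "0 < c" "c < 1" "b = a * c / (a + c)"
    and K0: "schatten (1 / (1 - a)) (adj R ** emb (emb (mpow \<omega> (- a))) ** R) \<le> K0" "K0 > 0"
    and K1: "(norm (emb (mpow \<sigma> (- c / 2) ** emb (mpow \<omega> (c / 2))) ** R))\<^sup>2 \<le> K1" "K1 > 0"
  obtains \<sigma>' :: "complex^('b \<times> 'c)^('b \<times> 'c)" where "pd \<sigma>'" "Re (trace \<sigma>') \<le> 1"
    "schatten (1 / (1 - b)) (adj R ** emb (mpow \<sigma>' (- b)) ** R) \<le> K0 powr (b / a) * K1 powr (b / c)"
proof -
  define \<theta> where "\<theta> = a / (a + c)"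
  have \<theta>: "0 < \<theta>" "\<theta> < 1" "b / c = \<theta>" "b / a = 1 - \<theta>" "c * \<theta> = b" "(a + c) * \<theta> = a"
    and e: "a / 2 + - a / 2 * \<theta> = b / 2"
    using abc by (auto simp: \<theta>_def field_simps)
  have "a * c < a" using abc by simp
  then have "a * c < a + c" using abc by linarith
  then have b: "0 < b" "b < 1" unfolding abc(5) using abc(1,3) by simp_all
  define E where "E = (emb \<omega> :: complex^('b \<times> 'c)^('b \<times> 'c))"
  \<comment> \<open>The exponent is forced at both ends: \<open>(a + c) * \<theta> = a\<close> makes
    the outer factors of \<open>\<sigma>'\<close> equal to the power of \<open>E\<close> inside
    \<open>Q\<close>, and at 1 the half power leaves
    \<open>(a + c) / 2 - a / 2 = c / 2\<close>.\<close>
  define G where "G = mpow E (a + c)"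
  have E: "pd E" using \<omega> by (simp add: E_def)
  then have G: "pd G" by (simp add: G_def)
  obtain \<sigma>' L where s': "pd \<sigma>'" "Re (trace \<sigma>') \<le> 1" and L: "pd L"
    "mpow L (- 1) = mpow G (1 / 2) ** mpow \<sigma> (- c) ** mpow G (1 / 2)"
    and s'L: "mpow \<sigma>' (- (c * \<theta>)) = mpow G (- \<theta> / 2) ** mpow L (- \<theta>) ** mpow G (- \<theta> / 2)"
    using geometric_mean_density[OF G \<sigma> abc(3,4) \<theta>(1,2)] by metis
  have Gp: "mpow G (- \<theta> / 2) = mpow E (- a / 2)" "mpow G (1 / 2) = mpow E ((a + c) / 2)"
    using E \<theta>(6) by (simp_all add: G_def mpow_mpow)
  define Q where "Q = emb (mpow E (- a / 2)) ** R"
  have Ea: "emb (emb (mpow \<omega> (- a))) = emb (mpow E (- a))"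
    using \<omega> by (simp add: E_def mpow_emb)
  have QQ: "adj Q ** Q = adj R ** emb (emb (mpow \<omega> (- a))) ** R"
    unfolding Ea using E by (simp add: Q_def adj_mult adj_emb mult_right_assoc emb_mult_left mpow_add)
  define P where "P = adj R ** emb (mpow \<sigma>' (- b)) ** R"
  have P: "P = adj Q ** emb (mpow L (- \<theta>)) ** Q"
    using s'L unfolding \<theta>(5) Gp using E by (simp add: P_def Q_def adj_mult adj_emb mult_right_assoc emb_mult emb_mult_left)
  have "psd P" unfolding P using L psd_conj[of "emb (mpow L (- \<theta>))" "adj Q"] by simp
  have "schatten (1 / (1 - b)) P \<le> K0 powr (b / a) * K1 powr (b / c)"
  proof (cases "P = 0")
    case True
    then show ?thesis using trace_mpow_zero_iff[OF \<open>psd P\<close>] by (simp add: schatten_def)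
  next
    case False
    obtain \<tau> where \<tau>: "psd \<tau>" "trace \<tau> = 1" "Re (trace (P ** mpow \<tau> b)) = schatten (1 / (1 - b)) P"
      by (rule schatten_attained[OF \<open>psd P\<close> False b])
    define F where "F z = cpow_line (emb L) 0 (- 1 / 2) z ** (Q ** cpow_line \<tau> (a / 2) (- a / 2) z)" for z
    have "(norm (F (of_real \<theta>)))\<^sup>2 \<le> K0 powr (1 - \<theta>) * K1 powr \<theta>"
    proof (rule three_lines[OF _ _ _ K0(2) K1(2) \<theta>(1,2)])
      show "strip_ok F" unfolding F_def using L \<tau> by (intro strip_ok_mult strip_ok_const strip_ok_cpow_line) auto
      show "(norm (F (\<i> * of_real t)))\<^sup>2 \<le> K0" for t
      proof -
        have "F (\<i> * of_real t) = imag_pow (emb L) (- 1 / 2 * t) ** ((Q ** mpow \<tau> (a / 2)) ** imag_pow \<tau> (- a / 2 * t))"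
          unfolding F_def cpow_line_0_imag cpow_line_0_right[OF psd_herm[OF \<tau>(1)]] by (simp add: mult_right_assoc)
        then have "norm (F (\<i> * of_real t)) \<le> norm (Q ** mpow \<tau> (a / 2))"
          using L \<tau> by (auto intro!: order_trans[OF norm_imag_pow_mult] norm_mult_imag_pow)
        then have "(norm (F (\<i> * of_real t)))\<^sup>2 \<le> (norm (Q ** mpow \<tau> (a / 2)))\<^sup>2" by (intro power_mono) auto
        also have "\<dots> = Re (trace ((adj Q ** Q) ** mpow \<tau> a))" using \<tau> by (intro norm_mult_mpow_sq) auto
        also have "\<dots> \<le> schatten (1 / (1 - a)) (adj Q ** Q)" using \<tau> abc by (intro holder_trace) auto
        finally show ?thesis using K0(1) QQ by simp
      qed
      show "(norm (F (1 + \<i> * of_real t)))\<^sup>2 \<le> K1" for t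
      proof -
        have "F (1 + \<i> * of_real t) = imag_pow (emb L) (- 1 / 2 * t) ** ((emb (mpow L (- 1 / 2)) ** Q) ** imag_pow \<tau> (- a / 2 * t))"
          unfolding F_def using L \<tau>
          by (simp add: cpow_line_1_left[where w = "- 1 / 2"] cpow_line_1_imag field_simps mult_right_assoc mpow_emb)
        then have "norm (F (1 + \<i> * of_real t)) \<le> norm (emb (mpow L (- 1 / 2)) ** Q)"
          using L \<tau> by (auto intro!: order_trans[OF norm_imag_pow_mult] norm_mult_imag_pow)
        then have "(norm (F (1 + \<i> * of_real t)))\<^sup>2 \<le> (norm (emb (mpow L (- 1 / 2)) ** Q))\<^sup>2" by (intro power_mono) auto
        also have "\<dots> = Re (trace (adj Q ** emb (mpow L (- 1)) ** Q))"
          using L by (simp add: norm_sq_trace' adj_mult adj_emb mult_right_assoc emb_mult_left mpow_add)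
        also have "adj Q ** emb (mpow L (- 1)) ** Q
            = adj (emb (mpow \<sigma> (- c / 2) ** mpow E (c / 2)) ** R) ** (emb (mpow \<sigma> (- c / 2) ** mpow E (c / 2)) ** R)"
          unfolding L(2) Gp using E \<sigma>
          by (simp add: Q_def adj_mult adj_emb mult_right_assoc emb_mult_left mpow_add mpow_add_left field_simps)
        also have "Re (trace \<dots>) = (norm (emb (mpow \<sigma> (- c / 2) ** mpow E (c / 2)) ** R))\<^sup>2"
          by (rule norm_sq_trace'[symmetric])
        also have "mpow E (c / 2) = emb (mpow \<omega> (c / 2))" using \<omega> by (simp add: E_def mpow_emb)
        finally show ?thesis by (rule order_trans[OF _ K1(1)])
      qed
    qed
    also have "F (of_real \<theta>) = (emb (mpow L (- \<theta> / 2)) ** Q) ** mpow \<tau> (b / 2)"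
      unfolding F_def cpow_line_real[OF e] using L by (simp add: cpow_line_real[where w = "- \<theta> / 2"] mpow_emb mult_right_assoc)
    also have "(norm \<dots>)\<^sup>2 = Re (trace ((adj (emb (mpow L (- \<theta> / 2)) ** Q) ** (emb (mpow L (- \<theta> / 2)) ** Q)) ** mpow \<tau> b))"
      using \<tau> by (intro norm_mult_mpow_sq) auto
    also have "adj (emb (mpow L (- \<theta> / 2)) ** Q) ** (emb (mpow L (- \<theta> / 2)) ** Q) = P"
      using L by (simp add: P adj_mult adj_emb mult_right_assoc emb_mult_left mpow_add)
    finally show ?thesis using \<tau>(3) \<theta> by simp
  qed
  then show ?thesis using that s' by (simp add: P_def)
qed

text \<open>On the auxiliary index \<open>\<sigma>\<close> has exponent \<open>- a / 2\<close> at 0,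
  matching the \<open>a\<close>-expression, and \<open>b / 2\<close> at 1, where Hoelder's
  inequality applies. It drops out at \<open>\<theta>\<close>, leaving the
  \<open>c\<close>-expression for the new matrix \<open>\<sigma>'\<close>.\<close>

lemma chain_mpm:
  fixes \<omega> :: "complex^('b::finite \<times> 'c::finite)^('b \<times> 'c)" and R :: "complex^'d^('a::finite \<times> 'b \<times> 'c)"
  assumes \<tau>: "pd \<tau>" and \<omega>: "pd \<omega>" "Re (trace \<omega>) \<le> 1" and \<sigma>: "pd \<sigma>" "Re (trace \<sigma>) \<le> 1"
    and abc: "0 < a" "0 < b" "b < 1" "c = a * b / (a + b)"
    and K0: "(norm (emb (emb (mpow \<tau> (a / 2))) ** (R ** mpow \<sigma> (- a / 2))))\<^sup>2 \<le> K0" "K0 > 0"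
    and K1: "schatten (1 / (1 - b)) (adj R ** emb (mpow \<omega> (- b)) ** R) \<le> K1" "K1 > 0"
  obtains \<sigma>' :: "complex^('b \<times> 'c)^('b \<times> 'c)" where "pd \<sigma>'" "Re (trace \<sigma>') \<le> 1"
    "(norm (emb (mpow \<sigma>' (- c / 2) ** emb (mpow \<tau> (c / 2))) ** R))\<^sup>2 \<le> K0 powr (c / a) * K1 powr (c / b)"
proof -
  define \<theta> where "\<theta> = a / (a + b)"
  have \<theta>: "0 < \<theta>" "\<theta> < 1" "c / b = \<theta>" "c / a = 1 - \<theta>" "b * \<theta> = c" 
    and e: "- a / 2 + (a + b) / 2 * \<theta> = 0" "a * \<theta> / 2 + c / 2 = a / 2"
    using abc by (auto simp: \<theta>_def field_simps)
  define E where "E = (emb \<tau> :: complex^('b \<times> 'c)^('b \<times> 'c))"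
  \<comment> \<open>Its half powers cancel the \<open>E\<close>-factors of \<open>Q\<close> at 1,
    leaving the sandwich by \<open>\<omega>\<close> alone; at \<open>\<theta>\<close> the exponents
    balance because \<open>a * \<theta> + c = a\<close>.\<close>
  define G where "G = mpow E (- a)"
  have E: "pd E" using \<tau> by (simp add: E_def)
  then have G: "pd G" by (simp add: G_def)
  obtain \<sigma>' L where s': "pd \<sigma>'" "Re (trace \<sigma>') \<le> 1" and L: "pd L"
    "mpow L (- 1) = mpow G (1 / 2) ** mpow \<omega> (- b) ** mpow G (1 / 2)"
    and s'L: "mpow \<sigma>' (- (b * \<theta>)) = mpow G (- \<theta> / 2) ** mpow L (- \<theta>) ** mpow G (- \<theta> / 2)"
    using geometric_mean_density[OF G \<omega> abc(2,3) \<theta>(1,2)] by metis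
  have Gp: "mpow G (- \<theta> / 2) = mpow E (a * \<theta> / 2)" "mpow G (1 / 2) = mpow E (- a / 2)"
    using E by (simp_all add: G_def mpow_mpow)
  define Q where "Q = emb (mpow E (a / 2)) ** R"
  define F where "F z = cpow_line (emb L) 0 (- 1 / 2) z ** (Q ** cpow_line \<sigma> (- a / 2) ((a + b) / 2) z)" for z
  have "(norm (F (of_real \<theta>)))\<^sup>2 \<le> K0 powr (1 - \<theta>) * K1 powr \<theta>"
  proof (rule three_lines[OF _ _ _ K0(2) K1(2) \<theta>(1,2)])
    show "strip_ok F" unfolding F_def using L \<sigma> by (intro strip_ok_mult strip_ok_const strip_ok_cpow_line) auto
    show "(norm (F (\<i> * of_real t)))\<^sup>2 \<le> K0" for t
    proof -
      have "F (\<i> * of_real t) = imag_pow (emb L) (- 1 / 2 * t) ** ((Q ** mpow \<sigma> (- a / 2)) ** imag_pow \<sigma> ((a + b) / 2 * t))"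
        unfolding F_def cpow_line_0_imag cpow_line_0_right[OF pd_herm[OF \<sigma>(1)]] by (simp add: mult_right_assoc)
      then have "norm (F (\<i> * of_real t)) = norm (Q ** mpow \<sigma> (- a / 2))"
        using L \<sigma> by (simp add: unitary_imag_pow)
      also have "Q ** mpow \<sigma> (- a / 2) = emb (emb (mpow \<tau> (a / 2))) ** (R ** mpow \<sigma> (- a / 2))"
        using \<tau> by (simp add: Q_def E_def mpow_emb mult_right_assoc)
      finally show ?thesis using K0(1) by simp
    qed
    show "(norm (F (1 + \<i> * of_real t)))\<^sup>2 \<le> K1" for t
    proof -
      have "F (1 + \<i> * of_real t) = imag_pow (emb L) (- 1 / 2 * t) ** ((emb (mpow L (- 1 / 2)) ** Q) ** mpow \<sigma> (b / 2) ** imag_pow \<sigma> ((a + b) / 2 * t))"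
        unfolding F_def using L \<sigma>
        by (simp add: cpow_line_1_left[where w = "- 1 / 2"] cpow_line_1_right[where w = "b / 2"] field_simps mult_right_assoc mpow_emb)
      then have "norm (F (1 + \<i> * of_real t)) = norm ((emb (mpow L (- 1 / 2)) ** Q) ** mpow \<sigma> (b / 2))"
        using L \<sigma> by (simp add: unitary_imag_pow)
      also have "(norm ((emb (mpow L (- 1 / 2)) ** Q) ** mpow \<sigma> (b / 2)))\<^sup>2 = Re (trace ((adj (emb (mpow L (- 1 / 2)) ** Q) ** (emb (mpow L (- 1 / 2)) ** Q)) ** mpow \<sigma> b))"
        using \<sigma> by (intro norm_mult_mpow_sq) auto
      also have "adj (emb (mpow L (- 1 / 2)) ** Q) ** (emb (mpow L (- 1 / 2)) ** Q) = adj Q ** emb (mpow L (- 1)) ** Q"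
        using L by (simp add: adj_mult adj_emb mult_right_assoc emb_mult_left mpow_add)
      also have "\<dots> = adj R ** emb (mpow \<omega> (- b)) ** R"
        unfolding L(2) Gp using E \<omega>
        by (simp add: Q_def adj_mult adj_emb mult_right_assoc emb_mult_left mpow_add mpow_add_left mpow_0)
      also have "Re (trace (adj R ** emb (mpow \<omega> (- b)) ** R ** mpow \<sigma> b)) \<le> schatten (1 / (1 - b)) (adj R ** emb (mpow \<omega> (- b)) ** R)"
        using psd_conj[of "emb (mpow \<omega> (- b))" "adj R"] \<omega> \<sigma> abc by (intro holder_trace) auto
      finally show ?thesis using K1(1) by simp
    qed
  qed
  also have "F (of_real \<theta>) = emb (mpow L (- \<theta> / 2)) ** Q"
    unfolding F_def cpow_line_real[OF e(1)] using L \<sigma> by (simp add: cpow_line_real[where w = "- \<theta> / 2"] mpow_emb mult_right_assoc mpow_0)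
  also have "(norm \<dots>)\<^sup>2 = Re (trace (adj Q ** emb (mpow L (- \<theta>)) ** Q))"
    using L by (simp add: norm_sq_trace' adj_mult adj_emb mult_right_assoc emb_mult_left mpow_add)
  also have "adj Q ** emb (mpow L (- \<theta>)) ** Q
      = adj (emb (mpow \<sigma>' (- c / 2) ** mpow E (c / 2)) ** R) ** (emb (mpow \<sigma>' (- c / 2) ** mpow E (c / 2)) ** R)"
  proof -
    have "mpow E (c / 2) ** mpow \<sigma>' (- c) ** mpow E (c / 2) = mpow E (a / 2) ** mpow L (- \<theta>) ** mpow E (a / 2)"
      using s'L E unfolding \<theta>(5) Gp by (simp add: mult_right_assoc mpow_add_left mpow_add e(2) add.commute[of "c / 2"])
    then show ?thesis using E s'
      by (simp add: Q_def adj_mult adj_emb mult_right_assoc emb_mult_left mpow_add mpow_add_left)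
  qed
  also have "Re (trace \<dots>) = (norm (emb (mpow \<sigma>' (- c / 2) ** mpow E (c / 2)) ** R))\<^sup>2"
    by (rule norm_sq_trace'[symmetric])
  also have "mpow E (c / 2) = emb (mpow \<tau> (c / 2))" using \<tau> by (simp add: E_def mpow_emb)
  finally show ?thesis using that s' \<theta> by simp
qed

subsection \<open>Continuity of the functional calculus\<close>

lemma psd_minus_scaleR_eigen:
  assumes U: "unitary U" and M: "M = U ** diagm (\<lambda>i. complex_of_real (d i)) ** adj U"
    and p: "psd (M - \<eta> *\<^sub>R mat 1)"
  shows "d i \<ge> \<eta>"
proof -
  have "M - \<eta> *\<^sub>R mat 1 = U ** diagm (\<lambda>i. complex_of_real (d i - \<eta>)) ** adj U"
    unfolding M by (rule unitary_diag_minus[OF U])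
  then have "adj U ** (M - \<eta> *\<^sub>R mat 1) ** adj (adj U) = diagm (\<lambda>i. complex_of_real (d i - \<eta>))"
    using U by (simp add: mult_right_assoc)
  then have "psd (diagm (\<lambda>i. complex_of_real (d i - \<eta>)))" using psd_conj[OF p] by metis
  then have "0 \<le> Re (cinner (axis i 1) (diagm (\<lambda>i. complex_of_real (d i - \<eta>)) *v axis i 1))"
    by (simp add: psd_def)
  also have "cinner (axis i 1) (diagm (\<lambda>i. complex_of_real (d i - \<eta>)) *v axis i 1) = d i - \<eta>"
    by (simp add: cinner_def matrix_vector_mult_def axis_def diagm_nth if_distrib[where f = "\<lambda>x. x * _"]
          if_distrib[where f = "\<lambda>x. _ * x"] if_distrib[where f = cnj] cong: if_cong)
  finally show ?thesis by simp
qed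

lemma tendsto_matrix_mult:
  fixes A :: "'a \<Rightarrow> complex^'n^'m" and B :: "'a \<Rightarrow> complex^'k^'n"
  assumes "(A \<longlongrightarrow> a) F" "(B \<longlongrightarrow> b) F" shows "((\<lambda>x. A x ** B x) \<longlongrightarrow> a ** b) F"
  by (rule vec_tendstoI, rule vec_tendstoI) (unfold matrix_nth_mult, intro tendsto_intros assms)

lemma tendsto_adj: "(A \<longlongrightarrow> a) F \<Longrightarrow> ((\<lambda>x. adj (A x)) \<longlongrightarrow> adj a) F"
  by (rule vec_tendstoI, rule vec_tendstoI) (unfold adj_nth, intro tendsto_intros)

lemma tendsto_diagm: "(\<And>i. ((\<lambda>x. d x i) \<longlongrightarrow> e i) F) \<Longrightarrow> ((\<lambda>x. diagm (d x)) \<longlongrightarrow> diagm e) F"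
  by (rule vec_tendstoI, rule vec_tendstoI) (auto simp: diagm_nth)

text \<open>Eigenvalues need not be followed continuously. Along a convergent sequence, eigenbases
  lie in the compact unitary group and eigenvalues in a fixed box, so a subsequence of
  decompositions converges to a decomposition of the limit, and any decomposition computes
  \<open>fun_calc\<close>. The bound \<open>\<eta>\<close> keeps the spectrum in the domain of
  \<open>f\<close>; \<open>\<eta> > 0\<close> admits negative powers.\<close>

theorem continuous_on_fun_calc:
  fixes f :: "real \<Rightarrow> real"
  assumes f: "continuous_on {\<eta>..} f"
  shows "continuous_on {M :: complex^'n^'n. psd (M - \<eta> *\<^sub>R mat 1)} (fun_calc (\<lambda>x. complex_of_real (f x)))"
  unfolding continuous_on_sequentially
proof (intro allI ballI impI, elim conjE)
  fix X :: "nat \<Rightarrow> complex^'n^'n" and A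
  assume A: "A \<in> {M. psd (M - \<eta> *\<^sub>R mat 1)}" and X: "\<forall>n. X n \<in> {M. psd (M - \<eta> *\<^sub>R mat 1)}" "X \<longlonglongrightarrow> A"
  define g where "g = fun_calc (\<lambda>x. complex_of_real (f x)) \<circ> X"
  have h: "herm M" if "psd (M - \<eta> *\<^sub>R mat 1)" for M :: "complex^'n^'n"
    using psd_herm[OF that] by (simp add: herm_def adj_minus adj_scaleR)
  obtain B where B: "\<And>n. norm (X n) \<le> B"
    using convergent_imp_Bseq[OF convergentI[OF X(2)]] by (auto simp: Bseq_def)
  have "\<exists>p. fst p \<in> {U. unitary U} \<and> snd p \<in> cbox (\<chi> i. \<eta>) (\<chi> i. B) \<and>
      X n = fst p ** diagm (\<lambda>i. complex_of_real (snd p $ i)) ** adj (fst p) \<and>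
      g n = fst p ** diagm (\<lambda>i. complex_of_real (f (snd p $ i))) ** adj (fst p)" for n
  proof -
    have p: "psd (X n - \<eta> *\<^sub>R mat 1)" using X(1) by simp
    show ?thesis
    proof (rule hermE[OF h[OF p]])
      fix U d assume U: "unitary U" "X n = U ** diagm (\<lambda>i. complex_of_real (d i)) ** adj U"
        "\<And>f. fun_calc f (X n) = U ** diagm (\<lambda>i. f (d i)) ** adj U"
      have "d i \<le> B" for i
      proof -
        have "(d i)\<^sup>2 \<le> (norm (diagm (\<lambda>i. complex_of_real (d i)) :: complex^'n^'n))\<^sup>2"
          unfolding norm_matrix_sq
          by (rule order_trans[OF _ member_le_sum[of i]], rule order_trans[OF _ member_le_sum[of i]])
             (auto simp: diagm_nth intro: sum_nonneg)
        then have "d i \<le> norm (diagm (\<lambda>i. complex_of_real (d i)) :: complex^'n^'n)"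
          by (simp add: power2_le_iff_abs_le)
        also have "\<dots> = norm (X n)" using U by (simp add: mult_right_assoc)
        finally show ?thesis using B[of n] by simp
      qed
      moreover have "\<eta> \<le> d i" for i using psd_minus_scaleR_eigen[OF U(1,2) p] .
      ultimately show ?thesis using U
        by (intro exI[of _ "(U, \<chi> i. d i)"]) (auto simp: mem_box_cart g_def)
    qed
  qed
  then obtain p where p: "\<And>n. fst (p n) \<in> {U. unitary U}" "\<And>n. snd (p n) \<in> cbox (\<chi> i. \<eta>) (\<chi> i. B)"
      "\<And>n. X n = fst (p n) ** diagm (\<lambda>i. complex_of_real (snd (p n) $ i)) ** adj (fst (p n))"
      "\<And>n. g n = fst (p n) ** diagm (\<lambda>i. complex_of_real (f (snd (p n) $ i))) ** adj (fst (p n))"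
    by metis
  have K: "compact ({U :: complex^'n^'n. unitary U} \<times> cbox (\<chi> i. \<eta>) (\<chi> i. (B :: real)) )"
    by (intro compact_Times compact_unitary compact_cbox)
  show "g \<longlonglongrightarrow> fun_calc (\<lambda>x. complex_of_real (f x)) A"
  proof (rule ccontr)
    assume "\<not> g \<longlonglongrightarrow> fun_calc (\<lambda>x. complex_of_real (f x)) A"
    then obtain e where e: "e > 0" "\<exists>\<^sub>F n in sequentially. \<not> dist (g n) (fun_calc (\<lambda>x. complex_of_real (f x)) A) < e"
      unfolding tendsto_iff frequently_def by auto
    then have "infinite {n. \<not> dist (g n) (fun_calc (\<lambda>x. complex_of_real (f x)) A) < e}"
      by (simp add: frequently_cofinite[symmetric] cofinite_eq_sequentially)
    then obtain r :: "nat \<Rightarrow> nat" where r: "strict_mono r" "\<And>n. \<not> dist (g (r n)) (fun_calc (\<lambda>x. complex_of_real (f x)) A) < e"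
      using infinite_enumerate by blast
    have "\<forall>n. (p \<circ> r) n \<in> {U. unitary U} \<times> cbox (\<chi> i. \<eta>) (\<chi> i. B)" using p(1,2) by (auto simp: mem_Times_iff)
    then obtain l s where l: "l \<in> {U. unitary U} \<times> cbox (\<chi> i. \<eta>) (\<chi> i. B)" and s: "strict_mono s" "((p \<circ> r) \<circ> s) \<longlonglongrightarrow> l"
      using K unfolding compact_def by blast
    define q where "q n = p (r (s n))" for n
    have q: "q \<longlonglongrightarrow> l" using s(2) by (simp add: q_def[abs_def] o_def)
    have q1: "(\<lambda>n. fst (q n)) \<longlonglongrightarrow> fst l" and q2: "(\<lambda>n. snd (q n) $ i) \<longlonglongrightarrow> snd l $ i" for i
      using q by (auto intro!: tendsto_intros)
    have rs: "strict_mono (r \<circ> s)" using r(1) s(1) by (rule strict_mono_o)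
    have "(\<lambda>n. X (r (s n))) \<longlonglongrightarrow> A" using LIMSEQ_subseq_LIMSEQ[OF X(2) rs] by (simp add: o_def)
    moreover have "(\<lambda>n. X (r (s n))) \<longlonglongrightarrow> fst l ** diagm (\<lambda>i. complex_of_real (snd l $ i)) ** adj (fst l)"
      unfolding p(3) q_def[symmetric]
      by (intro tendsto_matrix_mult tendsto_diagm tendsto_adj tendsto_of_real q1 q2)
    ultimately have A': "A = fst l ** diagm (\<lambda>i. complex_of_real (snd l $ i)) ** adj (fst l)"
      by (rule LIMSEQ_unique)
    have "(\<lambda>n. f (snd (q n) $ i)) \<longlonglongrightarrow> f (snd l $ i)" for i
      by (rule continuous_on_tendsto_compose[OF f q2])
         (use p(2) l in \<open>auto simp: q_def mem_box_cart mem_Times_iff\<close>)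
    then have "(\<lambda>n. g (r (s n))) \<longlonglongrightarrow> fst l ** diagm (\<lambda>i. complex_of_real (f (snd l $ i))) ** adj (fst l)"
      unfolding p(4) q_def[symmetric]
      by (intro tendsto_matrix_mult tendsto_diagm tendsto_adj tendsto_of_real q1)
    also have "fst l ** diagm (\<lambda>i. complex_of_real (f (snd l $ i))) ** adj (fst l) = fun_calc (\<lambda>x. complex_of_real (f x)) A"
      unfolding A' by (rule fun_calc_diag[symmetric]) (use l in auto)
    finally have "eventually (\<lambda>n. dist (g (r (s n))) (fun_calc (\<lambda>x. complex_of_real (f x)) A) < e) sequentially"
      using e(1) by (rule tendstoD)
    then show False using r(2) by (auto simp: eventually_sequentially)
  qed
qed

lemma continuous_on_mpow_pos: "p > 0 \<Longrightarrow> continuous_on {M. psd M} (\<lambda>M. mpow M p)"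
proof -
  assume p: "p > 0"
  have "continuous_on {0..} (\<lambda>x::real. x powr p)"
    using p by (intro continuous_on_powr' continuous_intros) auto
  then have "continuous_on {0..} (rpow p)"
    by (rule continuous_on_eq) (simp add: rpow_eq')
  from continuous_on_fun_calc[OF this] show ?thesis by (simp add: mpow_fun_calc[abs_def])
qed

lemma continuous_on_mpow: "\<eta> > 0 \<Longrightarrow> continuous_on {M. psd (M - \<eta> *\<^sub>R mat 1)} (\<lambda>M. mpow M p)"
proof -
  assume e: "\<eta> > 0"
  have "continuous_on {\<eta>..} (\<lambda>x::real. x powr p)"
    using e by (intro continuous_intros) auto
  then have "continuous_on {\<eta>..} (rpow p)"
    by (rule continuous_on_eq) (use e in \<open>simp add: rpow_eq'\<close>)
  from continuous_on_fun_calc[OF this] show ?thesis by (simp add: mpow_fun_calc[abs_def])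
qed

lemma continuous_on_matrix_mult [continuous_intros]:
  fixes A :: "'a::topological_space \<Rightarrow> complex^'n^'m" and B :: "'a \<Rightarrow> complex^'k^'n"
  assumes "continuous_on S A" "continuous_on S B" shows "continuous_on S (\<lambda>x. A x ** B x)"
  using assms unfolding continuous_on_def by (blast intro: tendsto_matrix_mult)

lemma continuous_on_emb [continuous_intros]:
  fixes A :: "'a::topological_space \<Rightarrow> complex^'y^'y"
  assumes "continuous_on S A" shows "continuous_on S (\<lambda>x. emb (A x))"
  unfolding kron_def by (intro continuous_intros assms)

lemma continuous_on_ptrace1 [continuous_intros]:
  fixes A :: "'a::topological_space \<Rightarrow> complex^('x::finite \<times> 'y::finite)^('x \<times> 'y)"
  assumes "continuous_on S A" shows "continuous_on S (\<lambda>x. ptrace1 (A x))"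
  unfolding ptrace1_def by (intro continuous_intros assms)

lemma continuous_on_trace [continuous_intros]:
  fixes A :: "'a::topological_space \<Rightarrow> complex^'y^'y"
  assumes "continuous_on S A" shows "continuous_on S (\<lambda>x. trace (A x))"
  unfolding trace_def by (intro continuous_intros assms)

section \<open>Partial traces of sandwiches and crude spectral bounds\<close>

lemma sum_mat_1_left:
  "(\<Sum>a'\<in>UNIV. \<Sum>j\<in>UNIV. (mat 1 $ a $ a' * g j) * f a' j) = (\<Sum>j\<in>UNIV. g j * (f a j :: complex))"
proof -
  have "(\<Sum>j\<in>UNIV. (mat 1 $ a $ a' * g j) * f a' j) = (if a' = a then (\<Sum>j\<in>UNIV. g j * f a j) else 0)" for a'
    by (simp add: mat_def)
  then show ?thesis by simp
qed

lemma sum_mat_1_right: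
  "(\<Sum>a'\<in>UNIV. \<Sum>j\<in>UNIV. f a' j * (mat 1 $ a' $ a * g j)) = (\<Sum>j\<in>UNIV. (f a j :: complex) * g j)"
proof -
  have "(\<Sum>j\<in>UNIV. f a' j * (mat 1 $ a' $ a * g j)) = (if a' = a then (\<Sum>j\<in>UNIV. f a j * g j) else 0)" for a'
    by (simp add: mat_def)
  then show ?thesis by simp
qed

lemma ptrace1_emb_mult: "ptrace1 (emb A ** X ** emb B) = A ** ptrace1 X ** B"
proof -
  have 1: "ptrace1 (Y ** emb B) = ptrace1 Y ** B" for Y
    unfolding vec_eq_iff
  proof (intro allI)
    fix i j
    have "ptrace1 (Y ** emb B) $ i $ j = (\<Sum>a\<in>UNIV. \<Sum>k\<in>UNIV. Y $ (a, i) $ (a, k) * B $ k $ j)"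
      by (simp add: ptrace1_def matrix_nth_mult sum_prod_UNIV kron_def sum_mat_1_right)
    also have "\<dots> = (\<Sum>k\<in>UNIV. \<Sum>a\<in>UNIV. Y $ (a, i) $ (a, k) * B $ k $ j)" by (rule sum.swap)
    finally show "ptrace1 (Y ** emb B) $ i $ j = (ptrace1 Y ** B) $ i $ j"
      by (simp add: ptrace1_def matrix_nth_mult sum_distrib_right)
  qed
  have 2: "ptrace1 (emb A ** X) = A ** ptrace1 X"
    unfolding vec_eq_iff
  proof (intro allI)
    fix i j
    have "ptrace1 (emb A ** X) $ i $ j = (\<Sum>a\<in>UNIV. \<Sum>k\<in>UNIV. A $ i $ k * X $ (a, k) $ (a, j))"
      by (simp add: ptrace1_def matrix_nth_mult sum_prod_UNIV kron_def sum_mat_1_left)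
    also have "\<dots> = (\<Sum>k\<in>UNIV. \<Sum>a\<in>UNIV. A $ i $ k * X $ (a, k) $ (a, j))" by (rule sum.swap)
    finally show "ptrace1 (emb A ** X) $ i $ j = (A ** ptrace1 X) $ i $ j"
      by (simp add: ptrace1_def matrix_nth_mult sum_distrib_left)
  qed
  show ?thesis by (simp add: 1 2)
qed

text \<open>The scalar bound \<open>d powr q \<le> 1 + d\<close> is crude but sufficient to limit
  the normalisation of the fixed point map in \<open>stationary_density\<close>.\<close>

lemma trace_mpow_le:
  assumes M: "psd (M :: complex^'n^'n)" and q: "0 < q" "q < 1"
  shows "Re (trace (mpow M q)) \<le> real CARD('n) + Re (trace M)"
proof (rule psdE[OF M])
  fix U d assume U: "unitary U" "M = U ** diagm (\<lambda>i. complex_of_real (d i)) ** adj U"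
    "\<And>f. fun_calc f M = U ** diagm (\<lambda>i. f (d i)) ** adj U" "\<And>i. d i \<ge> 0"
  have "d i powr q \<le> 1 + d i" for i
  proof (cases "d i \<le> 1")
    case True
    then have "d i powr q \<le> 1" using U(4)[of i] q by (intro powr_le1) auto
    then show ?thesis using U(4)[of i] by linarith
  next
    case False
    then have "d i powr q \<le> d i powr 1" using q by (intro powr_mono) auto
    then show ?thesis using False by simp
  qed
  then have "(\<Sum>i\<in>UNIV. d i powr q) \<le> (\<Sum>i\<in>UNIV. 1 + d i)" by (rule sum_mono)
  then show ?thesis using U(1,4) by (simp add: mpow_fun_calc U(3) trace_unitary_conj trace_diagm rpow_eq' sum.distrib)
      (simp add: U(2) trace_unitary_conj trace_diagm)
qed

lemma mpow_ge: "psd (M - \<delta> *\<^sub>R mat 1) \<Longrightarrow> \<delta> > 0 \<Longrightarrow> q \<ge> 0 \<Longrightarrow> psd (mpow M q - (\<delta> powr q) *\<^sub>R mat 1)"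
proof -
  assume M: "psd (M - \<delta> *\<^sub>R mat 1)" and \<delta>: "\<delta> > 0" "q \<ge> 0"
  have "pd M" unfolding pd_def using M \<delta> by blast
  then show ?thesis
  proof (rule pdE)
    fix U d assume U: "unitary U" "M = U ** diagm (\<lambda>i. complex_of_real (d i)) ** adj U"
      "\<And>f. fun_calc f M = U ** diagm (\<lambda>i. f (d i)) ** adj U" "\<And>i. d i > 0"
    have "\<delta> \<le> d i" for i by (rule psd_minus_scaleR_eigen[OF U(1,2) M])
    then have "0 \<le> rpow q (d i) - \<delta> powr q" for i using U(4)[of i] \<delta> by (simp add: rpow_eq powr_mono2)
    then show ?thesis unfolding mpow_fun_calc U(3) unitary_diag_minus[OF U(1)] by (rule psd_unitary_diag)
  qed
qed

subsection \<open>A density operator satisfying the stationarity condition\<close>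

text \<open>The equation is the stationarity condition of the minimisation over \<open>\<omega>\<close>, regularised by
  \<open>\<delta>\<close>; Brouwer's theorem gives a solution directly.\<close>

lemma stationary_density:
  fixes R :: "complex^'z^('x::finite \<times> 'y::finite)"
  assumes x: "0 < x" "x < 1" and \<delta>: "\<delta> > 0" and R: "R \<noteq> 0"
  defines "P \<equiv> (\<lambda>\<omega>. adj R ** emb (mpow \<omega> (- x)) ** R)" and "p \<equiv> 1 / (1 - x)"
  defines "\<tau> \<equiv> (\<lambda>\<omega>. (1 / Re (trace (mpow (P \<omega>) p))) *\<^sub>R mpow (P \<omega>) p)"
  obtains \<omega> k where "pd \<omega>" "trace \<omega> = 1" "k > 0" "P \<omega> \<noteq> 0"
    "ptrace1 (R ** mpow (\<tau> \<omega>) x ** adj R) + \<delta> *\<^sub>R mat 1 = k *\<^sub>R mpow \<omega> (1 + x)"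
proof -
  \<comment> \<open>The stationarity equation is solved for \<open>\<omega>\<close> by taking this
    power of its left-hand side.\<close>
  define q where "q = 1 / (1 + x)"
  define n where "n = real CARD('y)"
  have n: "n > 0" by (simp add: n_def)
  have q: "0 < q" "q < 1" using x by (auto simp: q_def)
  have p: "p > 0" using x by (simp add: p_def)
  define M where "M \<omega> = ptrace1 (R ** mpow (\<tau> \<omega>) x ** adj R) + \<delta> *\<^sub>R mat 1" for \<omega>
  define H where "H = schatten (1 / (1 - x)) (adj R ** R)"
  \<comment> \<open>Upper bound for the trace of \<open>mpow (M \<omega>) q\<close>: Hoelder's
    inequality bounds the trace of the marginal by \<open>H\<close>, and the first \<open>n\<close>
    comes from \<open>trace_mpow_le\<close>.\<close>
  define C where "C = n + H + n * \<delta>"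
  have C: "C > 0" using n \<delta> by (simp add: C_def H_def add_pos_nonneg)
  \<comment> \<open>As \<open>M \<omega>\<close> is at least \<open>\<delta>\<close> times the
    identity, the normalised power stays above \<open>\<delta> powr q / C\<close>, so
    \<open>D\<close> is mapped into itself; the bound \<open>1 / n\<close> puts the maximally mixed
    density into \<open>D\<close>.\<close>
  define \<eta> where "\<eta> = min (\<delta> powr q / C) (1 / n)"
  have \<eta>: "\<eta> > 0" using \<delta> C n by (simp add: \<eta>_def)
  define D where "D = {\<omega> :: complex^'y^'y. psd (\<omega> - \<eta> *\<^sub>R mat 1) \<and> trace \<omega> = 1}"
  define \<Phi> where "\<Phi> \<omega> = (1 / Re (trace (mpow (M \<omega>) q))) *\<^sub>R mpow (M \<omega>) q" for \<omega>
  have pd: "pd \<omega>" if "\<omega> \<in> D" for \<omega> using that \<eta> unfolding D_def pd_def by blast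
  have P: "psd (P \<omega>)" "P \<omega> \<noteq> 0" if "\<omega> \<in> D" for \<omega>
  proof -
    show "psd (P \<omega>)" unfolding P_def
      using psd_conj[of "emb (mpow \<omega> (- x))" "adj R"] pd[OF that] by simp
    show "P \<omega> \<noteq> 0"
    proof
      assume z: "P \<omega> = 0"
      define Q where "Q = emb (mpow \<omega> (- x / 2)) ** R"
      have "adj Q ** Q = P \<omega>" using pd[OF that] by (simp add: Q_def P_def adj_mult adj_emb mult_right_assoc emb_mult_left mpow_add)
      then have "(norm Q)\<^sup>2 = 0" by (simp add: norm_sq_trace' z trace_def)
      then have Q0: "Q = 0" by simp
      have "R = emb (mpow \<omega> (x / 2)) ** Q" using pd[OF that] by (simp add: Q_def emb_mult_left mpow_add mpow_0)
      then show False using R unfolding Q0 by (simp add: vec_eq_iff matrix_nth_mult)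
    qed
  qed
  have tp: "Re (trace (mpow (P \<omega>) p)) > 0" if "\<omega> \<in> D" for \<omega> using trace_mpow_pos P[OF that] by blast
  have \<tau>: "psd (\<tau> \<omega>)" "Re (trace (\<tau> \<omega>)) = 1" if "\<omega> \<in> D" for \<omega>
    using P[OF that] tp[OF that] by (simp_all add: \<tau>_def psd_scaleR trace_scaleR)
  have M: "psd (M \<omega> - \<delta> *\<^sub>R mat 1)" "pd (M \<omega>)" "psd (M \<omega>)" if "\<omega> \<in> D" for \<omega>
  proof -
    show "psd (M \<omega> - \<delta> *\<^sub>R mat 1)" using \<tau>[OF that] by (simp add: M_def psd_ptrace1 psd_conj)
    then show "pd (M \<omega>)" unfolding pd_def using \<delta> by blast
    then show "psd (M \<omega>)" by simp
  qed
  have M0: "M \<omega> \<noteq> 0" if "\<omega> \<in> D" for \<omega>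
  proof
    assume "M \<omega> = 0"
    then have "0 \<le> Re (trace ((- \<delta>) *\<^sub>R mat 1 :: complex^'y^'y))" using trace_psd_nonneg[OF M(1)[OF that]] by simp
    then have "0 \<le> - \<delta> * n" by (simp only: trace_scaleR trace_I n_def) simp
    then show False using \<delta> n by (simp add: mult_le_0_iff)
  qed
  have tM: "Re (trace (mpow (M \<omega>) q)) > 0" if "\<omega> \<in> D" for \<omega>
    using trace_mpow_pos M(3) M0 that by blast
  have tM': "Re (trace (mpow (M \<omega>) q)) \<le> C" if "\<omega> \<in> D" for \<omega>
  proof -
    have "trace (R ** mpow (\<tau> \<omega>) x ** adj R) = trace ((adj R ** R) ** mpow (\<tau> \<omega>) x)"
      using trace_mul_sym[of "R ** mpow (\<tau> \<omega>) x" "adj R"] by (simp add: mult_right_assoc)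
    then have "Re (trace (R ** mpow (\<tau> \<omega>) x ** adj R)) \<le> H"
      unfolding H_def using holder_trace[of "adj R ** R" "\<tau> \<omega>" x] \<tau>[OF that] x by simp
    then have "Re (trace (M \<omega>)) \<le> H + n * \<delta>"
      by (simp add: M_def trace_add trace_ptrace1 trace_scaleR trace_I n_def)
    then show ?thesis using trace_mpow_le[OF M(3)[OF that] q] by (simp add: C_def n_def)
  qed
  have "continuous_on D P" unfolding P_def
    by (intro continuous_intros continuous_on_subset[OF continuous_on_mpow[OF \<eta>]]) (auto simp: D_def)
  then have cPp: "continuous_on D (\<lambda>\<omega>. mpow (P \<omega>) p)"
    by (rule continuous_on_compose2[OF continuous_on_mpow_pos[OF p]]) (use P in auto)
  have "continuous_on D \<tau>" unfolding \<tau>_def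
    by (intro continuous_intros cPp) (use tp in force)
  then have "continuous_on D (\<lambda>\<omega>. mpow (\<tau> \<omega>) x)"
    by (rule continuous_on_compose2[OF continuous_on_mpow_pos[OF x(1)]]) (use \<tau> in auto)
  then have "continuous_on D M" unfolding M_def by (intro continuous_intros)
  then have cMq: "continuous_on D (\<lambda>\<omega>. mpow (M \<omega>) q)"
    by (rule continuous_on_compose2[OF continuous_on_mpow_pos[OF q(1)]]) (use M in auto)
  have c: "continuous_on D \<Phi>" unfolding \<Phi>_def
    by (intro continuous_intros cMq) (use tM in force)
  have "\<Phi> \<omega> \<in> D" if "\<omega> \<in> D" for \<omega>
  proof -
    define t where "t = Re (trace (mpow (M \<omega>) q))"
    have t: "t > 0" "t \<le> C" using tM[OF that] tM'[OF that] by (auto simp: t_def)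
    have tc: "trace (mpow (M \<omega>) q) = t" using trace_psd_Im[OF psd_mpow[OF M(3)[OF that]]] by (simp add: t_def complex_eq_iff)
    have "psd ((1 / t) *\<^sub>R (mpow (M \<omega>) q - (\<delta> powr q) *\<^sub>R mat 1) + (\<delta> powr q / t - \<eta>) *\<^sub>R mat 1)"
    proof (intro psd_add psd_scaleR mpow_ge M(1) that \<delta> psd_mat_1)
      have "\<eta> \<le> \<delta> powr q / C" by (simp add: \<eta>_def)
      also have "\<dots> \<le> \<delta> powr q / t" using t by (intro divide_left_mono) auto
      finally show "0 \<le> \<delta> powr q / t - \<eta>" by simp
    qed (use t q in auto)
    then have "psd (\<Phi> \<omega> - \<eta> *\<^sub>R mat 1)" by (simp add: \<Phi>_def t_def[symmetric] algebra_simps)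
    moreover have "trace (\<Phi> \<omega>) = 1"
      using t by (simp add: \<Phi>_def trace_scaleR tc scaleR_conv_of_real[where 'a=complex])
    ultimately show ?thesis by (simp add: D_def)
  qed
  then have im: "\<Phi> ` D \<subseteq> D" by blast
  have conv: "convex D"
  proof (rule convexI)
    fix A B u v assume AB: "A \<in> D" "B \<in> D" and uv: "(0::real) \<le> u" "0 \<le> v" "u + v = 1"
    have "psd (u *\<^sub>R (A - \<eta> *\<^sub>R mat 1) + v *\<^sub>R (B - \<eta> *\<^sub>R mat 1))"
      using AB uv by (intro psd_add psd_scaleR) (auto simp: D_def)
    also have "u *\<^sub>R (A - \<eta> *\<^sub>R mat 1) + v *\<^sub>R (B - \<eta> *\<^sub>R mat 1) = u *\<^sub>R A + v *\<^sub>R B - ((u + v) * \<eta>) *\<^sub>R mat 1"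
      by (simp add: algebra_simps)
    finally have "psd (u *\<^sub>R A + v *\<^sub>R B - \<eta> *\<^sub>R mat 1)" using uv by simp
    moreover have "trace (u *\<^sub>R A + v *\<^sub>R B) = 1"
      using AB uv by (simp add: D_def trace_add trace_scaleR scaleR_add_left[symmetric])
    ultimately show "u *\<^sub>R A + v *\<^sub>R B \<in> D" by (simp add: D_def)
  qed
  have "norm A \<le> 1" if A: "A \<in> D" for A
  proof (rule psdE[OF pd_psd[OF pd[OF A]]])
    fix U d assume U: "unitary U" "A = U ** diagm (\<lambda>i. complex_of_real (d i)) ** adj U"
      "\<And>i. d i \<ge> 0"
    have s: "(\<Sum>i\<in>UNIV. d i) = 1" 
    proof -
      have "trace A = (\<Sum>i\<in>UNIV. complex_of_real (d i))" using U by (simp add: trace_unitary_conj trace_diagm)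
      then show ?thesis using A unfolding D_def by (metis (mono_tags, lifting) mem_Collect_eq of_real_eq_1_iff of_real_sum)
    qed
    have "(norm A)\<^sup>2 = Re (trace (A ** adj A))" by (rule norm_sq_trace)
    also have "\<dots> = (\<Sum>i\<in>UNIV. d i * d i)"
    proof -
      have "A ** adj A = U ** diagm (\<lambda>i. complex_of_real (d i * d i)) ** adj U"
        using U(1) by (simp add: U(2) adj_mult mult_right_assoc) (simp add: matrix_mul_assoc diagm_mult)
      then show ?thesis using U(1) by (simp add: trace_unitary_conj trace_diagm)
    qed
    also have "\<dots> \<le> (\<Sum>i\<in>UNIV. d i * 1)"
    proof (intro sum_mono mult_left_mono U(3))
      show "d i \<le> 1" for i using member_le_sum[of i UNIV d] U(3) s by simp
    qed
    finally show "norm A \<le> 1" using s by (simp add: power2_le_iff_abs_le abs_square_le_1)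
  qed
  then have bd: "bounded D" unfolding bounded_iff by blast
  have clD: "closed D"
  proof -
    have "D = {\<omega>. adj \<omega> = \<omega>} \<inter> (\<Inter>v. {\<omega>. 0 \<le> Re (cinner v ((\<omega> - \<eta> *\<^sub>R mat 1) *v v))}) \<inter> {\<omega>. trace \<omega> = 1}"
      unfolding D_def psd_def by (auto simp: adj_minus adj_scaleR)
    moreover have "closed {\<omega> :: complex^'y^'y. adj \<omega> = \<omega>}"
      unfolding adj_def by (intro closed_Collect_eq continuous_intros)
    moreover have "closed {\<omega> :: complex^'y^'y. trace \<omega> = 1}"
      by (intro closed_Collect_eq continuous_intros)
    moreover have "closed {\<omega> :: complex^'y^'y. 0 \<le> Re (cinner v ((\<omega> - \<eta> *\<^sub>R mat 1) *v v))}" for v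
      unfolding cinner_def matrix_vector_mult_def by (intro closed_Collect_le continuous_intros)
    ultimately show ?thesis by (simp add: closed_Int closed_INT)
  qed
  have "(1 / n) *\<^sub>R mat 1 \<in> D"
  proof -
    have "psd ((1 / n - \<eta>) *\<^sub>R (mat 1 :: complex^'y^'y))" by (intro psd_scaleR) (auto simp: \<eta>_def)
    then show ?thesis by (simp add: D_def scaleR_diff_left trace_scaleR trace_I n_def scaleR_conv_of_real[where 'a=complex])
  qed
  then have ne: "D \<noteq> {}" by blast
  have "compact D" using clD bd by (simp add: compact_eq_bounded_closed)
  then obtain \<omega> where \<omega>: "\<omega> \<in> D" "\<Phi> \<omega> = \<omega>"
    using brouwer[OF _ conv ne c] im by auto
  define t where "t = Re (trace (mpow (M \<omega>) q))"
  have t: "t > 0" using tM[OF \<omega>(1)] by (simp add: t_def)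
  have "mpow \<omega> (1 + x) = mpow ((1 / t) *\<^sub>R mpow (M \<omega>) q) (1 + x)" using \<omega>(2) by (simp add: \<Phi>_def t_def)
  also have "\<dots> = (1 / t) powr (1 + x) *\<^sub>R mpow (M \<omega>) (q * (1 + x))"
    using t M(3)[OF \<omega>(1)] by (simp add: mpow_scaleR mpow_mpow)
  also have "q * (1 + x) = 1" using x by (simp add: q_def)
  also have "mpow (M \<omega>) 1 = M \<omega>" using M(3)[OF \<omega>(1)] by (rule mpow_1)
  finally have "M \<omega> = t powr (1 + x) *\<^sub>R mpow \<omega> (1 + x)" using t by (simp add: powr_divide)
  then show ?thesis
    using that[of \<omega> "t powr (1 + x)"] pd[OF \<omega>(1)] \<omega>(1) P(2)[OF \<omega>(1)] t by (simp add: M_def D_def)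
qed

section \<open>Bounds for removing the regularisation\<close>

lemma powr_add_le: assumes "x \<ge> 0" "y \<ge> 0" "0 < q" "q < 1" shows "(x + y) powr q \<le> x powr q + y powr (q::real)"
proof (cases "x + y = 0")
  case True
  then show ?thesis using assms by simp
next
  case False
  define s where "s = x + y"
  have s: "s > 0" using False assms by (simp add: s_def)
  have *: "z / s \<le> (z / s) powr q" if "0 \<le> z" "z \<le> s" for z
  proof (cases "z = 0")
    case False
    then have "(z / s) powr 1 \<le> (z / s) powr q" using that s assms by (intro powr_mono') auto
    then show ?thesis using that s by simp
  qed simp
  have "1 = x / s + y / s" using s by (simp add: s_def add_divide_distrib[symmetric])
  also have "\<dots> \<le> (x / s) powr q + (y / s) powr q" using *[of x] *[of y] assms by (simp add: s_def)
  also have "\<dots> = (x powr q + y powr q) / s powr q" using s assms by (simp add: powr_divide add_divide_distrib)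
  finally show ?thesis using s by (simp add: s_def field_simps)
qed

lemma trace_mpow_add_le:
  fixes M :: "complex^'n^'n"
  assumes M: "psd M" and q: "0 < q" "q < 1" and \<delta>: "\<delta> \<ge> 0"
  shows "Re (trace (mpow (M + \<delta> *\<^sub>R mat 1) q)) \<le> Re (trace (mpow M q)) + real CARD('n) * \<delta> powr q"
proof (rule psdE[OF M])
  fix U d assume U: "unitary U" "M = U ** diagm (\<lambda>i. complex_of_real (d i)) ** adj U"
    "\<And>f. fun_calc f M = U ** diagm (\<lambda>i. f (d i)) ** adj U" "\<And>i. d i \<ge> 0"
  have "M + \<delta> *\<^sub>R mat 1 = U ** diagm (\<lambda>i. complex_of_real (d i + \<delta>)) ** adj U"
    using unitary_diag_minus[OF U(1), of d "- \<delta>"] by (simp add: U(2))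
  then have "mpow (M + \<delta> *\<^sub>R mat 1) q = U ** diagm (\<lambda>i. complex_of_real (rpow q (d i + \<delta>))) ** adj U"
    unfolding mpow_fun_calc by (simp only: fun_calc_diag[OF U(1)])
  then have "Re (trace (mpow (M + \<delta> *\<^sub>R mat 1) q)) = (\<Sum>i\<in>UNIV. (d i + \<delta>) powr q)"
    using U(1,4) \<delta> by (simp add: trace_unitary_conj trace_diagm rpow_eq')
  also have "\<dots> \<le> (\<Sum>i\<in>UNIV. d i powr q + \<delta> powr q)" using U(4) q \<delta> by (intro sum_mono powr_add_le) auto
  also have "\<dots> = Re (trace (mpow M q)) + real CARD('n) * \<delta> powr q"
    using U(1,4) by (simp add: mpow_fun_calc U(3) trace_unitary_conj trace_diagm rpow_eq' sum.distrib)
  finally show ?thesis .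
qed

text \<open>A multiple of the identity commutes with \<open>M\<close>, so comparing eigenvalues is
  enough, even for exponents beyond the range of operator monotonicity.\<close>

lemma mpow_add_mono:
  fixes M :: "complex^'n^'n"
  assumes M: "psd M" and q: "0 \<le> q" and \<delta>: "\<delta> \<ge> 0"
  shows "psd (mpow (M + \<delta> *\<^sub>R mat 1) q - mpow M q)"
proof (rule psdE[OF M])
  fix U d assume U: "unitary U" "M = U ** diagm (\<lambda>i. complex_of_real (d i)) ** adj U"
    "\<And>f. fun_calc f M = U ** diagm (\<lambda>i. f (d i)) ** adj U" "\<And>i. d i \<ge> 0"
  have "M + \<delta> *\<^sub>R mat 1 = U ** diagm (\<lambda>i. complex_of_real (d i + \<delta>)) ** adj U"
    using unitary_diag_minus[OF U(1), of d "- \<delta>"] by (simp add: U(2))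
  then have "mpow (M + \<delta> *\<^sub>R mat 1) q = U ** diagm (\<lambda>i. complex_of_real (rpow q (d i + \<delta>))) ** adj U"
    unfolding mpow_fun_calc by (simp only: fun_calc_diag[OF U(1)])
  moreover have "diagm (\<lambda>i. complex_of_real (rpow q (d i + \<delta>))) - diagm (\<lambda>i. complex_of_real (rpow q (d i)))
     = diagm (\<lambda>i. complex_of_real (rpow q (d i + \<delta>) - rpow q (d i)))"
    by (simp add: vec_eq_iff diagm_nth)
  ultimately have "mpow (M + \<delta> *\<^sub>R mat 1) q - mpow M q = U ** diagm (\<lambda>i. complex_of_real (rpow q (d i + \<delta>) - rpow q (d i))) ** adj U"
    unfolding mpow_fun_calc U(3) by (simp only: matrix_mult_diff[symmetric] matrix_diff_mult[symmetric])
  moreover have "rpow q (d i) \<le> rpow q (d i + \<delta>)" for i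
    using U(4)[of i] q \<delta> by (simp add: rpow_def powr_mono2)
  ultimately show ?thesis using psd_unitary_diag[of "\<lambda>i. rpow q (d i + \<delta>) - rpow q (d i)" U] by simp
qed

lemma mpow_mat_1 [simp]: "mpow (mat 1) p = mat 1"
proof -
  have "mpow (mat 1) p = fun_calc (\<lambda>x. complex_of_real (rpow p x)) (mat 1 ** diagm (\<lambda>i. complex_of_real 1) ** adj (mat 1))"
    by (simp add: mpow_fun_calc)
  also have "\<dots> = mat 1" by (subst fun_calc_diag) (simp_all add: rpow_def)
  finally show ?thesis .
qed

lemma density_eigen_le_1:
  assumes U: "unitary U" "\<omega> = U ** diagm (\<lambda>i. complex_of_real (d i)) ** adj U" "\<And>i. d i \<ge> 0" "trace \<omega> = 1"
  shows "d i \<le> 1"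
proof -
  have "trace \<omega> = (\<Sum>i\<in>UNIV. complex_of_real (d i))" using U(1) by (simp add: U(2) trace_unitary_conj trace_diagm)
  then have "(\<Sum>i\<in>UNIV. d i) = 1" using U(4) by (metis of_real_eq_1_iff of_real_sum)
  then show ?thesis using member_le_sum[of i UNIV d] U(3) by simp
qed

lemma mpow_minus_ge_1:
  assumes \<omega>: "pd \<omega>" "trace \<omega> = 1" and x: "x \<ge> 0"
  shows "psd (mpow \<omega> (- x) - 1 *\<^sub>R mat 1)"
proof (rule pdE[OF \<omega>(1)])
  fix U d assume U: "unitary U" "\<omega> = U ** diagm (\<lambda>i. complex_of_real (d i)) ** adj U"
    "\<And>f. fun_calc f \<omega> = U ** diagm (\<lambda>i. f (d i)) ** adj U" "\<And>i. d i > 0"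
  have "d i \<le> 1" for i using density_eigen_le_1[OF U(1,2) _ \<omega>(2)] U(4) less_imp_le by blast
  then have "d i powr x \<le> 1" for i using U(4)[of i] x by (intro powr_le1) (auto intro: less_imp_le)
  then have "rpow (- x) (d i) - 1 \<ge> 0" for i
    using U(4)[of i] by (simp add: rpow_eq powr_minus one_le_inverse_iff)
  then show ?thesis unfolding mpow_fun_calc U(3) unitary_diag_minus[OF U(1)] by (rule psd_unitary_diag)
qed

text \<open>For a density, \<open>mpow \<omega> (- x)\<close> is at least the identity, and
  \<open>holder_trace\<close> is tested with the maximally mixed matrix on the auxiliary space.
  Uniformity in \<open>\<omega>\<close> lets \<open>dual_witness\<close> fix \<open>\<delta>\<close>
  before \<open>\<omega>\<close> is known, and keeps the infimum in \<open>is_opt_exists\<close>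
  positive.\<close>

lemma sandwich_lower_bound:
  fixes R :: "complex^'z^('x::finite \<times> 'y::finite)"
  assumes \<omega>: "pd \<omega>" "trace \<omega> = 1" and x: "0 < x" "x < 1"
  shows "(1 / real CARD('z)) powr x * (norm R)\<^sup>2 \<le> schatten (1 / (1 - x)) (adj R ** emb (mpow \<omega> (- x)) ** R)"
proof -
  define P where "P = adj R ** emb (mpow \<omega> (- x)) ** R"
  define \<tau> :: "complex^'z^'z" where "\<tau> = (1 / real CARD('z)) *\<^sub>R mat 1"
  have P: "psd P" unfolding P_def using psd_conj[of "emb (mpow \<omega> (- x))" "adj R"] \<omega> by simp
  have \<tau>: "psd \<tau>" "trace \<tau> = 1"
    by (simp_all add: \<tau>_def psd_scaleR trace_scaleR trace_I scaleR_conv_of_real[where 'a=complex])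
  have "psd (adj R ** emb (mpow \<omega> (- x) - 1 *\<^sub>R mat 1) ** R)"
    using psd_conj[of "emb (mpow \<omega> (- x) - 1 *\<^sub>R mat 1)" "adj R"] mpow_minus_ge_1[OF \<omega>] x by simp
  then have "psd (P - adj R ** R)"
    by (simp add: P_def emb_diff[symmetric] matrix_diff_mult matrix_mult_diff)
  then have "0 \<le> Re (trace (P - adj R ** R))" by (rule trace_psd_nonneg)
  then have "(norm R)\<^sup>2 \<le> Re (trace P)" by (simp add: trace_sub norm_sq_trace')
  then have "(1 / real CARD('z)) powr x * (norm R)\<^sup>2 \<le> (1 / real CARD('z)) powr x * Re (trace P)"
    by (intro mult_left_mono) auto
  also have "\<dots> = Re (trace (P ** mpow \<tau> x))"
    by (simp add: \<tau>_def mpow_scaleR scaleR_mult_right trace_scaleR)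
  also have "\<dots> \<le> schatten (1 / (1 - x)) P" using P \<tau> x by (intro holder_trace) auto
  finally show ?thesis by (simp add: P_def)
qed

text \<open>Three numbers are compared: \<open>h\<close>, the Schatten value at
  \<open>\<omega>\<close>; \<open>m\<close>, the quasi-norm of the marginal \<open>M\<close>; and
  \<open>k\<close> from stationarity. Pairing that equation with \<open>mpow \<omega> (- x)\<close>
  gives \<open>h \<le> k\<close>, taking its power \<open>q\<close> gives
  \<open>k \<le> \<kappa>' * m\<close>, and reverse Hoelder gives \<open>m \<le> h\<close>. The
  matrix \<open>T0\<close>, optimal for \<open>Q ** adj Q\<close>, then has a marginal of at most
  \<open>k / h\<close> times \<open>\<omega>\<close>.\<close>

lemma dual_witness:
  fixes R :: "complex^'z^('x::finite \<times> 'y::finite)"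
  assumes x: "0 < x" "x < 1" and \<kappa>: "\<kappa> > 1" and R: "R \<noteq> 0"
  obtains \<omega> \<tau> T where "pd \<omega>" "trace \<omega> = 1" "psd \<tau>" "trace \<tau> = 1" "pd T" "psd (\<kappa> *\<^sub>R \<omega> - ptrace1 T)"
    "schatten (1 / (1 - x)) (adj R ** emb (mpow \<omega> (- x)) ** R) \<le> (norm (mpow T (x / 2) ** (emb (mpow \<omega> (- x / 2)) ** R)))\<^sup>2"
    "schatten (1 / (1 - x)) (adj R ** emb (mpow \<omega> (- x)) ** R) \<le> \<kappa> * schatten (1 / (1 + x)) (ptrace1 (R ** mpow \<tau> x ** adj R))"
proof -
  define q where "q = 1 / (1 + x)"
  define p where "p = 1 / (1 - x)"
  define n where "n = real CARD('y)"
  define c where "c = (1 / real CARD('z)) powr x * (norm R)\<^sup>2"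
  \<comment> \<open>The tolerance is split: \<open>\<kappa>'\<close> pays for the regularisation,
    the gap up to \<open>\<kappa>\<close> for making \<open>T\<close> positive definite.\<close>
  define \<kappa>' where "\<kappa>' = sqrt \<kappa>"
  have \<kappa>': "\<kappa>' > 1" "\<kappa>' < \<kappa>" using \<kappa> by (simp_all add: \<kappa>'_def real_less_lsqrt power2_eq_square)
  have n: "n > 0" and c: "c > 0" using R by (simp_all add: n_def c_def)
  have q: "0 < q" "q < 1" "q * (1 + x) = 1" using x by (auto simp: q_def)
  have p: "p > 0" "p * (1 - x) = 1" using x by (auto simp: p_def)
  have px: "p * x + 1 = p" using p(2) by (simp add: algebra_simps)
  define g where "g = 1 - \<kappa>' powr (- q)"
  have g: "g > 0" using \<kappa>' q by (simp add: g_def powr_less_one)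
  \<comment> \<open>Solves \<open>n * \<delta> powr q = c powr q * g\<close>. As
    \<open>c \<le> h \<le> k\<close>, the error is at most \<open>k powr q * g\<close>, which leaves
    \<open>k powr q * \<kappa>' powr (- q) \<le> m powr q\<close>.\<close>
  define \<delta> where "\<delta> = (c powr q * g / n) powr (1 / q)"
  have \<delta>: "\<delta> > 0" using c g n by (simp add: \<delta>_def)
  have \<delta>q: "n * \<delta> powr q = c powr q * g" using c g n q by (simp add: \<delta>_def powr_powr)
  define PP where "PP \<omega> = adj R ** emb (mpow \<omega> (- x)) ** R" for \<omega>
  define TT where "TT \<omega> = (1 / Re (trace (mpow (PP \<omega>) p))) *\<^sub>R mpow (PP \<omega>) p" for \<omega>
  obtain \<omega> k where \<omega>: "pd \<omega>" "trace \<omega> = 1" and k: "k > 0" and P0: "PP \<omega> \<noteq> 0"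
    and st: "ptrace1 (R ** mpow (TT \<omega>) x ** adj R) + \<delta> *\<^sub>R mat 1 = k *\<^sub>R mpow \<omega> (1 + x)"
    using stationary_density[OF x \<delta> R] unfolding PP_def TT_def p_def by blast
  define P where "P = PP \<omega>"
  define \<tau> where "\<tau> = TT \<omega>"
  define M where "M = ptrace1 (R ** mpow \<tau> x ** adj R)"
  define h where "h = schatten p P"
  define Q where "Q = emb (mpow \<omega> (- x / 2)) ** R"
  have st: "M + \<delta> *\<^sub>R mat 1 = k *\<^sub>R mpow \<omega> (1 + x)" using st by (simp add: M_def \<tau>_def)
  have PQ: "P = adj Q ** Q"
    using \<omega> by (simp add: P_def PP_def Q_def adj_mult adj_emb mult_right_assoc emb_mult_left mpow_add)
  have P: "psd P" "P \<noteq> 0" using P0 by (simp add: PQ, simp add: P_def)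
  define t where "t = Re (trace (mpow P p))"
  have \<tau>_eq: "\<tau> = (1 / t) *\<^sub>R mpow P p" by (simp add: \<tau>_def TT_def t_def P_def)
  obtain \<tau>' where "psd \<tau>'" "trace \<tau>' = 1" "Re (trace (P ** mpow \<tau>' x)) = h" "\<tau>' = \<tau>"
    unfolding \<tau>_eq h_def t_def p_def by (rule schatten_attained[OF P x])
  then have \<tau>: "psd \<tau>" "trace \<tau> = 1" "Re (trace (P ** mpow \<tau> x)) = h" by auto
  have hc: "c \<le> h" unfolding h_def c_def P_def PP_def p_def by (rule sandwich_lower_bound[OF \<omega> x])
  have h: "h > 0" using hc c by simp
  have M: "psd M" unfolding M_def using \<tau> by (intro psd_ptrace1 psd_conj) auto
  have M\<omega>: "Re (trace (M ** mpow \<omega> (- x))) = h"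
  proof -
    have "trace (M ** mpow \<omega> (- x)) = trace (R ** mpow \<tau> x ** adj R ** emb (mpow \<omega> (- x)))"
      by (simp add: M_def trace_mult_emb)
    also have "\<dots> = trace (P ** mpow \<tau> x)"
      using trace_mul_sym[of "R ** mpow \<tau> x" "adj R ** emb (mpow \<omega> (- x))"]
        trace_mul_sym[of P "mpow \<tau> x"] trace_mul_sym[of "adj R ** emb (mpow \<omega> (- x))" "R ** mpow \<tau> x"]
      by (simp add: mult_right_assoc P_def PP_def)
    finally show ?thesis using \<tau>(3) by simp
  qed
  define m where "m = schatten q M"
  have mh: "m \<le> h" unfolding m_def q_def M\<omega>[symmetric] using M \<omega> x by (intro reverse_holder_trace) auto
  have hk: "h \<le> k"
  proof -
    have "(M + \<delta> *\<^sub>R mat 1) ** mpow \<omega> (- x) = k *\<^sub>R \<omega>"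
      unfolding st using \<omega> by (simp add: scaleR_mult_left mpow_add mpow_1)
    then have "trace ((M + \<delta> *\<^sub>R mat 1) ** mpow \<omega> (- x)) = trace (k *\<^sub>R \<omega>)" by simp
    then have "trace (M ** mpow \<omega> (- x)) + \<delta> *\<^sub>R trace (mpow \<omega> (- x)) = k *\<^sub>R trace \<omega>"
      by (simp only: matrix_add_mult scaleR_mult_left matrix_mul_lid trace_add trace_scaleR)
    then have "Re (trace (M ** mpow \<omega> (- x))) + \<delta> * Re (trace (mpow \<omega> (- x))) = k"
      using \<omega>(2) by (metis Re_complex_of_real mult.right_neutral of_real_1 plus_complex.simps(1) scaleR_complex.simps(1))
    moreover have "0 \<le> \<delta> * Re (trace (mpow \<omega> (- x)))" using \<delta> \<omega> trace_psd_nonneg[of "mpow \<omega> (- x)"] by simp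
    ultimately show ?thesis using M\<omega> by simp
  qed
  have "k powr q = Re (trace (mpow (M + \<delta> *\<^sub>R mat 1) q))"
  proof -
    have "mpow (M + \<delta> *\<^sub>R mat 1) q = k powr q *\<^sub>R \<omega>"
      unfolding st using k \<omega> q(3) by (simp add: mpow_scaleR mpow_mpow mult.commute mpow_1)
    then show ?thesis using \<omega>(2) by (simp add: trace_scaleR)
  qed
  also have "\<dots> \<le> m powr q + n * \<delta> powr q"
    using trace_mpow_add_le[OF M q(1,2), of \<delta>] \<delta> schatten_powr[OF M q(1)] by (simp add: n_def m_def)
  also have "n * \<delta> powr q \<le> k powr q * g"
    unfolding \<delta>q using hc hk c q g by (intro mult_right_mono powr_mono2) auto
  finally have "k powr q * \<kappa>' powr (- q) \<le> m powr q" by (simp add: g_def algebra_simps)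
  then have "(k * inverse \<kappa>') powr q \<le> m powr q"
    using k \<kappa>' by (simp add: powr_mult powr_minus) (simp add: powr_def ln_inverse exp_minus)
  then have "k * inverse \<kappa>' \<le> m"
    using powr_less_mono2[OF q(1), of m "k * inverse \<kappa>'"] by (force simp: m_def)
  then have km: "k \<le> \<kappa>' * m" using \<kappa>' by (simp add: field_simps)
  have r1: "h \<le> \<kappa> * m"
  proof -
    have "h \<le> \<kappa>' * m" using hk km by simp
    also have "\<dots> \<le> \<kappa> * m" using \<kappa>' by (intro mult_right_mono) (auto simp: m_def)
    finally show ?thesis .
  qed
  have kh: "k / h \<le> \<kappa>'"
  proof -
    have "k \<le> \<kappa>' * h" by (rule order_trans[OF km]) (use mh \<kappa>' in simp)
    then show ?thesis using h by (simp add: field_simps)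
  qed
  define S where "S = Q ** adj Q"
  have S: "psd S" "S \<noteq> 0"
  proof -
    have "Re (trace S) = Re (trace P)" unfolding S_def PQ by (subst trace_mul_sym) (rule refl)
    moreover have "Re (trace P) \<noteq> 0" using trace_psd_zero[OF P(1)] P(2) by blast
    ultimately show "S \<noteq> 0" by (auto simp: trace_def)
  qed (simp add: S_def)
  have tS: "Re (trace (mpow S p)) = t" by (simp add: t_def PQ S_def trace_mpow_gram)
  define T0 where "T0 = (1 / t) *\<^sub>R mpow S p"
  obtain T0' where "psd T0'" "Re (trace (S ** mpow T0' x)) = schatten p S" "T0' = T0"
    unfolding T0_def tS[symmetric] p_def by (rule schatten_attained[OF S x])
  then have T0: "psd T0" "Re (trace (S ** mpow T0 x)) = h" by (simp_all add: h_def S_def PQ schatten_gram)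
  have t: "t > 0" unfolding t_def by (rule trace_mpow_pos[OF P])
  \<comment> \<open>\<open>Q\<close> carries powers of \<open>adj Q ** Q\<close> to powers of
    \<open>Q ** adj Q\<close>. The partial trace of the left-hand side is a sandwich of
    \<open>M\<close>, which stationarity expresses through \<open>\<omega>\<close>.\<close>
  have hT: "Q ** mpow \<tau> x ** adj Q = h *\<^sub>R T0"
  proof -
    have e: "(\<lambda>u. complex_of_real (rpow (p * x) u) * complex_of_real u) = (\<lambda>u. complex_of_real (rpow p u))"
    proof
      fix u show "complex_of_real (rpow (p * x) u) * complex_of_real u = complex_of_real (rpow p u)"
        by (subst px[symmetric]) (auto simp: rpow_def powr_add)
    qed
    have "mpow \<tau> x = (1 / t) powr x *\<^sub>R mpow P (p * x)"
      unfolding \<tau>_eq using t P by (simp add: mpow_scaleR mpow_mpow)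
    then have "Q ** mpow \<tau> x ** adj Q = (1 / t) powr x *\<^sub>R (Q ** mpow P (p * x) ** adj Q)"
      by (simp add: scaleR_mult_left scaleR_mult_right)
    also have "Q ** mpow P (p * x) ** adj Q = mpow S p"
      unfolding mpow_fun_calc PQ fun_calc_gram e S_def ..
    also have "(1 / t) powr x *\<^sub>R mpow S p = h *\<^sub>R T0"
    proof -
      have "h = t powr (1 - x)" using p by (simp add: h_def schatten_def t_def p_def)
      then have "(1 / t) powr x = h * (1 / t)" using t by (simp add: powr_divide powr_diff)
      then show ?thesis by (simp add: T0_def)
    qed
    finally show ?thesis .
  qed
  have "ptrace1 (Q ** mpow \<tau> x ** adj Q) = mpow \<omega> (- x / 2) ** M ** mpow \<omega> (- x / 2)"
    unfolding M_def ptrace1_emb_mult[symmetric] using \<omega> by (simp add: Q_def adj_mult adj_emb mult_right_assoc)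
  also have "M = k *\<^sub>R mpow \<omega> (1 + x) - \<delta> *\<^sub>R mat 1" unfolding st[symmetric] by simp
  also have "mpow \<omega> (- x / 2) ** (k *\<^sub>R mpow \<omega> (1 + x) - \<delta> *\<^sub>R mat 1) ** mpow \<omega> (- x / 2) = k *\<^sub>R \<omega> - \<delta> *\<^sub>R mpow \<omega> (- x)"
    using \<omega> by (simp add: matrix_mult_diff matrix_diff_mult scaleR_mult_left scaleR_mult_right mpow_add mpow_1)
  finally have hT': "h *\<^sub>R ptrace1 T0 = k *\<^sub>R \<omega> - \<delta> *\<^sub>R mpow \<omega> (- x)" by (simp add: hT ptrace1_scaleR)
  have "psd (\<kappa>' *\<^sub>R \<omega> - ptrace1 T0)"
  proof -
    have "ptrace1 T0 = (1 / h) *\<^sub>R (h *\<^sub>R ptrace1 T0)" using h by simp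
    then have "\<kappa>' *\<^sub>R \<omega> - ptrace1 T0 = (\<kappa>' - k / h) *\<^sub>R \<omega> + (\<delta> / h) *\<^sub>R mpow \<omega> (- x)"
      unfolding hT' by (simp add: algebra_simps)
    then show ?thesis using \<omega> kh \<delta> h by (auto intro!: psd_add psd_scaleR)
  qed
  obtain e1 where e1: "e1 > 0" "psd (\<omega> - e1 *\<^sub>R mat 1)" using \<omega> by (auto simp: pd_def)
  \<comment> \<open>Tracing out the first system multiplies the shift by \<open>CARD('x)\<close>, so
    the marginal grows by \<open>(\<kappa> - \<kappa>') * e1\<close> times the identity, which lies
    below \<open>(\<kappa> - \<kappa>') *\<^sub>R \<omega>\<close>.\<close>
  define e where "e = (\<kappa> - \<kappa>') * e1 / real CARD('x)"
  have e: "e > 0" using \<kappa>' e1 by (simp add: e_def)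
  define T where "T = T0 + e *\<^sub>R mat 1"
  have T: "pd T" unfolding pd_def T_def using e T0 by (intro exI[of _ e]) simp
  have "psd ((\<kappa>' *\<^sub>R \<omega> - ptrace1 T0) + (\<kappa> - \<kappa>') *\<^sub>R (\<omega> - e1 *\<^sub>R mat 1))"
    using \<open>psd (\<kappa>' *\<^sub>R \<omega> - ptrace1 T0)\<close> e1 \<kappa>' by (intro psd_add psd_scaleR) auto
  also have "(\<kappa>' *\<^sub>R \<omega> - ptrace1 T0) + (\<kappa> - \<kappa>') *\<^sub>R (\<omega> - e1 *\<^sub>R mat 1) = \<kappa> *\<^sub>R \<omega> - ptrace1 T"
  proof -
    have "ptrace1 T = ptrace1 T0 + ((\<kappa> - \<kappa>') * e1) *\<^sub>R mat 1"
      by (simp add: T_def ptrace1_add ptrace1_scaleR ptrace1_mat_1 e_def)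
    then show ?thesis by (simp add: algebra_simps)
  qed
  finally have T1: "psd (\<kappa> *\<^sub>R \<omega> - ptrace1 T)" .
  have "h \<le> (norm (mpow T (x / 2) ** Q))\<^sup>2"
  proof -
    have "h = Re (trace (mpow T0 x ** S))" using T0(2) trace_mul_sym[of S "mpow T0 x"] by simp
    also have "\<dots> \<le> Re (trace (mpow T x ** S))"
      unfolding T_def using T0 x e S by (intro trace_mult_mono mpow_add_mono) auto
    also have "\<dots> = (norm (mpow T (x / 2) ** Q))\<^sup>2"
      using T by (simp add: norm_mpow_mult_sq S_def)
    finally show ?thesis .
  qed
  then show ?thesis
    using that[OF \<omega> \<tau>(1,2) T T1] r1 by (simp add: h_def P_def PP_def p_def m_def M_def q_def Q_def)
qed

subsection \<open>The optimised quantity behind the conditional entropy\<close>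

text \<open>With \<open>a = (\<alpha> - 1) / \<alpha>\<close>, i.e. \<open>\<alpha> = 1 / (1 - a)\<close>, the divergence is \<open>ln (opt_val a \<rho> \<omega>) / a\<close>, and the
  conditional entropy is \<open>- ln N / a\<close>, where \<open>N\<close> is the infimum (\<open>a > 0\<close>) or the supremum (\<open>a < 0\<close>)
  of \<open>opt_val a \<rho>\<close>.\<close>

definition opt_val :: "real \<Rightarrow> complex^('x::finite \<times> 'y::finite)^('x \<times> 'y) \<Rightarrow> complex^'y^'y \<Rightarrow> real" where
  "opt_val a \<rho> \<omega> = schatten (1 / (1 - a)) (emb (mpow \<omega> (- a / 2)) ** \<rho> ** emb (mpow \<omega> (- a / 2)))"

definition is_opt :: "real \<Rightarrow> complex^('x::finite \<times> 'y::finite)^('x \<times> 'y) \<Rightarrow> real \<Rightarrow> bool" where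
  "is_opt a \<rho> N \<longleftrightarrow> N > 0 \<and> (if a > 0
     then (\<forall>\<omega>. pd \<omega> \<and> trace \<omega> = 1 \<longrightarrow> N \<le> opt_val a \<rho> \<omega>) \<and> (\<forall>\<kappa>>1. \<exists>\<omega>. pd \<omega> \<and> trace \<omega> = 1 \<and> opt_val a \<rho> \<omega> \<le> \<kappa> * N)
     else (\<forall>\<omega>. pd \<omega> \<and> trace \<omega> = 1 \<longrightarrow> opt_val a \<rho> \<omega> \<le> N) \<and> (\<forall>\<kappa>>1. \<exists>\<omega>. pd \<omega> \<and> trace \<omega> = 1 \<and> N \<le> \<kappa> * opt_val a \<rho> \<omega>))"

text \<open>Passing to the other Gram matrix moves the Schatten value to the auxiliary space, where
  \<open>\<omega>\<close> enters through a single power; norm estimates and duality use this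
  form.\<close>

lemma opt_val_gram:
  assumes "psd \<omega>" shows "opt_val a (R ** adj R) \<omega> = schatten (1 / (1 - a)) (adj R ** emb (mpow \<omega> (- a)) ** R)"
proof -
  define Q where "Q = emb (mpow \<omega> (- a / 2)) ** R"
  have "Q ** adj Q = emb (mpow \<omega> (- a / 2)) ** (R ** adj R) ** emb (mpow \<omega> (- a / 2))"
    using assms by (simp add: Q_def adj_mult adj_emb mult_right_assoc)
  moreover have "adj Q ** Q = adj R ** emb (mpow \<omega> (- a)) ** R"
    using assms by (simp add: Q_def adj_mult adj_emb mult_right_assoc emb_mult_left mpow_add)
  ultimately show ?thesis unfolding opt_val_def by (metis schatten_gram)
qed

lemma psd_gram: assumes "psd \<rho>" obtains R :: "complex^'n^'n" where "\<rho> = R ** adj R"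
proof -
  obtain K where "\<rho> = adj K ** K" "herm K" by (rule psd_square_root[OF assms])
  then show ?thesis using that[of "adj K"] by simp
qed

text \<open>For \<open>a > 0\<close> the values are bounded below by
  \<open>sandwich_lower_bound\<close>. For \<open>a < 0\<close> they are bounded above by testing
  \<open>reverse_holder_trace\<close> with the maximally mixed matrix, since
  \<open>mpow \<omega> x\<close> is at most the identity.\<close>

lemma is_opt_exists:
  fixes \<rho> :: "complex^('x::finite \<times> 'y::finite)^('x \<times> 'y)"
  assumes \<rho>: "psd \<rho>" "\<rho> \<noteq> 0" and a: "- 1 < a" "a < 1" "a \<noteq> 0"
  obtains N where "is_opt a \<rho> N"
proof -
  obtain R :: "complex^('x \<times> 'y)^('x \<times> 'y)" where R: "\<rho> = R ** adj R" using psd_gram[OF \<rho>(1)] by blast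
  have R0: "R \<noteq> 0"
  proof
    assume R0: "R = 0"
    have "\<rho> = 0" unfolding R R0 by (simp add: vec_eq_iff matrix_nth_mult)
    then show False using \<rho>(2) by simp
  qed
  define D where "D = {\<omega> :: complex^'y^'y. pd \<omega> \<and> trace \<omega> = 1}"
  define u :: "complex^'y^'y" where "u = (1 / real CARD('y)) *\<^sub>R mat 1"
  have u: "u \<in> D" by (simp add: D_def u_def pd_scaleR trace_scaleR trace_I scaleR_conv_of_real[where 'a=complex])
  show ?thesis
  proof (cases "a > 0")
    case True
    define c where "c = (1 / real CARD('x \<times> 'y)) powr a * (norm R)\<^sup>2"
    have c: "c > 0" using R0 by (simp add: c_def)
    have lo: "c \<le> opt_val a \<rho> \<omega>" if "\<omega> \<in> D" for \<omega>
      unfolding c_def R using that sandwich_lower_bound[of \<omega> a R] True a by (simp add: opt_val_gram D_def)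
    define N where "N = (INF \<omega>\<in>D. opt_val a \<rho> \<omega>)"
    have bd: "bdd_below (opt_val a \<rho> ` D)" using lo by (intro bdd_belowI[of _ c]) auto
    have "c \<le> N" unfolding N_def using u lo by (intro cINF_greatest) auto
    then have N: "N > 0" using c by simp
    have 1: "N \<le> opt_val a \<rho> \<omega>" if "\<omega> \<in> D" for \<omega> unfolding N_def using bd that by (rule cINF_lower)
    have 2: "\<exists>\<omega>\<in>D. opt_val a \<rho> \<omega> \<le> \<kappa> * N" if "\<kappa> > 1" for \<kappa>
    proof -
      have "N < \<kappa> * N" using N that by simp
      then show ?thesis using cINF_less_iff[of D "opt_val a \<rho>" "\<kappa> * N"] bd u unfolding N_def by (auto intro: less_imp_le)
    qed
    show ?thesis using that[of N] N 1 2 True by (auto simp: is_opt_def D_def)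
  next
    case False
    define x where "x = - a"
    have x: "0 < x" "x < 1" using False a by (auto simp: x_def)
    have up: "opt_val a \<rho> \<omega> \<le> (1 / real CARD('x \<times> 'y)) powr (- x) * Re (trace \<rho>)" if "\<omega> \<in> D" for \<omega>
    proof -
      have \<omega>: "pd \<omega>" "trace \<omega> = 1" using that by (auto simp: D_def)
      define v :: "complex^('x \<times> 'y)^('x \<times> 'y)" where "v = (1 / real CARD('x \<times> 'y)) *\<^sub>R mat 1"
      define P where "P = emb (mpow \<omega> (x / 2)) ** \<rho> ** emb (mpow \<omega> (x / 2))"
      have P: "psd P" using psd_conj[OF \<rho>(1), of "emb (mpow \<omega> (x / 2))"] \<omega> by (simp add: P_def adj_emb)
      have v: "pd v" "trace v = 1" by (simp_all add: v_def pd_scaleR trace_scaleR trace_I scaleR_conv_of_real[where 'a=complex])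
      have "opt_val a \<rho> \<omega> \<le> Re (trace (P ** mpow v (- x)))"
        using reverse_holder_trace[OF P v(1) _ x(1)] v(2) by (simp add: opt_val_def P_def x_def)
      also have "\<dots> = (1 / real CARD('x \<times> 'y)) powr (- x) * Re (trace P)"
        by (simp add: v_def mpow_scaleR scaleR_mult_right trace_scaleR)
      also have "Re (trace P) \<le> Re (trace \<rho>)"
      proof -
        have "trace P = trace (\<rho> ** emb (mpow \<omega> x))"
          using trace_mul_sym[of "emb (mpow \<omega> (x / 2)) ** \<rho>" "emb (mpow \<omega> (x / 2))"] \<omega>
            trace_mul_sym[of "emb (mpow \<omega> x)" \<rho>]
          by (simp add: P_def mult_right_assoc emb_mult_left mpow_add)
        also have "Re (trace (\<rho> ** emb (mpow \<omega> x))) = Re (trace (emb (mpow \<omega> x) ** \<rho>))" by (subst trace_mul_sym) (rule refl)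
        also have "\<dots> \<le> Re (trace (emb (mat 1 :: complex^'y^'y) ** \<rho>))"
        proof (rule trace_mult_mono[OF _ \<rho>(1)])
          have "psd (mat 1 - mpow \<omega> x)"
          proof (rule pdE[OF \<omega>(1)])
            fix U d assume U: "unitary U" "\<omega> = U ** diagm (\<lambda>i. complex_of_real (d i)) ** adj U"
              "\<And>f. fun_calc f \<omega> = U ** diagm (\<lambda>i. f (d i)) ** adj U" "\<And>i. d i > 0"
            have "d i \<le> 1" for i using density_eigen_le_1[OF U(1,2) _ \<omega>(2)] U(4) less_imp_le by blast
            then have r: "0 \<le> 1 - rpow x (d i)" for i using U(4)[of i] x by (simp add: rpow_eq powr_le1 less_imp_le)
            have "mat 1 - mpow \<omega> x = U ** (mat 1 - diagm (\<lambda>i. complex_of_real (rpow x (d i)))) ** adj U"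
              unfolding mpow_fun_calc U(3) using U(1) by (simp add: matrix_mult_diff matrix_diff_mult)
            also have "mat 1 - diagm (\<lambda>i. complex_of_real (rpow x (d i))) = diagm (\<lambda>i. complex_of_real (1 - rpow x (d i)))"
              by (simp add: vec_eq_iff diagm_nth mat_def)
            finally show ?thesis using psd_unitary_diag[OF r, of U] by simp
          qed
          then show "psd (emb (mat 1 :: complex^'y^'y) - emb (mpow \<omega> x) :: complex^('x \<times> 'y)^('x \<times> 'y))"
            unfolding emb_diff by simp
        qed
        finally show ?thesis by simp
      qed
      finally show ?thesis by (simp add: mult_left_mono)
    qed
    define N where "N = (SUP \<omega>\<in>D. opt_val a \<rho> \<omega>)"
    have bd: "bdd_above (opt_val a \<rho> ` D)" using up by (intro bdd_aboveI[of _ "(1 / real CARD('x \<times> 'y)) powr (- x) * Re (trace \<rho>)"]) auto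
    have 1: "opt_val a \<rho> \<omega> \<le> N" if "\<omega> \<in> D" for \<omega> unfolding N_def using that bd by (rule cSUP_upper)
    have "opt_val a \<rho> u > 0"
    proof -
      have "mpow u (- a / 2) = ((1 / real CARD('y)) powr (- a / 2)) *\<^sub>R mat 1" by (simp add: u_def mpow_scaleR)
      then have "emb (mpow u (- a / 2)) ** \<rho> ** emb (mpow u (- a / 2))
          = ((1 / real CARD('y)) powr (- a / 2) * (1 / real CARD('y)) powr (- a / 2)) *\<^sub>R \<rho>"
        by (simp add: emb_scaleR scaleR_mult_left scaleR_mult_right)
      then show ?thesis unfolding opt_val_def using \<rho> by (intro schatten_pos) (auto intro: psd_scaleR)
    qed
    then have N: "N > 0" using 1[OF u] by simp
    have 2: "\<exists>\<omega>\<in>D. N \<le> \<kappa> * opt_val a \<rho> \<omega>" if "\<kappa> > 1" for \<kappa>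
    proof -
      have "N / \<kappa> < N" using N that by (simp add: field_simps)
      then have "\<exists>\<omega>\<in>D. N / \<kappa> < opt_val a \<rho> \<omega>"
        using less_cSUP_iff[of D "opt_val a \<rho>" "N / \<kappa>"] bd u unfolding N_def by auto
      then show ?thesis using that by (auto simp: field_simps intro: less_imp_le)
    qed
    show ?thesis using that[of N] N 1 2 False by (auto simp: is_opt_def D_def)
  qed
qed

text \<open>For negative \<open>a\<close>, adding \<open>t\<close> times the identity to
  \<open>\<omega>\<close> can only raise the value, and dividing by the new trace
  \<open>\<kappa>\<close> costs \<open>\<kappa> powr x \<le> \<kappa>\<close>.\<close>

lemma opt_val_neg_approx:
  fixes \<rho> :: "complex^('x::finite \<times> 'y::finite)^('x \<times> 'y)"
  assumes \<rho>: "psd \<rho>" and \<omega>: "psd \<omega>" "trace \<omega> = 1" and a: "- 1 < a" "a < 0" and \<kappa>: "\<kappa> > 1"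
  obtains \<omega>' where "pd \<omega>'" "trace \<omega>' = 1" "opt_val a \<rho> \<omega> \<le> \<kappa> * opt_val a \<rho> \<omega>'"
proof -
  define x where "x = - a"
  have x: "0 < x" "x < 1" using a by (auto simp: x_def)
  obtain R :: "complex^('x \<times> 'y)^('x \<times> 'y)" where R: "\<rho> = R ** adj R" using psd_gram[OF \<rho>(1)] by blast
  define n where "n = real CARD('y)"
  define t where "t = (\<kappa> - 1) / n"
  have n: "n > 0" by (simp add: n_def)
  have t: "t > 0" "1 + t * n = \<kappa>" using \<kappa> n by (auto simp: t_def)
  define W where "W = \<omega> + t *\<^sub>R mat 1"
  have W: "pd W" unfolding pd_def W_def using t \<omega> by (intro exI[of _ t]) simp
  define \<omega>' where "\<omega>' = (1 / \<kappa>) *\<^sub>R W"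
  have \<omega>': "pd \<omega>'" using W \<kappa> by (simp add: \<omega>'_def pd_scaleR)
  have "trace W = complex_of_real \<kappa>"
    using t \<omega>(2) by (simp add: W_def trace_add trace_scaleR trace_I n_def scaleR_conv_of_real[where 'a=complex]) (metis of_real_1 of_real_add of_real_mult of_real_of_nat_eq)
  then have tr: "trace \<omega>' = 1" using \<kappa> by (simp add: \<omega>'_def trace_scaleR scaleR_conv_of_real[where 'a=complex])
  have "opt_val a \<rho> \<omega> = schatten (1 / (1 + x)) (adj R ** emb (mpow \<omega> x) ** R)" unfolding R using \<omega> by (simp add: opt_val_gram x_def)
  also have "\<dots> \<le> schatten (1 / (1 + x)) (adj R ** emb (mpow W x) ** R)"
  proof (rule schatten_mono[OF _ _ x(1)])
    show "psd (adj R ** emb (mpow \<omega> x) ** R)" using psd_conj[of "emb (mpow \<omega> x)" "adj R"] \<omega> by simp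
    have "psd (emb (mpow W x) - emb (mpow \<omega> x) :: complex^('x \<times> 'y)^('x \<times> 'y))"
      unfolding emb_diff W_def using \<omega> x t by (intro psd_emb mpow_add_mono) auto
    from psd_conj_mono[OF this, of "adj R"]
    show "psd (adj R ** emb (mpow W x) ** R - adj R ** emb (mpow \<omega> x) ** R)" by simp
  qed
  also have "\<dots> = opt_val a \<rho> W" unfolding R using W by (simp add: opt_val_gram x_def)
  also have "W = \<kappa> *\<^sub>R \<omega>'" using \<kappa> by (simp add: \<omega>'_def)
  also have "opt_val a \<rho> (\<kappa> *\<^sub>R \<omega>') = \<kappa> powr x * opt_val a \<rho> \<omega>'"
  proof -
    have p: "psd (adj R ** emb (mpow \<omega>' x) ** R)" using psd_conj[of "emb (mpow \<omega>' x)" "adj R"] \<omega>' by simp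
    have "opt_val a \<rho> (\<kappa> *\<^sub>R \<omega>') = schatten (1 / (1 + x)) (\<kappa> powr x *\<^sub>R (adj R ** emb (mpow \<omega>' x) ** R))"
      unfolding R using \<omega>' \<kappa> by (simp add: opt_val_gram x_def psd_scaleR mpow_scaleR emb_scaleR scaleR_mult_left scaleR_mult_right)
    also have "\<dots> = \<kappa> powr x * schatten (1 / (1 + x)) (adj R ** emb (mpow \<omega>' x) ** R)"
      using p \<kappa> x trace_psd_nonneg[OF psd_mpow[OF p]] unfolding schatten_def
      by (simp add: mpow_scaleR trace_scaleR powr_mult powr_powr)
    finally show ?thesis unfolding R using \<omega>' by (simp add: opt_val_gram x_def)
  qed
  also have "\<dots> \<le> \<kappa> * opt_val a \<rho> \<omega>'"
  proof -
    have "\<kappa> powr x \<le> \<kappa> powr 1" using \<kappa> x by (intro powr_mono) auto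
    then show ?thesis using \<kappa> by (intro mult_right_mono) (auto simp: opt_val_def)
  qed
  finally show ?thesis using that \<omega>' tr by blast
qed

text \<open>Only the zero eigenvalues of \<open>\<omega>\<close> are raised, so its negative power
  is unchanged on the support, and the support condition hides the rest from \<open>\<rho>\<close>.
  Normalisation by the trace \<open>s \<le> \<kappa>\<close> costs
  \<open>s powr a \<le> \<kappa>\<close>.\<close>

lemma opt_val_pos_approx:
  fixes \<rho> :: "complex^('x::finite \<times> 'y::finite)^('x \<times> 'y)"
  assumes \<rho>: "psd \<rho>" and \<omega>: "psd \<omega>" "trace \<omega> = 1" and a: "0 < a" "a < 1" and \<kappa>: "\<kappa> > 1"
    and supp: "supp \<rho> \<subseteq> supp (emb \<omega> :: complex^('x \<times> 'y)^('x \<times> 'y))"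
  obtains \<omega>' where "pd \<omega>'" "trace \<omega>' = 1" "opt_val a \<rho> \<omega>' \<le> \<kappa> * opt_val a \<rho> \<omega>"
proof (rule psdE[OF \<omega>(1)])
  fix U d assume U: "unitary U" "\<omega> = U ** diagm (\<lambda>i. complex_of_real (d i)) ** adj U"
    "\<And>f. fun_calc f \<omega> = U ** diagm (\<lambda>i. f (d i)) ** adj U" "\<And>i. d i \<ge> 0"
  define n where "n = real CARD('y)"
  define t where "t = (\<kappa> - 1) / n"
  have n: "n > 0" by (simp add: n_def)
  have t: "t > 0" "1 + t * n = \<kappa>" using \<kappa> n by (auto simp: t_def)
  define e where "e i = (if d i > 0 then d i else t)" for i
  have e: "e i > 0" for i using t by (simp add: e_def)
  define W where "W = U ** diagm (\<lambda>i. complex_of_real (e i)) ** adj U"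
  define s where "s = (\<Sum>i\<in>UNIV. e i)"
  have s0: "s > 0" unfolding s_def using e by (intro sum_pos) auto
  have W: "pd W" unfolding W_def by (rule pd_unitary_diag[OF U(1) e])
  have tW: "trace W = complex_of_real s" by (simp add: W_def trace_unitary_conj[OF U(1)] trace_diagm s_def)
  have s: "s \<le> \<kappa>"
  proof -
    have "trace \<omega> = (\<Sum>i\<in>UNIV. complex_of_real (d i))" using U(1) by (simp add: U(2) trace_unitary_conj trace_diagm)
    then have "(\<Sum>i\<in>UNIV. d i) = 1" using \<omega>(2) by (metis of_real_eq_1_iff of_real_sum)
    moreover have "s \<le> (\<Sum>i\<in>UNIV. d i + t)" unfolding s_def using U(4) t by (intro sum_mono) (auto simp: e_def)
    ultimately show ?thesis using t by (simp add: sum.distrib n_def mult.commute)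
  qed
  define \<omega>' where "\<omega>' = (1 / s) *\<^sub>R W"
  have \<omega>': "pd \<omega>'" using W s0 by (simp add: \<omega>'_def pd_scaleR)
  have tr: "trace \<omega>' = 1" using s0 tW by (simp add: \<omega>'_def trace_scaleR scaleR_conv_of_real[where 'a=complex])
  define Pr where "Pr = fun_calc (\<lambda>x. if x > 0 then 1 else 0) \<omega>"
  define S where "S = mpow \<omega> (- a / 2)"
  define S' where "S' = mpow W (- a / 2)"
  have S': "S' = U ** diagm (\<lambda>i. complex_of_real (rpow (- a / 2) (e i))) ** adj U"
    unfolding S'_def W_def mpow_fun_calc by (rule fun_calc_diag[OF U(1)])
  have Pr_\<omega>: "Pr ** \<omega> = \<omega>"
  proof -
    have "Pr ** fun_calc complex_of_real \<omega> = fun_calc (\<lambda>x. (if x > 0 then 1 else 0) * complex_of_real x) \<omega>"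
      unfolding Pr_def by (rule fun_calc_mult) (use \<omega> in simp)
    also have "\<dots> = fun_calc complex_of_real \<omega>" using \<omega>(1) by (rule fun_calc_cong) auto
    finally show ?thesis using \<omega> by simp
  qed
  have Pr: "adj Pr = Pr" unfolding Pr_def using \<omega> by (simp add: adj_fun_calc if_distrib[of cnj] cong: if_cong)
  have S_Pr: "S' ** Pr = S"
  proof -
    have "complex_of_real (rpow (- a / 2) (e i)) * (if d i > 0 then 1 else 0) = complex_of_real (rpow (- a / 2) (d i))" for i
      by (simp add: e_def rpow_def)
    then have "diagm (\<lambda>i. complex_of_real (rpow (- a / 2) (e i))) ** diagm (\<lambda>i. if d i > 0 then 1 else 0)
        = diagm (\<lambda>i. complex_of_real (rpow (- a / 2) (d i)))"
      unfolding diagm_mult by presburger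
    then show ?thesis
      unfolding S' Pr_def S_def mpow_fun_calc U(3) using U(1) by (simp add: mult_right_assoc) (simp add: matrix_mul_assoc)
  qed
  have Pr_S: "Pr ** S' = S"
    using arg_cong[OF S_Pr, of adj] Pr W \<omega> by (simp add: adj_mult S'_def S_def)
  have Pr_\<rho>: "emb Pr ** \<rho> = \<rho>"
  proof -
    have "(emb Pr ** \<rho>) *v v = \<rho> *v v" for v
    proof -
      have "\<rho> *v v \<in> supp (emb \<omega>)" using supp by (auto simp: supp_def)
      then obtain w where w: "\<rho> *v v = emb \<omega> *v w" by (auto simp: supp_def)
      have "(emb Pr ** \<rho>) *v v = emb Pr *v (emb \<omega> *v w)" by (simp add: matrix_vector_mul_assoc[symmetric] w)
      also have "\<dots> = emb \<omega> *v w" by (simp add: matrix_vector_mul_assoc emb_mult Pr_\<omega>)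
      finally show ?thesis by (simp add: w)
    qed
    then show ?thesis by (simp add: matrix_eq)
  qed
  have \<rho>_Pr: "\<rho> ** emb Pr = \<rho>"
    using arg_cong[OF Pr_\<rho>, of adj] \<rho> Pr by (simp add: adj_mult adj_emb psd_def)
  have "emb S' ** \<rho> ** emb S' = emb S' ** (emb Pr ** \<rho> ** emb Pr) ** emb S'" by (simp add: Pr_\<rho> \<rho>_Pr)
  also have "\<dots> = emb S ** \<rho> ** emb S" by (simp add: mult_right_assoc emb_mult_left emb_mult S_Pr Pr_S)
  finally have v: "opt_val a \<rho> W = opt_val a \<rho> \<omega>" by (simp add: opt_val_def S_def S'_def)
  obtain R :: "complex^('x \<times> 'y)^('x \<times> 'y)" where R: "\<rho> = R ** adj R" using psd_gram[OF \<rho>(1)] by blast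
  have "opt_val a \<rho> \<omega>' = (1 / s) powr (- a) * opt_val a \<rho> W"
  proof -
    have p: "psd (adj R ** emb (mpow W (- a)) ** R)" using psd_conj[of "emb (mpow W (- a))" "adj R"] W by simp
    have "opt_val a \<rho> \<omega>' = schatten (1 / (1 - a)) ((1 / s) powr (- a) *\<^sub>R (adj R ** emb (mpow W (- a)) ** R))"
      unfolding R \<omega>'_def using W s0 by (simp add: opt_val_gram psd_scaleR mpow_scaleR emb_scaleR scaleR_mult_left scaleR_mult_right)
    also have "\<dots> = (1 / s) powr (- a) * schatten (1 / (1 - a)) (adj R ** emb (mpow W (- a)) ** R)"
      using p s0 a trace_psd_nonneg[OF psd_mpow[OF p]] unfolding schatten_def
      by (simp add: mpow_scaleR trace_scaleR powr_mult powr_powr)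
    finally show ?thesis unfolding R using W by (simp add: opt_val_gram)
  qed
  also have "(1 / s) powr (- a) = s powr a" using s0 by (simp add: powr_minus powr_divide)
  also have "s powr a * opt_val a \<rho> W \<le> \<kappa> * opt_val a \<rho> W"
  proof -
    have "s powr a \<le> \<kappa> powr a" using s s0 a by (intro powr_mono2) auto
    also have "\<dots> \<le> \<kappa> powr 1" using \<kappa> a by (intro powr_mono) auto
    finally show ?thesis using \<kappa> by (intro mult_right_mono) (auto simp: opt_val_def)
  qed
  finally show ?thesis using that \<omega>' tr v by simp
qed

lemma le_if_le_mult_gt_1:
  fixes x y :: real assumes "\<And>\<kappa>. \<kappa> > 1 \<Longrightarrow> x \<le> \<kappa> * y" "y \<ge> 0" shows "x \<le> y"
proof (rule ccontr)
  assume "\<not> x \<le> y"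
  then have "x > y" by simp
  show False
  proof (cases "y = 0")
    case True
    then show False using assms(1)[of 2] \<open>x > y\<close> by simp
  next
    case False
    then have y: "y > 0" using assms(2) by simp
    have "(1 + x / y) / 2 > 1" using \<open>x > y\<close> y by (simp add: field_simps)
    from assms(1)[OF this] show False using \<open>x > y\<close> y by (simp add: field_simps)
  qed
qed

text \<open>The two approximation lemmas reduce the infimum to positive definite densities. Infinite
  values are harmless: a vanishing value gives \<infinity> for \<open>a < 0\<close>, and for
  \<open>a > 0\<close> under the support condition it cannot occur because
  \<open>N > 0\<close>.\<close>

theorem cond_renyi_is_opt:
  fixes \<rho> :: "complex^('x::finite \<times> 'y::finite)^('x \<times> 'y)"
  assumes \<rho>: "density \<rho>" and a: "- 1 < a" "a < 1" "a \<noteq> 0" and \<alpha>: "\<alpha> = 1 / (1 - a)" and N: "is_opt a \<rho> N"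
  shows "cond_renyi \<alpha> \<rho> = ereal (- ln N / a)"
proof -
  have \<rho>p: "psd \<rho>" "trace \<rho> = 1" using \<rho> by (auto simp: density_def)
  have N0: "N > 0" using N by (simp add: is_opt_def)
  have aa: "(\<alpha> - 1) / \<alpha> = a" "\<alpha> > 0" "\<alpha> - 1 = a * \<alpha>" "\<alpha> > 1 \<longleftrightarrow> a > 0" "\<alpha> < 1 \<longleftrightarrow> a < 0"
    using a by (auto simp: \<alpha> field_simps)
  define E where "E \<omega> = (emb \<omega> :: complex^('x \<times> 'y)^('x \<times> 'y))" for \<omega>
  define D where "D \<omega> = renyi_div \<alpha> \<rho> (E \<omega>)" for \<omega>
  have D: "D \<omega> = (if a > 0 \<and> \<not> supp \<rho> \<subseteq> supp (E \<omega>) then \<infinity>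
      else if opt_val a \<rho> \<omega> = 0 then (if a < 0 then \<infinity> else -\<infinity>) else ereal (ln (opt_val a \<rho> \<omega>) / a))" if "psd \<omega>" for \<omega>
  proof -
    define P where "P = emb (mpow \<omega> (- a / 2)) ** \<rho> ** emb (mpow \<omega> (- a / 2))"
    have P: "psd P" using psd_conj[OF \<rho>p(1), of "emb (mpow \<omega> (- a / 2))"] that by (simp add: P_def adj_emb)
    define Q where "Q = Re (trace (mpow P \<alpha>))"
    have Q: "Q \<ge> 0" using trace_psd_nonneg[OF psd_mpow[OF P]] by (simp add: Q_def)
    have v: "opt_val a \<rho> \<omega> = Q powr (1 / \<alpha>)" by (simp add: opt_val_def schatten_def Q_def P_def \<alpha>)
    have v0: "opt_val a \<rho> \<omega> = 0 \<longleftrightarrow> Q = 0" using aa by (simp add: v)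
    have vl: "ln Q / (\<alpha> - 1) = ln (opt_val a \<rho> \<omega>) / a" if "Q \<noteq> 0"
      using that Q aa a by (simp add: v ln_powr field_simps)
    show ?thesis
      unfolding D_def renyi_div_def Let_def aa(1) E_def mpow_emb[OF psd_herm[OF that]] \<rho>p(2)
        P_def[symmetric] Q_def[symmetric]
      using v0 vl aa(4,5) by simp
  qed
  have pos: "opt_val a \<rho> \<omega> > 0" if "pd \<omega>" for \<omega>
  proof -
    define S where "S = mpow \<omega> (- a / 2)"
    define S' where "S' = mpow \<omega> (a / 2)"
    have SS: "S' ** S = mat 1" "S ** S' = mat 1" using that by (simp_all add: S_def S'_def mpow_add mpow_0)
    have "emb S ** \<rho> ** emb S \<noteq> 0"
    proof
      assume z: "emb S ** \<rho> ** emb S = 0"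
      have "\<rho> = emb S' ** (emb S ** \<rho> ** emb S) ** emb S'"
        using SS by (simp add: mult_right_assoc emb_mult_left emb_mult)
      then have "\<rho> = 0" unfolding z by (simp add: vec_eq_iff matrix_nth_mult)
      then show False using \<rho>p(2) by (simp add: trace_def)
    qed
    moreover have "psd (emb S ** \<rho> ** emb S)"
      using psd_conj[OF \<rho>p(1), of "emb S"] that by (simp add: S_def adj_emb)
    ultimately show ?thesis unfolding opt_val_def S_def by (intro schatten_pos) auto
  qed
  have suppd: "supp \<rho> \<subseteq> supp (E \<omega>)" if "pd \<omega>" for \<omega>
  proof
    fix v assume "v \<in> supp \<rho>"
    have "E \<omega> ** emb (mpow \<omega> (- 1)) = emb (mpow \<omega> 1 ** mpow \<omega> (- 1))" using that by (simp add: E_def emb_mult mpow_1)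
    also have "\<dots> = mat 1" using that by (simp add: mpow_add mpow_0)
    finally have "v = E \<omega> *v (emb (mpow \<omega> (- 1)) *v v)" by (simp add: matrix_vector_mul_assoc)
    then show "v \<in> supp (E \<omega>)" unfolding supp_def by blast
  qed
  have Dpd: "D \<omega> = ereal (ln (opt_val a \<rho> \<omega>) / a)" if "pd \<omega>" for \<omega>
    using D[of \<omega>] suppd[OF that] pos[OF that] that by simp
  have "(INF \<omega>\<in>{\<omega>. density \<omega>}. D \<omega>) = ereal (ln N / a)"
  proof (rule antisym)
    show "ereal (ln N / a) \<le> (INF \<omega>\<in>{\<omega>. density \<omega>}. D \<omega>)"
    proof (rule INF_greatest)
      fix \<omega> :: "complex^'y^'y" assume "\<omega> \<in> {\<omega>. density \<omega>}"
      then have \<omega>: "psd \<omega>" "trace \<omega> = 1" by (auto simp: density_def)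
      show "ereal (ln N / a) \<le> D \<omega>"
      proof (cases "a > 0")
        case True
        show ?thesis
        proof (cases "supp \<rho> \<subseteq> supp (E \<omega>)")
          case False
          then show ?thesis using D[OF \<omega>(1)] True by simp
        next
          case supp: True
          have "N \<le> opt_val a \<rho> \<omega>"
          proof (rule le_if_le_mult_gt_1)
            fix \<kappa> :: real assume "\<kappa> > 1"
            then obtain \<omega>' where "pd \<omega>'" "trace \<omega>' = 1" "opt_val a \<rho> \<omega>' \<le> \<kappa> * opt_val a \<rho> \<omega>"
              using opt_val_pos_approx[OF \<rho>p(1) \<omega> True a(2) _ supp[unfolded E_def]] by blast
            moreover have "N \<le> opt_val a \<rho> \<omega>'" using calculation N True by (auto simp: is_opt_def)
            ultimately show "N \<le> \<kappa> * opt_val a \<rho> \<omega>" by simp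
          qed (simp add: opt_val_def)
          then show ?thesis using D[OF \<omega>(1)] supp True N0 by (simp add: divide_right_mono)
        qed
      next
        case False
        then have a0: "a < 0" using a by simp
        have "opt_val a \<rho> \<omega> \<le> N"
        proof (rule le_if_le_mult_gt_1)
          fix \<kappa> :: real assume k: "\<kappa> > 1"
          then obtain \<omega>' where *: "pd \<omega>'" "trace \<omega>' = 1" "opt_val a \<rho> \<omega> \<le> \<kappa> * opt_val a \<rho> \<omega>'"
            using opt_val_neg_approx[OF \<rho>p(1) \<omega> a(1) a0] by blast
          have "opt_val a \<rho> \<omega>' \<le> N" using * N False by (auto simp: is_opt_def)
          then have "\<kappa> * opt_val a \<rho> \<omega>' \<le> \<kappa> * N" using k by (intro mult_left_mono) auto
          then show "opt_val a \<rho> \<omega> \<le> \<kappa> * N" using *(3) by simp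
        qed (use N0 in simp)
        moreover have "opt_val a \<rho> \<omega> \<ge> 0" by (simp add: opt_val_def)
        ultimately show ?thesis using D[OF \<omega>(1)] a0 N0 by (auto simp: divide_right_mono_neg)
      qed
    qed
    show "(INF \<omega>\<in>{\<omega>. density \<omega>}. D \<omega>) \<le> ereal (ln N / a)"
    proof (rule ereal_le_epsilon2)
      fix e :: real assume e: "e > 0"
      \<comment> \<open>Then \<open>ln \<kappa> / \<bar>a\<bar> = e\<close>, the additive tolerance
        after taking logarithms.\<close>
      define \<kappa> where "\<kappa> = exp (e * \<bar>a\<bar>)"
      have \<kappa>: "\<kappa> > 1" using e a by (simp add: \<kappa>_def)
      have "\<exists>\<omega>. pd \<omega> \<and> trace \<omega> = 1 \<and> ln (opt_val a \<rho> \<omega>) / a \<le> ln N / a + e"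
      proof (cases "a > 0")
        case True
        then obtain \<omega> where \<omega>: "pd \<omega>" "trace \<omega> = 1" "opt_val a \<rho> \<omega> \<le> \<kappa> * N" using N \<kappa> by (auto simp: is_opt_def)
        have "ln (opt_val a \<rho> \<omega>) \<le> ln (\<kappa> * N)" using \<omega>(3) pos[OF \<omega>(1)] by simp
        also have "\<dots> = e * a + ln N" using N0 True by (simp add: \<kappa>_def ln_mult)
        finally show ?thesis using \<omega> True by (intro exI[of _ \<omega>]) (simp add: field_simps)
      next
        case False
        then obtain \<omega> where \<omega>: "pd \<omega>" "trace \<omega> = 1" "N \<le> \<kappa> * opt_val a \<rho> \<omega>" using N \<kappa> by (auto simp: is_opt_def)
        have "ln N \<le> ln (\<kappa> * opt_val a \<rho> \<omega>)" using \<omega>(3) N0 by simp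
        also have "\<dots> = - e * a + ln (opt_val a \<rho> \<omega>)" using pos[OF \<omega>(1)] False by (simp add: \<kappa>_def ln_mult)
        finally show ?thesis using \<omega> False a by (intro exI[of _ \<omega>]) (simp add: field_simps)
      qed
      then obtain \<omega> where \<omega>: "pd \<omega>" "trace \<omega> = 1" "ln (opt_val a \<rho> \<omega>) / a \<le> ln N / a + e" by blast
      have "(INF \<omega>\<in>{\<omega>. density \<omega>}. D \<omega>) \<le> D \<omega>" using \<omega> by (intro INF_lower) (auto simp: density_def)
      also have "\<dots> \<le> ereal (ln N / a) + ereal e" using Dpd[OF \<omega>(1)] \<omega>(3) by simp
      finally show "(INF \<omega>\<in>{\<omega>. density \<omega>}. D \<omega>) \<le> ereal (ln N / a) + ereal e" .
    qed
  qed
  then show ?thesis by (simp add: cond_renyi_def D_def E_def)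
qed

subsection \<open>Duality for pure states\<close>

lemma transpose_nth: "transpose M $ i $ j = M $ j $ i"
  by (simp add: transpose_def)

lemma adj_transpose: "adj (transpose M) = transpose (adj M)"
  by (simp add: vec_eq_iff transpose_nth)

lemma transpose_unitary_diag:
  "transpose (U ** diagm f ** adj U) = transpose (adj U) ** diagm f ** adj (transpose (adj U))"
proof -
  have "transpose (diagm f) = diagm f" by (auto simp: vec_eq_iff transpose_nth diagm_nth)
  then show ?thesis by (simp add: matrix_transpose_mul adj_transpose mult_right_assoc)
qed

lemma unitary_transpose: "unitary U \<Longrightarrow> unitary (transpose U)"
proof -
  assume U: "unitary U"
  have "transpose (mat 1) = (mat 1 :: complex^'a^'a)" by (auto simp: vec_eq_iff transpose_nth mat_def)
  then show ?thesis using U unfolding unitary_def adj_transpose matrix_transpose_mul[symmetric] by simp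
qed

lemma fun_calc_transpose: assumes "herm M" shows "fun_calc f (transpose M) = transpose (fun_calc f M)"
proof (rule hermE[OF assms])
  fix U d assume U: "unitary U" "M = U ** diagm (\<lambda>i. complex_of_real (d i)) ** adj U"
    "\<And>f. fun_calc f M = U ** diagm (\<lambda>i. f (d i)) ** adj U"
  have "unitary (transpose (adj U))" using U(1) by (simp add: unitary_transpose)
  then show ?thesis unfolding U(3) unfolding U(2) transpose_unitary_diag by (rule fun_calc_diag)
qed

lemma trace_transpose_complex: "trace (transpose M) = trace M"
  by (simp add: trace_def transpose_nth)

lemma mpow_transpose: "herm M \<Longrightarrow> mpow (transpose M) p = transpose (mpow M p)"
  by (simp add: mpow_fun_calc fun_calc_transpose)

lemma schatten_transpose: "herm M \<Longrightarrow> schatten p (transpose M) = schatten p M"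
  by (simp add: schatten_def mpow_transpose trace_transpose_complex)

lemma psd_transpose: assumes "psd M" shows "psd (transpose M)"
  using assms by (rule psdE) (metis psd_unitary_diag transpose_unitary_diag)

lemma pd_transpose: assumes "pd M" shows "pd (transpose M)"
  using assms by (rule pdE) (metis pd_unitary_diag transpose_unitary_diag unitary_transpose unitary_adj)

lemma trace_ptrace1_sandwich:
  "trace (ptrace1 (R ** K ** adj R) ** W) = trace ((adj R ** emb W ** R) ** K)"
  using trace_mult_emb[of "R ** K ** adj R" W] trace_mul_sym[of R "K ** adj R ** emb W"]
    trace_mul_sym[of K "adj R ** emb W ** R"] by (simp add: mult_right_assoc)

text \<open>\<open>R\<close> and \<open>R2\<close> are the same tripartite vector, grouped as
  \<open>(x, y)\<close> against \<open>z\<close> and as \<open>(u, z)\<close> against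
  \<open>y\<close>; \<open>\<pi>\<close> only relabels the system that is traced out. Exchanging row
  and column roles of the indices produces the transposes.\<close>

lemma gram_swap:
  fixes R :: "complex^'z^('x::finite \<times> 'y::finite)" and R2 :: "complex^'y^('u::finite \<times> 'z::finite)"
  assumes \<pi>: "bij \<pi>" and R2: "\<And>u z y. R2 $ (u, z) $ y = R $ (\<pi> u, y) $ z"
  shows "adj R2 ** emb K ** R2 = transpose (ptrace1 (R ** transpose K ** adj R))"
  unfolding vec_eq_iff
proof (intro allI)
  fix y y'
  have "(emb K ** R2) $ (u, z) $ y' = (\<Sum>z'\<in>UNIV. K $ z $ z' * R2 $ (u, z') $ y')" for u z
    unfolding matrix_nth_mult sum_prod_UNIV kron_def by (simp add: sum_mat_1_left)
  then have "(adj R2 ** emb K ** R2) $ y $ y' = (\<Sum>u\<in>UNIV. \<Sum>z\<in>UNIV. cnj (R2 $ (u, z) $ y) * (\<Sum>z'\<in>UNIV. K $ z $ z' * R2 $ (u, z') $ y'))"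
    unfolding mult_right_assoc matrix_nth_mult[of "adj R2"] by (simp add: sum_prod_UNIV)
  also have "\<dots> = (\<Sum>x\<in>UNIV. \<Sum>z\<in>UNIV. cnj (R $ (x, y) $ z) * (\<Sum>z'\<in>UNIV. K $ z $ z' * R $ (x, y') $ z'))"
    unfolding R2 by (rule sum.reindex_bij_betw[OF \<pi>])
  also have "\<dots> = transpose (ptrace1 (R ** transpose K ** adj R)) $ y $ y'"
    unfolding transpose_nth ptrace1_def
    by (simp add: matrix_nth_mult transpose_nth sum_distrib_left sum_distrib_right mult_ac)
  finally show "(adj R2 ** emb K ** R2) $ y $ y' = transpose (ptrace1 (R ** transpose K ** adj R)) $ y $ y'" .
qed

text \<open>The trace of \<open>adj R ** emb (mpow \<omega> (- x)) ** R\<close> against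
  \<open>mpow \<tau> x\<close> lies above the dual value by reverse Hoelder and below the primal one
  by Hoelder. \<open>dual_witness\<close> closes the gap up to a factor, in place of a minimax
  theorem.\<close>

lemma is_opt_dual_pos:
  fixes R :: "complex^'z^('x::finite \<times> 'y::finite)" and R2 :: "complex^'y^('u::finite \<times> 'z::finite)"
  assumes \<pi>: "bij \<pi>" and R2: "\<And>u z y. R2 $ (u, z) $ y = R $ (\<pi> u, y) $ z"
    and x: "0 < x" "x < 1" and N: "is_opt x (R ** adj R) N" and R: "R \<noteq> 0"
  shows "is_opt (- x) (R2 ** adj R2) N"
proof -
  have N0: "N > 0" using N by (simp add: is_opt_def)
  have rv: "opt_val (- x) (R2 ** adj R2) (transpose \<tau>) = schatten (1 / (1 + x)) (ptrace1 (R ** mpow \<tau> x ** adj R))"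
    if "psd \<tau>" for \<tau>
  proof -
    have "psd (ptrace1 (R ** mpow \<tau> x ** adj R))" using that by (intro psd_ptrace1 psd_conj) auto
    moreover have "transpose (transpose \<tau>) = \<tau>" by (simp add: vec_eq_iff transpose_nth)
    ultimately show ?thesis using that psd_transpose[OF that]
      by (simp add: opt_val_gram gram_swap[OF \<pi> R2] mpow_transpose[symmetric] schatten_transpose)
  qed
  have up: "opt_val (- x) (R2 ** adj R2) \<tau> \<le> N" if \<tau>: "pd \<tau>" "trace \<tau> = 1" for \<tau>
  proof (rule le_if_le_mult_gt_1)
    fix \<kappa> :: real assume "\<kappa> > 1"
    then obtain \<omega> where \<omega>: "pd \<omega>" "trace \<omega> = 1" "opt_val x (R ** adj R) \<omega> \<le> \<kappa> * N"
      using N x by (auto simp: is_opt_def)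
    define \<tau>' where "\<tau>' = transpose \<tau>"
    have \<tau>': "pd \<tau>'" "trace \<tau>' = 1" using \<tau> by (simp_all add: \<tau>'_def pd_transpose trace_transpose_complex)
    have "\<tau> = transpose \<tau>'" by (simp add: \<tau>'_def vec_eq_iff transpose_nth)
    then have "opt_val (- x) (R2 ** adj R2) \<tau> = schatten (1 / (1 + x)) (ptrace1 (R ** mpow \<tau>' x ** adj R))"
      using rv[of \<tau>'] \<tau>' by simp
    also have "\<dots> \<le> Re (trace (ptrace1 (R ** mpow \<tau>' x ** adj R) ** mpow \<omega> (- x)))"
      using \<tau>' \<omega> x by (intro reverse_holder_trace psd_ptrace1 psd_conj) auto
    also have "\<dots> = Re (trace ((adj R ** emb (mpow \<omega> (- x)) ** R) ** mpow \<tau>' x))"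
      by (simp only: trace_ptrace1_sandwich)
    also have "\<dots> \<le> schatten (1 / (1 - x)) (adj R ** emb (mpow \<omega> (- x)) ** R)"
      using psd_conj[of "emb (mpow \<omega> (- x))" "adj R"] \<omega> \<tau>' x by (intro holder_trace) auto
    also have "\<dots> = opt_val x (R ** adj R) \<omega>" using \<omega> by (simp add: opt_val_gram)
    finally show "opt_val (- x) (R2 ** adj R2) \<tau> \<le> \<kappa> * N" using \<omega>(3) by simp
  qed (use N0 in simp)
  have lo: "\<exists>\<tau>. pd \<tau> \<and> trace \<tau> = 1 \<and> N \<le> \<kappa> * opt_val (- x) (R2 ** adj R2) \<tau>" if \<kappa>: "\<kappa> > 1" for \<kappa>
  proof -
    \<comment> \<open>One factor \<open>sqrt \<kappa>\<close> is spent on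
      \<open>dual_witness\<close>, the other on replacing its possibly singular
      \<open>\<tau>\<close> by a positive definite density.\<close>
    have k: "sqrt \<kappa> > 1" "sqrt \<kappa> * sqrt \<kappa> = \<kappa>" using \<kappa> by auto
    obtain \<omega> \<tau> where \<omega>: "pd \<omega>" "trace \<omega> = 1" and \<tau>: "psd \<tau>" "trace \<tau> = 1"
      and h: "schatten (1 / (1 - x)) (adj R ** emb (mpow \<omega> (- x)) ** R) \<le> sqrt \<kappa> * schatten (1 / (1 + x)) (ptrace1 (R ** mpow \<tau> x ** adj R))"
      by (rule dual_witness[OF x k(1) R]) 
    have "N \<le> opt_val x (R ** adj R) \<omega>" using N x \<omega> by (auto simp: is_opt_def)
    also have "\<dots> \<le> sqrt \<kappa> * opt_val (- x) (R2 ** adj R2) (transpose \<tau>)"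
      using h \<omega> \<tau> by (simp add: opt_val_gram rv)
    finally have 1: "N \<le> sqrt \<kappa> * opt_val (- x) (R2 ** adj R2) (transpose \<tau>)" .
    obtain \<tau>' where \<tau>': "pd \<tau>'" "trace \<tau>' = 1"
      "opt_val (- x) (R2 ** adj R2) (transpose \<tau>) \<le> sqrt \<kappa> * opt_val (- x) (R2 ** adj R2) \<tau>'"
      using opt_val_neg_approx[OF psd_mult_adj psd_transpose[OF \<tau>(1)] _ _ _ k(1), of "- x" R2] \<tau>(2) x
      by (auto simp: trace_transpose_complex)
    have "sqrt \<kappa> * opt_val (- x) (R2 ** adj R2) (transpose \<tau>) \<le> sqrt \<kappa> * (sqrt \<kappa> * opt_val (- x) (R2 ** adj R2) \<tau>')"
      using \<tau>'(3) \<kappa> by (intro mult_left_mono) auto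
    also have "\<dots> = \<kappa> * opt_val (- x) (R2 ** adj R2) \<tau>'" using k(2) by (simp add: mult.assoc[symmetric])
    finally show ?thesis using \<tau>' 1 by (intro exI[of _ \<tau>']) simp
  qed
  show ?thesis using N0 x up lo by (auto simp: is_opt_def)
qed

lemma is_opt_unique: assumes "is_opt a \<rho> N" "is_opt a \<rho> N'" shows "N = N'"
proof -
  have "N \<le> N'" if N: "is_opt a \<rho> N" and N': "is_opt a \<rho> N'" for N N'
  proof (rule le_if_le_mult_gt_1)
    show "N' \<ge> 0" using N' by (simp add: is_opt_def)
    fix \<kappa> :: real assume \<kappa>: "\<kappa> > 1"
    show "N \<le> \<kappa> * N'"
    proof (cases "a > 0")
      case True
      then obtain \<omega> where "pd \<omega>" "trace \<omega> = 1" "opt_val a \<rho> \<omega> \<le> \<kappa> * N'" using N' \<kappa> by (auto simp: is_opt_def)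
      moreover have "N \<le> opt_val a \<rho> \<omega>" using calculation N True by (auto simp: is_opt_def)
      ultimately show ?thesis by simp
    next
      case False
      then obtain \<omega> where \<omega>: "pd \<omega>" "trace \<omega> = 1" "N \<le> \<kappa> * opt_val a \<rho> \<omega>" using N \<kappa> by (auto simp: is_opt_def)
      have "opt_val a \<rho> \<omega> \<le> N'" using \<omega> N' False by (auto simp: is_opt_def)
      then have "\<kappa> * opt_val a \<rho> \<omega> \<le> \<kappa> * N'" using \<kappa> by (intro mult_left_mono) auto
      then show ?thesis using \<omega>(3) by simp
    qed
  qed
  then show ?thesis using assms by (intro antisym) auto
qed

text \<open>For negative \<open>a\<close> the dual problem has an optimum at \<open>- a > 0\<close>;
  dualising it back with \<open>inv \<pi>\<close> gives an optimum of the original problem, and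
  uniqueness identifies the two.\<close>

lemma is_opt_dual:
  fixes R :: "complex^'z^('x::finite \<times> 'y::finite)" and R2 :: "complex^'y^('u::finite \<times> 'z::finite)"
  assumes \<pi>: "bij \<pi>" and R2: "\<And>u z y. R2 $ (u, z) $ y = R $ (\<pi> u, y) $ z"
    and a: "- 1 < a" "a < 1" "a \<noteq> 0" and N: "is_opt a (R ** adj R) N" and R: "R \<noteq> 0"
  shows "is_opt (- a) (R2 ** adj R2) N"
proof (cases "a > 0")
  case True
  then show ?thesis using is_opt_dual_pos[OF \<pi> R2 _ a(2) N R] by simp
next
  case False
  have i: "bij (inv \<pi>)" "\<pi> (inv \<pi> x) = x" for x using \<pi> by (auto simp: bij_imp_bij_inv bij_is_surj surj_f_inv_f)
  have R': "R $ (x, y) $ z = R2 $ (inv \<pi> x, z) $ y" for x y z by (simp add: R2 i)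
  have "R2 \<noteq> 0"
  proof
    assume "R2 = 0"
    then have "R $ p $ z = 0" for p z using R'[of "fst p" "snd p" z] by simp
    then show False using R by (simp add: vec_eq_iff)
  qed
  then have nz: "R2 ** adj R2 \<noteq> 0"
    using norm_sq_trace[of R2] by (auto simp: trace_def)
  obtain N' where N': "is_opt (- a) (R2 ** adj R2) N'"
    using is_opt_exists[OF psd_mult_adj nz, of "- a"] a by auto
  have "is_opt (- (- a)) (R ** adj R) N'"
    using is_opt_dual_pos[OF i(1) R' _ _ N' \<open>R2 \<noteq> 0\<close>] False a by simp
  then have "N' = N" using is_opt_unique N by simp
  then show ?thesis using N' by simp
qed

subsection \<open>Regrouping of the subsystems\<close>

text \<open>The permutation matrix of the reassociation. Its row and column types differ, so
  \<open>unitary\<close> cannot be stated for it and the cancellation rules are given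
  separately.\<close>

definition regroup_perm :: "complex^('a::finite \<times> 'b::finite \<times> 'c::finite)^(('a \<times> 'b) \<times> 'c)" where
  "regroup_perm = (\<chi> p q. if q = (fst (fst p), snd (fst p), snd p) then 1 else 0)"

lemma regroup_perm_mult_nth: "(regroup_perm ** M) $ p $ j = M $ (fst (fst p), snd (fst p), snd p) $ j"
  by (simp add: matrix_nth_mult regroup_perm_def if_distrib[where f = "\<lambda>x. x * _"] cong: if_cong)

lemma mult_regroup_perm_nth: "((M :: complex^(('a::finite \<times> 'b::finite) \<times> 'c::finite)^'k) ** regroup_perm) $ i $ q = M $ i $ ((fst q, fst (snd q)), snd (snd q))"
proof -
  have "(M ** regroup_perm) $ i $ q = (\<Sum>p\<in>UNIV. if p = ((fst q, fst (snd q)), snd (snd q)) then M $ i $ p else 0)"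
    unfolding matrix_nth_mult regroup_perm_def by (intro sum.cong refl) (auto simp: prod_eq_iff)
  then show ?thesis by simp
qed

lemma regroup_perm_nth: "regroup_perm $ p $ q = (if q = (fst (fst p), snd (fst p), snd p) then 1 else 0)"
  by (simp add: regroup_perm_def)

lemma mult_adj_regroup_perm_nth: "(M ** adj regroup_perm) $ i $ q = M $ i $ (fst (fst q), snd (fst q), snd q)"
  by (simp add: matrix_nth_mult regroup_perm_nth if_distrib[where f = "\<lambda>x. _ * x"] if_distrib[where f = cnj] cong: if_cong)

lemma adj_regroup_perm_mult_nth: "(adj regroup_perm ** M) $ q $ j = M $ ((fst q, fst (snd q)), snd (snd q)) $ j"
proof -
  have "adj regroup_perm ** M = adj (adj M ** regroup_perm)" by (simp add: adj_mult)
  then show ?thesis by (simp add: mult_regroup_perm_nth)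
qed

lemma adj_regroup_perm_mult: "adj regroup_perm ** regroup_perm = mat 1"
  unfolding vec_eq_iff mult_regroup_perm_nth by (auto simp: regroup_perm_nth mat_def prod_eq_iff)

lemma regroup_perm_mult_adj: "regroup_perm ** adj regroup_perm = mat 1"
  unfolding vec_eq_iff regroup_perm_mult_nth by (auto simp: regroup_perm_nth mat_def prod_eq_iff)

lemma regroup_perm_cancel: "adj regroup_perm ** (regroup_perm ** X) = X" "regroup_perm ** (adj regroup_perm ** Y) = Y"
  by (simp_all add: matrix_mul_assoc adj_regroup_perm_mult regroup_perm_mult_adj)

lemma regroup_regroup_perm: "regroup M = regroup_perm ** M ** adj regroup_perm"
  unfolding vec_eq_iff mult_adj_regroup_perm_nth regroup_perm_mult_nth by (simp add: regroup_def)

lemma emb_regroup_perm: "emb W ** regroup_perm = regroup_perm ** emb (emb W)"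
  by (auto simp: vec_eq_iff regroup_perm_mult_nth mult_regroup_perm_nth kron_def mat_def)

lemma regroup_gram: "regroup (R ** adj R) = (regroup_perm ** R) ** adj (regroup_perm ** R)"
  by (simp add: regroup_regroup_perm adj_mult mult_right_assoc)

lemma opt_val_regroup:
  assumes "psd \<omega>"
  shows "opt_val a (regroup (R ** adj R)) \<omega> = schatten (1 / (1 - a)) (adj R ** emb (emb (mpow \<omega> (- a))) ** R)"
proof -
  have "emb W ** (regroup_perm ** R) = regroup_perm ** (emb (emb W) ** R)" for W
    by (simp add: matrix_mul_assoc emb_regroup_perm)
  then have "adj (regroup_perm ** R) ** emb W ** (regroup_perm ** R) = adj R ** emb (emb W) ** R" for W
    by (simp add: adj_mult mult_right_assoc regroup_perm_cancel)
  then show ?thesis using assms by (simp only: regroup_gram opt_val_gram)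
qed

lemma mpow_regroup_perm: assumes "herm T" shows "mpow (adj regroup_perm ** T ** regroup_perm) p = adj regroup_perm ** mpow T p ** regroup_perm"
proof -
  have "herm (adj regroup_perm ** T ** regroup_perm)" using assms by (simp add: herm_def adj_mult mult_right_assoc)
  then have "mpow (adj regroup_perm ** T ** regroup_perm) p ** adj regroup_perm = adj regroup_perm ** mpow T p"
    unfolding mpow_fun_calc by (intro fun_calc_intertwine assms) (simp_all add: mult_right_assoc regroup_perm_mult_adj)
  from arg_cong[OF this, of "\<lambda>X. X ** regroup_perm"] show ?thesis
    by (simp add: mult_right_assoc adj_regroup_perm_mult)
qed

lemma norm_adj_regroup_perm_mult: "norm (adj regroup_perm ** X) = norm X"
  by (rule power2_eq_imp_eq) (simp_all add: norm_sq_trace' adj_mult mult_right_assoc regroup_perm_cancel)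

lemma ptrace1_regroup_perm: "ptrace1 (ptrace1 (adj regroup_perm ** T ** regroup_perm)) = ptrace1 T"
proof -
  have "(adj regroup_perm ** T ** regroup_perm) $ (a, b, i) $ (a', b', j) = T $ ((a, b), i) $ ((a', b'), j)" for a b i a' b' j
    by (simp add: mult_regroup_perm_nth adj_regroup_perm_mult_nth)
  then have "ptrace1 (ptrace1 (adj regroup_perm ** T ** regroup_perm)) $ i $ j = ptrace1 T $ i $ j" for i j
    by (simp add: ptrace1_def sum_prod_UNIV) (rule sum.swap)
  then show ?thesis by (simp add: vec_eq_iff)
qed

lemma pd_regroup_perm: assumes "pd T" shows "pd (adj regroup_perm ** T ** regroup_perm)"
proof -
  obtain e where e: "e > 0" "psd (T - e *\<^sub>R mat 1)" using assms by (auto simp: pd_def)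
  have "psd (adj regroup_perm ** (T - e *\<^sub>R mat 1) ** adj (adj regroup_perm))" by (rule psd_conj[OF e(2)])
  then show ?thesis unfolding pd_def using e(1)
    by (intro exI[of _ e]) (simp add: matrix_mult_diff matrix_diff_mult scaleR_mult_left scaleR_mult_right adj_regroup_perm_mult)
qed

subsection \<open>The chain rules\<close>

lemma norm_regroup_perm_mult: "norm (regroup_perm ** X) = norm X"
  by (rule power2_eq_imp_eq) (simp_all add: norm_sq_trace' adj_mult mult_right_assoc regroup_perm_cancel)

lemma is_optD_pos_approx: 
  "is_opt a \<rho> N \<Longrightarrow> a > 0 \<Longrightarrow> \<kappa> > 1 \<Longrightarrow> \<exists>\<omega>. pd \<omega> \<and> trace \<omega> = 1 \<and> opt_val a \<rho> \<omega> \<le> \<kappa> * N"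
  and is_optD_pos: "is_opt a \<rho> N \<Longrightarrow> a > 0 \<Longrightarrow> pd \<omega> \<Longrightarrow> trace \<omega> = 1 \<Longrightarrow> N \<le> opt_val a \<rho> \<omega>"
  and is_optD_neg_approx:
  "is_opt a \<rho> N \<Longrightarrow> a < 0 \<Longrightarrow> \<kappa> > 1 \<Longrightarrow> \<exists>\<omega>. pd \<omega> \<and> trace \<omega> = 1 \<and> N \<le> \<kappa> * opt_val a \<rho> \<omega>"
  and is_optD_neg: "is_opt a \<rho> N \<Longrightarrow> a < 0 \<Longrightarrow> pd \<omega> \<Longrightarrow> trace \<omega> = 1 \<Longrightarrow> opt_val a \<rho> \<omega> \<le> N"
  and is_optD_gt_0: "is_opt a \<rho> N \<Longrightarrow> N > 0"
  by (auto simp: is_opt_def)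

lemma ln_le_interpolation:
  fixes x :: real
  assumes "x \<le> K0 powr u * K1 powr v" "x > 0" "K0 > 0" "K1 > 0"
  shows "ln x \<le> u * ln K0 + v * ln K1"
proof -
  have "ln x \<le> ln (K0 powr u * K1 powr v)" using assms by simp
  then show ?thesis using assms by (simp add: ln_mult ln_powr)
qed

lemma le_if_le_add_ln:
  fixes X Y k :: real
  assumes "\<And>\<kappa>. \<kappa> > 1 \<Longrightarrow> X \<le> Y + k * ln \<kappa>" "k > 0" shows "X \<le> Y"
proof (rule field_le_epsilon)
  fix e :: real assume "e > 0"
  then have "exp (e / k) > 1" using assms(2) by simp
  from assms(1)[OF this] show "X \<le> Y + e" using assms(2) by simp
qed

text \<open>For \<open>b > 0\<close> the value is homogeneous of degree \<open>- b\<close> in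
  \<open>\<sigma>\<close>, so raising a trace below 1 to exactly 1 can only lower it. This
  normalises the output of \<open>geometric_mean_density\<close>.\<close>

lemma opt_val_scaleR_ge:
  fixes \<rho> :: "complex^('x::finite \<times> 'y::finite)^('x \<times> 'y)" and R :: "complex^'d^('x \<times> 'y)"
  assumes \<rho>: "\<rho> = R ** adj R" and \<sigma>: "pd \<sigma>" "Re (trace \<sigma>) \<le> 1" and b: "0 < b" "b < 1"
  obtains \<omega> where "pd \<omega>" "trace \<omega> = 1" "opt_val b \<rho> \<omega> \<le> opt_val b \<rho> \<sigma>"
proof -
  define s where "s = Re (trace \<sigma>)"
  have s: "0 < s" "s \<le> 1"
  proof -
    show "s > 0"
    proof (rule ccontr)
      assume "\<not> s > 0"
      then have "\<sigma> = 0" using trace_psd_nonneg[OF pd_psd[OF \<sigma>(1)]] trace_psd_zero[OF pd_psd[OF \<sigma>(1)]] by (simp add: s_def)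
      moreover have "mpow \<sigma> (- 1) ** mpow \<sigma> 1 = mat 1" using \<sigma> by (simp add: mpow_add mpow_0)
      ultimately have "mpow \<sigma> (- 1) ** 0 = mat 1" using \<sigma> by (simp add: mpow_1)
      then have "(0 :: complex^'y^'y) = mat 1" by (simp add: vec_eq_iff matrix_nth_mult)
      then have "(0 :: complex^'y^'y) $ undefined $ undefined = (mat 1 :: complex^'y^'y) $ undefined $ undefined"
        by simp
      then show False by (simp add: mat_def)
    qed
  qed (use \<sigma> in \<open>simp add: s_def\<close>)
  have tr: "trace \<sigma> = complex_of_real s" using trace_psd_Im[OF pd_psd[OF \<sigma>(1)]] by (simp add: s_def complex_eq_iff)
  define \<omega> where "\<omega> = (1 / s) *\<^sub>R \<sigma>"
  have \<omega>: "pd \<omega>" "trace \<omega> = 1" using s \<sigma> tr by (simp_all add: \<omega>_def pd_scaleR trace_scaleR scaleR_conv_of_real[where 'a=complex])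
  have p: "psd (adj R ** emb (mpow \<sigma> (- b)) ** R)" using psd_conj[of "emb (mpow \<sigma> (- b))" "adj R"] \<sigma> by simp
  have "opt_val b \<rho> \<omega> = schatten (1 / (1 - b)) ((1 / s) powr (- b) *\<^sub>R (adj R ** emb (mpow \<sigma> (- b)) ** R))"
    unfolding \<rho> \<omega>_def using \<sigma> s by (simp add: opt_val_gram psd_scaleR mpow_scaleR emb_scaleR scaleR_mult_left scaleR_mult_right)
  also have "\<dots> = (1 / s) powr (- b) * schatten (1 / (1 - b)) (adj R ** emb (mpow \<sigma> (- b)) ** R)"
    using p s b trace_psd_nonneg[OF psd_mpow[OF p]] unfolding schatten_def
    by (simp add: mpow_scaleR trace_scaleR powr_mult powr_powr)
  also have "\<dots> = s powr b * opt_val b \<rho> \<sigma>" using \<sigma> s by (simp add: \<rho> opt_val_gram powr_minus powr_divide)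
  also have "\<dots> \<le> 1 * opt_val b \<rho> \<sigma>" using s b by (intro mult_right_mono powr_le1) (auto simp: opt_val_def)
  finally show ?thesis using that \<omega> by simp
qed

text \<open>A near-optimal density on the auxiliary space converts the quasi-norm of a negative
  exponent into a Frobenius norm that can be interpolated. The slack
  \<open>(\<kappa> - 1) * K\<close> makes the error multiplicative.\<close>

lemma purifying_density:
  fixes X :: "complex^'d^'n"
  assumes x: "0 < x" and K: "schatten (1 / (1 + x)) (adj X ** X) \<le> K" "K > 0" and \<kappa>: "\<kappa> > 1"
  obtains \<sigma> where "pd \<sigma>" "trace \<sigma> = 1" "(norm (X ** mpow \<sigma> (- x / 2)))\<^sup>2 \<le> \<kappa> * K"
proof -
  have "(\<kappa> - 1) * K > 0" using K \<kappa> by simp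
  then obtain \<sigma> where \<sigma>: "pd \<sigma>" "trace \<sigma> = 1"
    "Re (trace ((adj X ** X) ** mpow \<sigma> (- x))) \<le> schatten (1 / (1 + x)) (adj X ** X) + (\<kappa> - 1) * K"
    using reverse_holder_approx[OF psd_adj_mult x] by metis
  have "(norm (X ** mpow \<sigma> (- x / 2)))\<^sup>2 \<le> \<kappa> * K"
    using \<sigma> norm_mult_mpow_sq[of \<sigma> X "- x"] K by (simp add: algebra_simps)
  then show ?thesis using that \<sigma> by blast
qed

text \<open>The auxiliary index type \<open>'d\<close> is left free because
  \<open>chain_real_dual\<close> applies these results to a vector whose auxiliary space is indexed
  by \<open>'c\<close>.\<close>

context
  fixes R :: "complex^'d^('a::finite \<times> 'b::finite \<times> 'c::finite)" and \<rho> and a b c Na Nb Nc :: real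
  assumes \<rho>: "\<rho> = R ** adj R" and R0: "R \<noteq> 0"
    and rg: "- 1 < a" "a < 1" "- 1 < b" "b < 1" "- 1 < c" "c < 1"
    and rel: "1 / a = 1 / b + 1 / c"
    and Na: "is_opt a (regroup \<rho>) Na" and Nb: "is_opt b \<rho> Nb" and Nc: "is_opt c (ptrace1 \<rho>) Nc"
begin

text \<open>Any \<open>\<omega>\<close> bounds \<open>Na\<close> from above; the one paired with
  \<open>T\<close> in \<open>dual_witness\<close> allows the passage to a Frobenius norm.
  Near-optimal \<open>\<beta>\<close> and \<open>\<gamma>\<close> control the two ends in
  \<open>chain_ppp\<close>.\<close>

lemma chain_real_ppp:
  assumes s: "a > 0" "b > 0" "c > 0" shows "ln Na / a \<le> ln Nb / b + ln Nc / c"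
proof (rule le_if_le_add_ln)
  show "1 / b + 2 / c > 0" using s by (simp add: add_pos_pos)
  fix \<kappa> :: real assume \<kappa>: "\<kappa> > 1"
  have N: "Na > 0" "Nb > 0" "Nc > 0" using Na Nb Nc is_optD_gt_0 by blast+
  have abc: "a = b * c / (b + c)" using rel s by (simp add: field_simps)
  have "psd (ptrace1 \<rho>)" by (simp add: \<rho> psd_ptrace1)
  then obtain R' :: "complex^('b \<times> 'c)^('b \<times> 'c)" where R': "ptrace1 \<rho> = R' ** adj R'" using psd_gram by blast
  have "regroup_perm ** R \<noteq> 0" using R0 norm_regroup_perm_mult[of R] by (metis norm_eq_zero)
  then obtain \<omega> T where \<omega>: "pd \<omega>" "trace \<omega> = 1" and T: "pd T" "psd (\<kappa> *\<^sub>R \<omega> - ptrace1 T)"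
    and h: "schatten (1 / (1 - a)) (adj (regroup_perm ** R) ** emb (mpow \<omega> (- a)) ** (regroup_perm ** R))
      \<le> (norm (mpow T (a / 2) ** (emb (mpow \<omega> (- a / 2)) ** (regroup_perm ** R))))\<^sup>2"
    using dual_witness[OF s(1) rg(2) \<kappa>] by metis
  define T' where "T' = adj regroup_perm ** T ** regroup_perm"
  have T': "pd T'" "psd (\<kappa> *\<^sub>R \<omega> - ptrace1 (ptrace1 T'))" using T by (simp_all add: T'_def pd_regroup_perm ptrace1_regroup_perm)
  obtain \<beta> where \<beta>: "pd \<beta>" "trace \<beta> = 1" "opt_val b \<rho> \<beta> \<le> \<kappa> * Nb" using is_optD_pos_approx[OF Nb s(2) \<kappa>] by blast
  obtain \<gamma> where \<gamma>: "pd \<gamma>" "trace \<gamma> = 1" "opt_val c (ptrace1 \<rho>) \<gamma> \<le> \<kappa> * Nc" using is_optD_pos_approx[OF Nc s(3) \<kappa>] by blast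
  have "Na \<le> opt_val a (regroup \<rho>) \<omega>" by (rule is_optD_pos[OF Na s(1) \<omega>])
  also have "\<dots> \<le> (norm (mpow T (a / 2) ** (emb (mpow \<omega> (- a / 2)) ** (regroup_perm ** R))))\<^sup>2"
    using h \<omega> by (simp add: \<rho> regroup_gram opt_val_gram)
  also have "\<dots> = (norm (mpow T' (a / 2) ** (emb (emb (mpow \<omega> (- a / 2))) ** R)))\<^sup>2"
  proof -
    have "emb W ** (regroup_perm ** R) = regroup_perm ** (emb (emb W) ** R)" for W by (simp add: matrix_mul_assoc emb_regroup_perm)
    then have "mpow T' (a / 2) ** (emb (emb (mpow \<omega> (- a / 2))) ** R) = adj regroup_perm ** (mpow T (a / 2) ** (emb (mpow \<omega> (- a / 2)) ** (regroup_perm ** R)))"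
      unfolding T'_def mpow_regroup_perm[OF pd_herm[OF T(1)]] by (simp add: mult_right_assoc)
    then show ?thesis by (simp add: norm_adj_regroup_perm_mult)
  qed
  also have "\<dots> \<le> (\<kappa> powr c * (\<kappa> * Nc)) powr (a / c) * (\<kappa> * Nb) powr (a / b)"
    by (rule chain_ppp[OF T'(1) \<omega>(1) _ T'(2) \<beta>(1) _ \<gamma>(1) _ R'[symmetric, unfolded \<rho>]])
       (use s rg abc \<beta> \<gamma> \<kappa> N R' \<rho> in \<open>auto simp: opt_val_gram\<close>)
  finally have "ln Na \<le> (a / c) * ln (\<kappa> powr c * (\<kappa> * Nc)) + (a / b) * ln (\<kappa> * Nb)"
    by (rule ln_le_interpolation) (use \<kappa> N in auto)
  also have "\<dots> = a * (ln Nb / b + ln Nc / c + (1 / b + 1 / c + 1) * ln \<kappa>)"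
    using \<kappa> N s by (simp add: ln_mult ln_powr field_simps)
  finally have "ln Na / a \<le> ln Nb / b + ln Nc / c + (1 / b + 1 / c + 1) * ln \<kappa>"
    using s by (simp add: field_simps)
  also have "1 / b + 1 / c + 1 \<le> 1 / b + 2 / c" using s rg by (simp add: field_simps)
  finally show "ln Na / a \<le> ln Nb / b + ln Nc / c + (1 / b + 2 / c) * ln \<kappa>"
    using \<kappa> by (simp add: mult_right_mono)
qed

text \<open>For a near-maximiser \<open>T\<close> of the \<open>b\<close>-problem, the marginal
  \<open>ptrace1 T\<close> is an admissible density in the supremum for \<open>a\<close>, which
  bounds the end at 0 by \<open>Na\<close>.\<close>

lemma chain_real_mmp:
  assumes s: "a < 0" "b < 0" "c > 0" shows "ln Na / a \<le> ln Nb / b + ln Nc / c"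
proof (rule le_if_le_add_ln)
  define A B where "A = - a" and "B = - b"
  have AB: "a = - A" "b = - B" "A > 0" "B > 0" using s by (auto simp: A_def B_def)
  show "1 / B + 2 / A + 1 / c > 0" using s AB by (simp add: add_pos_pos)
  fix \<kappa> :: real assume \<kappa>: "\<kappa> > 1"
  have N: "Na > 0" "Nb > 0" "Nc > 0" using Na Nb Nc is_optD_gt_0 by blast+
  have abc: "B = A * c / (A + c)" using rel s AB by (simp add: field_simps)
  have "psd (ptrace1 \<rho>)" by (simp add: \<rho> psd_ptrace1)
  then obtain R' :: "complex^('b \<times> 'c)^('b \<times> 'c)" where R': "ptrace1 \<rho> = R' ** adj R'" using psd_gram by blast
  obtain T where T: "pd T" "trace T = 1" "Nb \<le> \<kappa> * opt_val b \<rho> T" using is_optD_neg_approx[OF Nb s(2) \<kappa>] by blast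
  have TC: "pd (ptrace1 T)" "trace (ptrace1 T) = 1" using T by (simp_all add: pd_ptrace1 trace_ptrace1)
  define X where "X = emb (emb (mpow (ptrace1 T) (A / 2))) ** R"
  have "adj X ** X = adj R ** emb (emb (mpow (ptrace1 T) (- a))) ** R"
    using TC AB by (simp add: X_def adj_mult adj_emb mult_right_assoc emb_emb_mult_left mpow_add)
  then have "schatten (1 / (1 + A)) (adj X ** X) = opt_val a (regroup \<rho>) (ptrace1 T)"
    using TC AB by (simp add: \<rho> opt_val_regroup)
  also have "\<dots> \<le> Na" by (rule is_optD_neg[OF Na s(1) TC])
  finally obtain \<sigma> where \<sigma>: "pd \<sigma>" "trace \<sigma> = 1" "(norm (X ** mpow \<sigma> (- A / 2)))\<^sup>2 \<le> \<kappa> * Na"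
    using purifying_density[OF AB(3) _ N(1) \<kappa>] by metis
  obtain \<gamma> where \<gamma>: "pd \<gamma>" "trace \<gamma> = 1" "opt_val c (ptrace1 \<rho>) \<gamma> \<le> \<kappa> * Nc" using is_optD_pos_approx[OF Nc s(3) \<kappa>] by blast
  have "opt_val b \<rho> T = schatten (1 / (1 + B)) (adj R ** emb (mpow T B) ** R)" using T AB by (simp add: \<rho> opt_val_gram)
  also have "adj R ** emb (mpow T B) ** R = adj (emb (mpow T (B / 2)) ** R) ** (emb (mpow T (B / 2)) ** R)"
    using T by (simp add: adj_mult adj_emb mult_right_assoc emb_mult_left mpow_add)
  also have "schatten (1 / (1 + B)) \<dots> \<le> Re (trace (\<dots> ** mpow \<sigma> (- B)))"
    using \<sigma> AB by (intro reverse_holder_trace) auto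
  also have "\<dots> = (norm (emb (mpow T (B / 2)) ** R ** mpow \<sigma> (- B / 2)))\<^sup>2"
    using \<sigma> norm_mult_mpow_sq[of \<sigma> "emb (mpow T (B / 2)) ** R" "- B"] by simp
  also have "\<dots> = (norm (emb (mpow T (B / 2)) ** (R ** mpow \<sigma> (- B / 2))))\<^sup>2" by (simp add: mult_right_assoc)
  also have "\<dots> \<le> (\<kappa> * Na) powr (B / A) * (\<kappa> * Nc) powr (B / c)"
    by (rule chain_mmp[OF T(1) \<sigma>(1) \<gamma>(1) _ R'[symmetric, unfolded \<rho>]])
       (use s rg abc \<sigma> \<gamma> \<kappa> N R' \<rho> AB in \<open>auto simp: opt_val_gram X_def mult_right_assoc\<close>)
  finally have le: "opt_val b \<rho> T \<le> (\<kappa> * Na) powr (B / A) * (\<kappa> * Nc) powr (B / c)" .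
  have "Nb \<le> \<kappa> * ((\<kappa> * Na) powr (B / A) * (\<kappa> * Nc) powr (B / c))"
    by (rule order_trans[OF T(3) mult_left_mono[OF le]]) (use \<kappa> in simp)
  then have "Nb / \<kappa> \<le> (\<kappa> * Na) powr (B / A) * (\<kappa> * Nc) powr (B / c)"
    using \<kappa> by (simp only: pos_divide_le_eq mult.commute[of _ \<kappa>])
  then have "ln (Nb / \<kappa>) \<le> (B / A) * ln (\<kappa> * Na) + (B / c) * ln (\<kappa> * Nc)"
    by (rule ln_le_interpolation) (use \<kappa> N in auto)
  then have "ln Nb \<le> B * (ln Na / A + ln Nc / c + (1 / B + 1 / A + 1 / c) * ln \<kappa>)"
    using \<kappa> N s AB by (simp add: ln_mult ln_div ring_distribs)
  then have "ln Nb / B \<le> ln Na / A + ln Nc / c + (1 / B + 1 / A + 1 / c) * ln \<kappa>"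
    using AB by (simp add: pos_divide_le_eq mult.commute)
  also have "(1 / B + 1 / A + 1 / c) * ln \<kappa> \<le> (1 / B + 2 / A + 1 / c) * ln \<kappa>"
    using \<kappa> AB by (intro mult_right_mono) (auto simp: divide_right_mono)
  finally show "ln Na / a \<le> ln Nb / b + ln Nc / c + (1 / B + 2 / A + 1 / c) * ln \<kappa>"
    using AB by simp
qed

text \<open>A near-maximiser \<open>\<tau>\<close> for \<open>c\<close> is also admissible in the
  supremum for \<open>a\<close>, since both condition on the same system. The matrix
  \<open>\<sigma>'\<close> of \<open>chain_mpm\<close> then serves as test matrix in reverse Hoelder
  for the \<open>c\<close>-value.\<close>

lemma chain_real_mpm:
  assumes s: "a < 0" "b > 0" "c < 0" shows "ln Na / a \<le> ln Nb / b + ln Nc / c"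
proof (rule le_if_le_add_ln)
  define A C where "A = - a" and "C = - c"
  have AC: "a = - A" "c = - C" "A > 0" "C > 0" using s by (auto simp: A_def C_def)
  show "1 / C + 1 / A + 1 / b > 0" using s AC by (simp add: add_pos_pos)
  fix \<kappa> :: real assume \<kappa>: "\<kappa> > 1"
  have N: "Na > 0" "Nb > 0" "Nc > 0" using Na Nb Nc is_optD_gt_0 by blast+
  have abc: "C = A * b / (A + b)" using rel s AC by (simp add: field_simps)
  have "psd (ptrace1 \<rho>)" by (simp add: \<rho> psd_ptrace1)
  then obtain R' :: "complex^('b \<times> 'c)^('b \<times> 'c)" where R': "ptrace1 \<rho> = R' ** adj R'" using psd_gram by blast
  obtain \<tau> where \<tau>: "pd \<tau>" "trace \<tau> = 1" "Nc \<le> \<kappa> * opt_val c (ptrace1 \<rho>) \<tau>" using is_optD_neg_approx[OF Nc s(3) \<kappa>] by blast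
  define X where "X = emb (emb (mpow \<tau> (A / 2))) ** R"
  have "adj X ** X = adj R ** emb (emb (mpow \<tau> (- a))) ** R"
    using \<tau> AC by (simp add: X_def adj_mult adj_emb mult_right_assoc emb_emb_mult_left mpow_add)
  then have "schatten (1 / (1 + A)) (adj X ** X) = opt_val a (regroup \<rho>) \<tau>"
    using \<tau> AC by (simp add: \<rho> opt_val_regroup)
  also have "\<dots> \<le> Na" by (rule is_optD_neg[OF Na s(1) \<tau>(1,2)])
  finally obtain \<sigma> where \<sigma>: "pd \<sigma>" "trace \<sigma> = 1" "(norm (X ** mpow \<sigma> (- A / 2)))\<^sup>2 \<le> \<kappa> * Na"
    using purifying_density[OF AC(3) _ N(1) \<kappa>] by metis
  obtain \<omega> where \<omega>: "pd \<omega>" "trace \<omega> = 1" "opt_val b \<rho> \<omega> \<le> \<kappa> * Nb" using is_optD_pos_approx[OF Nb s(2) \<kappa>] by blast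
  obtain \<sigma>' :: "complex^('b \<times> 'c)^('b \<times> 'c)" where \<sigma>': "pd \<sigma>'" "Re (trace \<sigma>') \<le> 1"
    "(norm (emb (mpow \<sigma>' (- C / 2) ** emb (mpow \<tau> (C / 2))) ** R))\<^sup>2 \<le> (\<kappa> * Na) powr (C / A) * (\<kappa> * Nb) powr (C / b)"
    by (rule chain_mpm[of \<tau> \<omega> \<sigma> A b C R "\<kappa> * Na" "\<kappa> * Nb"])
       (use s rg abc \<sigma> \<omega> \<tau> \<kappa> N \<rho> AC in \<open>auto simp: opt_val_gram X_def mult_right_assoc\<close>)
  define P where "P = emb (mpow \<tau> (C / 2)) ** ptrace1 \<rho> ** emb (mpow \<tau> (C / 2))"
  have PP: "P = (emb (mpow \<tau> (C / 2)) ** R') ** adj (emb (mpow \<tau> (C / 2)) ** R')"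
    using \<tau> by (simp add: P_def R' adj_mult adj_emb mult_right_assoc)
  have "opt_val c (ptrace1 \<rho>) \<tau> = schatten (1 / (1 + C)) P" by (simp add: opt_val_def P_def AC)
  also have "\<dots> \<le> Re (trace (P ** mpow \<sigma>' (- C)))"
    using \<sigma>' AC unfolding PP by (intro reverse_holder_trace) auto
  also have "\<dots> = Re (trace (mpow \<sigma>' (- C) ** P))" by (subst trace_mul_sym) (rule refl)
  also have "\<dots> = (norm (mpow \<sigma>' (- C / 2) ** (emb (mpow \<tau> (C / 2)) ** R')))\<^sup>2"
    using norm_mpow_mult_sq[of \<sigma>' "- C" "emb (mpow \<tau> (C / 2)) ** R'"] \<sigma>' by (simp add: PP)
  also have "mpow \<sigma>' (- C / 2) ** (emb (mpow \<tau> (C / 2)) ** R') = (mpow \<sigma>' (- C / 2) ** emb (mpow \<tau> (C / 2))) ** R'"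
    by (simp add: mult_right_assoc)
  also have "norm \<dots> = norm (emb (mpow \<sigma>' (- C / 2) ** emb (mpow \<tau> (C / 2))) ** R)"
    by (rule norm_emb_reduce[symmetric]) (use R' \<rho> in simp)
  also note \<sigma>'(3)
  finally have le: "opt_val c (ptrace1 \<rho>) \<tau> \<le> (\<kappa> * Na) powr (C / A) * (\<kappa> * Nb) powr (C / b)" .
  have "Nc \<le> \<kappa> * ((\<kappa> * Na) powr (C / A) * (\<kappa> * Nb) powr (C / b))"
    by (rule order_trans[OF \<tau>(3) mult_left_mono[OF le]]) (use \<kappa> in simp)
  then have "Nc / \<kappa> \<le> (\<kappa> * Na) powr (C / A) * (\<kappa> * Nb) powr (C / b)"
    using \<kappa> by (simp only: pos_divide_le_eq mult.commute[of _ \<kappa>])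
  then have "ln (Nc / \<kappa>) \<le> (C / A) * ln (\<kappa> * Na) + (C / b) * ln (\<kappa> * Nb)"
    by (rule ln_le_interpolation) (use \<kappa> N in auto)
  then have "ln Nc \<le> C * (ln Na / A + ln Nb / b + (1 / C + 1 / A + 1 / b) * ln \<kappa>)"
    using \<kappa> N s AC by (simp add: ln_mult ln_div ring_distribs)
  then have "ln Nc / C \<le> ln Na / A + ln Nb / b + (1 / C + 1 / A + 1 / b) * ln \<kappa>"
    using AC by (simp add: pos_divide_le_eq mult.commute)
  then show "ln Na / a \<le> ln Nb / b + ln Nc / c + (1 / C + 1 / A + 1 / b) * ln \<kappa>"
    using AC by simp
qed

text \<open>The near-minimiser \<open>\<omega>\<close> for \<open>a\<close> is inserted into the
  supremum for \<open>c\<close>, which has the same conditioning system. The normalised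
  \<open>\<sigma>'\<close> of \<open>chain_ppm\<close> is a candidate for \<open>b\<close>, so here
  \<open>Nb\<close> is bounded from above, whence the direction of the inequality.\<close>

lemma chain_real_ppm:
  assumes s: "a > 0" "b > 0" "c < 0" shows "ln Nb / b + ln Nc / c \<le> ln Na / a"
proof (rule le_if_le_add_ln)
  define C where "C = - c"
  have C: "c = - C" "C > 0" "C < 1" using s rg by (auto simp: C_def)
  show "1 / a + 1 / C > 0" using s C by (simp add: add_pos_pos)
  fix \<kappa> :: real assume \<kappa>: "\<kappa> > 1"
  have N: "Na > 0" "Nb > 0" "Nc > 0" using Na Nb Nc is_optD_gt_0 by blast+
  have abc: "b = a * C / (a + C)" using rel s C by (simp add: field_simps)
  have "psd (ptrace1 \<rho>)" by (simp add: \<rho> psd_ptrace1)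
  then obtain R' :: "complex^('b \<times> 'c)^('b \<times> 'c)" where R': "ptrace1 \<rho> = R' ** adj R'" using psd_gram by blast
  obtain \<omega> where \<omega>: "pd \<omega>" "trace \<omega> = 1" "opt_val a (regroup \<rho>) \<omega> \<le> \<kappa> * Na" using is_optD_pos_approx[OF Na s(1) \<kappa>] by blast
  define X where "X = adj R' ** emb (mpow \<omega> (C / 2))"
  have "adj X ** X = emb (mpow \<omega> (C / 2)) ** ptrace1 \<rho> ** emb (mpow \<omega> (C / 2))"
    using \<omega> by (simp add: X_def R' adj_mult adj_emb mult_right_assoc)
  then have "schatten (1 / (1 + C)) (adj X ** X) = opt_val c (ptrace1 \<rho>) \<omega>" by (simp add: opt_val_def C)
  also have "\<dots> \<le> Nc" by (rule is_optD_neg[OF Nc s(3) \<omega>(1,2)])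
  finally obtain \<sigma> where \<sigma>: "pd \<sigma>" "trace \<sigma> = 1" "(norm (X ** mpow \<sigma> (- C / 2)))\<^sup>2 \<le> \<kappa> * Nc"
    using purifying_density[OF C(2) _ N(3) \<kappa>] by metis
  have "norm (X ** mpow \<sigma> (- C / 2)) = norm (adj (X ** mpow \<sigma> (- C / 2)))" by simp
  also have "adj (X ** mpow \<sigma> (- C / 2)) = (mpow \<sigma> (- C / 2) ** emb (mpow \<omega> (C / 2))) ** R'"
    using \<sigma> \<omega> by (simp add: X_def adj_mult adj_emb mult_right_assoc)
  also have "norm \<dots> = norm (emb (mpow \<sigma> (- C / 2) ** emb (mpow \<omega> (C / 2))) ** R)"
    by (rule norm_emb_reduce[symmetric]) (use R' \<rho> in simp)
  finally have K1: "(norm (emb (mpow \<sigma> (- C / 2) ** emb (mpow \<omega> (C / 2))) ** R))\<^sup>2 \<le> \<kappa> * Nc" using \<sigma>(3) by simp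
  obtain \<sigma>' :: "complex^('b \<times> 'c)^('b \<times> 'c)" where \<sigma>': "pd \<sigma>'" "Re (trace \<sigma>') \<le> 1"
    "schatten (1 / (1 - b)) (adj R ** emb (mpow \<sigma>' (- b)) ** R) \<le> (\<kappa> * Na) powr (b / a) * (\<kappa> * Nc) powr (b / C)"
    by (rule chain_ppm[of \<omega> \<sigma> a C b R "\<kappa> * Na" "\<kappa> * Nc"])
       (use s rg abc \<sigma> \<omega> \<kappa> N \<rho> C K1 in \<open>auto simp: opt_val_regroup\<close>)
  obtain \<beta> where \<beta>: "pd \<beta>" "trace \<beta> = 1" "opt_val b \<rho> \<beta> \<le> opt_val b \<rho> \<sigma>'"
    by (rule opt_val_scaleR_ge[OF \<rho> \<sigma>'(1,2) s(2) rg(4)])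
  have "Nb \<le> opt_val b \<rho> \<beta>" by (rule is_optD_pos[OF Nb s(2) \<beta>(1,2)])
  also note \<beta>(3)
  also have "opt_val b \<rho> \<sigma>' \<le> (\<kappa> * Na) powr (b / a) * (\<kappa> * Nc) powr (b / C)"
    using \<sigma>' by (simp add: \<rho> opt_val_gram)
  finally have "ln Nb \<le> (b / a) * ln (\<kappa> * Na) + (b / C) * ln (\<kappa> * Nc)"
    by (rule ln_le_interpolation) (use \<kappa> N in auto)
  also have "\<dots> = b * (ln Na / a + ln Nc / C + (1 / a + 1 / C) * ln \<kappa>)"
    using \<kappa> N s C by (simp add: ln_mult ring_distribs)
  finally have "ln Nb / b \<le> ln Na / a + ln Nc / C + (1 / a + 1 / C) * ln \<kappa>"
    using s by (simp add: pos_divide_le_eq mult.commute)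
  then show "ln Nb / b + ln Nc / c \<le> ln Na / a + (1 / a + 1 / C) * ln \<kappa>"
    using C by simp
qed

end

text \<open>For a purifying system \<open>D\<close>, duality turns the claim for \<open>(A, B, C)\<close> with exponents \<open>a, b, c\<close> into the
  claim for \<open>(B, A, D)\<close> with exponents \<open>- a, - c, - b\<close>.\<close>

lemma chain_real_dual:
  fixes R :: "complex^'d^('a::finite \<times> 'b::finite \<times> 'c::finite)" and \<rho> and a b c Na Nb Nc :: real
  assumes \<rho>: "\<rho> = R ** adj R" and R0: "R \<noteq> 0"
    and rg: "- 1 < a" "a < 1" "- 1 < b" "b < 1" "- 1 < c" "c < 1"
    and rel: "1 / a = 1 / b + 1 / c"
    and Na: "is_opt a (regroup \<rho>) Na" and Nb: "is_opt b \<rho> Nb" and Nc: "is_opt c (ptrace1 \<rho>) Nc"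
    and s: "b < 0" "a < 0 \<and> c < 0 \<or> a > 0 \<and> c > 0"
  shows "ln Nb / b + ln Nc / c \<le> ln Na / a"
proof -
  \<comment> \<open>All three hold the coefficients of one four-party vector in different groupings:
    \<open>S\<close> has auxiliary space \<open>'c\<close>, while \<open>R1\<close> and
    \<open>S1\<close> are square roots of \<open>ptrace1 \<rho>\<close> and
    \<open>ptrace1 \<rho>'\<close>.\<close>
  define S :: "complex^'c^('b \<times> 'a \<times> 'd)" where "S = (\<chi> p k. R $ (fst (snd p), fst p, k) $ snd (snd p))"
  define S1 :: "complex^('b \<times> 'c)^('a \<times> 'd)" where "S1 = (\<chi> p q. R $ (fst p, fst q, snd q) $ snd p)"
  define R1 :: "complex^('a \<times> 'd)^('b \<times> 'c)" where "R1 = (\<chi> q p. R $ (fst p, fst q, snd q) $ snd p)"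
  define \<rho>' where "\<rho>' = S ** adj S"
  have S0: "S \<noteq> 0"
  proof
    assume "S = 0"
    then have "S $ (j, i, m) $ k = 0" for i j k m by simp
    then show False using R0 by (auto simp: S_def vec_eq_iff)
  qed
  have R1: "ptrace1 \<rho> = R1 ** adj R1"
    by (simp add: vec_eq_iff \<rho> ptrace1_def matrix_nth_mult R1_def sum_prod_UNIV)
  have S1: "ptrace1 \<rho>' = S1 ** adj S1"
    by (simp add: vec_eq_iff \<rho>'_def ptrace1_def matrix_nth_mult S1_def S_def sum_prod_UNIV)
  have R10: "R1 \<noteq> 0"
  proof
    assume "R1 = 0"
    then have "R1 $ (j, k) $ (i, m) = 0" for i j k m by simp
    then show False using R0 by (auto simp: R1_def vec_eq_iff)
  qed
  have Rg0: "regroup_perm ** R \<noteq> 0" using R0 norm_regroup_perm_mult[of R] by (metis norm_eq_zero)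
  have nz: "a \<noteq> 0" "b \<noteq> 0" "c \<noteq> 0" using s by auto
  \<comment> \<open>Duality pairs AB|C with BA|D and, below, A|BC with A|D and B|C with B|AD; this
    is why \<open>b\<close> and \<open>c\<close> trade places.\<close>
  have "is_opt (- a) ((regroup_perm ** S) ** adj (regroup_perm ** S)) Na"
  proof (rule is_opt_dual[OF _ _ rg(1,2) nz(1) Na[unfolded \<rho> regroup_gram] Rg0])
    show "bij (prod.swap :: 'b \<times> 'a \<Rightarrow> 'a \<times> 'b)" by simp
    show "(regroup_perm ** S) $ (u, z) $ y = (regroup_perm ** R) $ (prod.swap u, y) $ z" for u z y
      by (simp add: regroup_perm_mult_nth S_def)
  qed
  then have Na': "is_opt (- a) (regroup \<rho>') Na" by (simp add: \<rho>'_def regroup_gram)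
  have "is_opt (- b) (S1 ** adj S1) Nb"
    by (rule is_opt_dual[where \<pi> = id, OF _ _ rg(3,4) nz(2) Nb[unfolded \<rho>] R0]) (auto simp: S1_def)
  then have Nb': "is_opt (- b) (ptrace1 \<rho>') Nb" by (simp add: S1)
  have "is_opt (- c) (S ** adj S) Nc"
    by (rule is_opt_dual[where \<pi> = id, OF _ _ rg(5,6) nz(3) Nc[unfolded R1] R10]) (auto simp: S_def R1_def)
  then have Nc': "is_opt (- c) \<rho>' Nc" by (simp add: \<rho>'_def)
  have rel': "1 / - a = 1 / - c + 1 / - b" using rel by simp
  have rg': "- 1 < - a" "- a < 1" "- 1 < - c" "- c < 1" "- 1 < - b" "- b < 1" using rg by auto
  have "ln Na / - a \<le> ln Nc / - c + ln Nb / - b"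
  proof (cases "a < 0")
    case True
    then show ?thesis using s by (intro chain_real_ppp[OF \<rho>'_def S0 rg' rel' Na' Nc' Nb']) auto
  next
    case False
    then show ?thesis using s by (intro chain_real_mmp[OF \<rho>'_def S0 rg' rel' Na' Nc' Nb']) auto
  qed
  then show ?thesis by simp
qed

lemma psd_regroup: "psd \<rho> \<Longrightarrow> psd (regroup \<rho>)"
  by (simp add: regroup_regroup_perm psd_conj)

lemma trace_regroup: "trace (regroup \<rho>) = trace \<rho>"
  using trace_mul_sym[of regroup_perm "\<rho> ** adj regroup_perm"] by (simp add: regroup_regroup_perm mult_right_assoc adj_regroup_perm_mult)

theorem theorem1:
  fixes \<rho> :: "complex^('a::finite \<times> 'b::finite \<times> 'c::finite)^('a \<times> 'b \<times> 'c)"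
    and \<alpha> \<beta> \<gamma> :: real
  assumes rho: "density \<rho>"
    and a: "\<alpha> \<in> {1/2<..<1} \<union> {1<..}"
    and b: "\<beta> \<in> {1/2<..<1} \<union> {1<..}"
    and c: "\<gamma> \<in> {1/2<..<1} \<union> {1<..}"
    and rel: "\<alpha> / (\<alpha> - 1) = \<beta> / (\<beta> - 1) + \<gamma> / (\<gamma> - 1)"
  shows "((\<alpha> - 1) * (\<beta> - 1) * (\<gamma> - 1) > 0 \<longrightarrow>
            cond_renyi \<alpha> (regroup \<rho>) \<ge> cond_renyi \<beta> \<rho> + cond_renyi \<gamma> (ptrace1 \<rho>))
       \<and> ((\<alpha> - 1) * (\<beta> - 1) * (\<gamma> - 1) < 0 \<longrightarrow>
            cond_renyi \<alpha> (regroup \<rho>) \<le> cond_renyi \<beta> \<rho> + cond_renyi \<gamma> (ptrace1 \<rho>))"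
proof -
  have \<rho>: "psd \<rho>" "trace \<rho> = 1" using rho by (auto simp: density_def)
  obtain R :: "complex^('a \<times> 'b \<times> 'c)^('a \<times> 'b \<times> 'c)" where R: "\<rho> = R ** adj R" using psd_gram[OF \<rho>(1)] by blast
  have R0: "R \<noteq> 0"
  proof
    assume R0: "R = 0"
    have "\<rho> = 0" unfolding R R0 by (simp add: vec_eq_iff matrix_nth_mult)
    then show False using \<rho>(2) by (simp add: trace_def)
  qed
  have d: "density (regroup \<rho>)" "density (ptrace1 \<rho>)"
    using \<rho> by (simp_all add: density_def psd_regroup trace_regroup psd_ptrace1 trace_ptrace1)
  \<comment> \<open>The substitution \<open>x \<mapsto> (x - 1) / x\<close> turns the relation into
    \<open>1 / p = 1 / q + 1 / r\<close>, and the lower bound 1/2 on the parameters becomes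
    \<open>- 1\<close>.\<close>
  have red: "- 1 < (x - 1) / x \<and> (x - 1) / x < 1 \<and> (x - 1) / x \<noteq> 0 \<and> x = 1 / (1 - (x - 1) / x)
      \<and> 1 / ((x - 1) / x) = x / (x - 1) \<and> ((x - 1) / x > 0 \<longleftrightarrow> x - 1 > 0)"
    if "x \<in> {1/2<..<1} \<union> {1<..}" for x :: real
    using that by (auto simp: field_simps)
  define p q r where "p = (\<alpha> - 1) / \<alpha>" and "q = (\<beta> - 1) / \<beta>" and "r = (\<gamma> - 1) / \<gamma>"
  have p: "- 1 < p" "p < 1" "p \<noteq> 0" "\<alpha> = 1 / (1 - p)" "1 / p = \<alpha> / (\<alpha> - 1)" "p > 0 \<longleftrightarrow> \<alpha> - 1 > 0"
    using red[OF a] unfolding p_def by auto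
  have q: "- 1 < q" "q < 1" "q \<noteq> 0" "\<beta> = 1 / (1 - q)" "1 / q = \<beta> / (\<beta> - 1)" "q > 0 \<longleftrightarrow> \<beta> - 1 > 0"
    using red[OF b] unfolding q_def by auto
  have r: "- 1 < r" "r < 1" "r \<noteq> 0" "\<gamma> = 1 / (1 - r)" "1 / r = \<gamma> / (\<gamma> - 1)" "r > 0 \<longleftrightarrow> \<gamma> - 1 > 0"
    using red[OF c] unfolding r_def by auto
  have rel': "1 / p = 1 / q + 1 / r" using rel p(5) q(5) r(5) by simp
  have nz: "\<sigma> \<noteq> 0" if "density \<sigma>" for \<sigma> :: "complex^'n^'n" using that by (auto simp: density_def trace_def)
  obtain Na where Na: "is_opt p (regroup \<rho>) Na"
    using is_opt_exists[OF _ nz[OF d(1)] p(1-3)] d(1) by (auto simp: density_def)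
  obtain Nb where Nb: "is_opt q \<rho> Nb"
    using is_opt_exists[OF _ nz[OF rho] q(1-3)] rho by (auto simp: density_def)
  obtain Nc where Nc: "is_opt r (ptrace1 \<rho>) Nc"
    using is_opt_exists[OF _ nz[OF d(2)] r(1-3)] d(2) by (auto simp: density_def)
  note H = cond_renyi_is_opt[OF d(1) p(1-4) Na] cond_renyi_is_opt[OF rho q(1-4) Nb] cond_renyi_is_opt[OF d(2) r(1-4) Nc]
  note args = R R0 p(1,2) q(1,2) r(1,2) rel' Na Nb Nc
  \<comment> \<open>The reciprocal relation excludes one sign pattern for each sign of the product,
    which leaves three patterns per inequality.\<close>
  have no1: False if "p > 0" "q < 0" "r < 0"
  proof -
    have "1 / p > 0" "1 / q < 0" "1 / r < 0" using that by simp_all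
    then show False using rel' by linarith
  qed
  have no2: False if "p < 0" "q > 0" "r > 0"
  proof -
    have "1 / p < 0" "1 / q > 0" "1 / r > 0" using that by simp_all
    then show False using rel' by linarith
  qed
  have sgn: "(\<alpha> - 1 > 0) = (p > 0)" "(\<beta> - 1 > 0) = (q > 0)" "(\<gamma> - 1 > 0) = (r > 0)"
    "(\<alpha> - 1 < 0) = (p < 0)" "(\<beta> - 1 < 0) = (q < 0)" "(\<gamma> - 1 < 0) = (r < 0)"
    using p(3,6) q(3,6) r(3,6) a b c by auto
  show ?thesis
  proof (intro conjI impI)
    assume "(\<alpha> - 1) * (\<beta> - 1) * (\<gamma> - 1) > 0"
    then have "p > 0 \<and> q > 0 \<and> r > 0 \<or> p < 0 \<and> q > 0 \<and> r < 0 \<or> p < 0 \<and> q < 0 \<and> r > 0"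
      using no1 sgn by (auto simp: zero_less_mult_iff mult_less_0_iff)
    then have "ln Na / p \<le> ln Nb / q + ln Nc / r"
      using chain_real_ppp[OF args] chain_real_mpm[OF args] chain_real_mmp[OF args] by blast
    then show "cond_renyi \<alpha> (regroup \<rho>) \<ge> cond_renyi \<beta> \<rho> + cond_renyi \<gamma> (ptrace1 \<rho>)"
      unfolding H by simp
  next
    assume "(\<alpha> - 1) * (\<beta> - 1) * (\<gamma> - 1) < 0"
    then have "p < 0 \<and> q < 0 \<and> r < 0 \<or> p > 0 \<and> q > 0 \<and> r < 0 \<or> p > 0 \<and> q < 0 \<and> r > 0"
      using no2 sgn by (auto simp: zero_less_mult_iff mult_less_0_iff)
    then have "ln Nb / q + ln Nc / r \<le> ln Na / p"
      using chain_real_ppm[OF args] chain_real_dual[OF args] by blast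
    then show "cond_renyi \<alpha> (regroup \<rho>) \<le> cond_renyi \<beta> \<rho> + cond_renyi \<gamma> (ptrace1 \<rho>)"
      unfolding H by simp
  qed
qed

end
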